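(* Let $X = \{a',b',x,y\}$, $Y = \{a,b,e\}$, $Z = X\cup Y$ (seven distinct letters), $F = \mathbb{K}\langle Z\rangle$, and let $I\subset F$ be the two-sided ideal generated by the following noncommutative polynomials: (i) $a'x - xa'$, $b'x - xe$; (ii) $a'a - aa'$, $a'b - ab'$, $b'a - ba'$, $b'b - bb'$, $a'e - ab$, $b'e - b^2$; (iii) $ay - y^2$, $by - y^2$, $a'y - y^2$, $b'y - y^2$; (iv) $xy$. Let $A = F/I$ be the corresponding finitely presented graded algebra. Fix on $F$ the graded (left) lexicographic monomial ordering with $a'\succ b'\succ a\succ b\succ e\succ x\succ y$, let $J=\mathrm{LM}(I)$ be the leading monomial ideal of $I$ and let $B = F/J$. Let $D\subset\{a,b\}^*$ be the Dyck language of all words of balanced brackets $a$ (left), $b$ (right), including the empty word, and let $L=(De)^*\subset Y^*$. Then $L_1(B)$ is the disjoint union of the finite set of the leading monomials of the binomials (i)-(iii) with the unambiguous context-free language $x L y$. It follows that $A$ and $B$ both have global dimension $3$, where $$L_2(B) = \{a',b'\} \{a,b\} y\cup \{a',b'\} x L y.$$ Then, the monomial algebra $B$ is homologically unambiguous and the Hilbert series $\mathrm{HS}(A) = \mathrm{HS}(B)$ is an algebraic function. Precisely, the Euler characteristic $E=1/\mathrm{HS}(A)$ satisfies the quadratic equation $$E^2 + (2 t - 1)(5 t^2 - 10 t + 2) E + (2 t - 1)(13 t^5 - 56 t^4 + 85 t^3 - 50 t^2 + 12 t - 1) = 0$$ and we have that $$\mathrm{HS}(A) = \left( 1 - 7 t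 + \frac{25}{2} t^2 - 5 t^3 + t^2\,\frac{\sqrt{1-4t^2}}{2} \right)^{-1}.$$
   Context: $\mathbb{K}$ is any field. $Z^*$ is the free monoid of words on $Z$, $|w|$ is the length of a word $w$, and the product of languages is $MM'=\{ww'\mid w\in M,w'\in M'\}$; $M^*=\bigcup_{d\ge 0}M^d$ with $M^0=\{1\}$. $F=\mathbb{K}\langle Z\rangle$ is the free associative algebra, graded by length. The Dyck language $D$ is generated by the grammar $T\to 1\mid a\,T\,b\,T$. For $0\ne f\in F$, the leading monomial $\mathrm{lm}(f)$ is the largest word occurring in $f$ with respect to the fixed monomial ordering (words are compared first by length, then lexicographically from the left), and $\mathrm{LM}(I)$ is the two-sided ideal generated by $\{\mathrm{lm}(f)\mid 0\neq f\in I\}$. The Hilbert series of a graded algebra $A=\bigoplus_{d\ge0}A_d$ is $\mathrm{HS}(A)=\sum_{d\ge 0}(\dim A_d)t^d$; $\sqrt{1-4t^2}$ denotes the power series with constant term $1$. A power series is an algebraic function if it is algebraic over the rational function field $\mathbb{K}(t)$. A monomial ideal is a two-sided ideal $J$ of $F$ generated by words; it has a unique minimal monomial basis, i.e. a generating set of words which is an antichain (no word of it is a subword of a different word of it). A monomial algebra is $B=F/J$ with $J$ a monomial ideal; $N(J)=Z^*\setminus J$ is its set of normal words. Chain languages $L_i=L_i(B)$ (when the words of the minimal monomial basis have length at least $2$): $L_0=Z$, and $L_1$ is the minimal monomial basis of $J$. Each $w\in L_1$ is written $w=st$ with $s\in L_0$ its first letter (its prefix $0$-chain) and $t\in N(J)$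 (its tail). Inductively, for $i\ge 1$, suppose each $w\in L_i$ is written $w=st$ with prefix $(i-1)$-chain $s\in L_{i-1}$ and tail $t\in N(J)$. Let $\bar L'_{i+1}$ be the set of pairs $(w,u)$ with $w=st\in L_i$, $u\in Z^*$, such that there exist $w'\in L_1$ and $v\in Z^*$ with $wu=vw'$, $|u|<|w'|$, $|v|\ge |s|$. Let $\bar L_{i+1}$ be the set of those $(w,u)\in\bar L'_{i+1}$ for which there is no $(w,u_1)\in\bar L'_{i+1}$ with $u_1$ a proper prefix of $u$. Then $L_{i+1}=\{wu\mid (w,u)\in\bar L_{i+1}\}$, where $wu$ has prefix $i$-chain $w$ and tail $u$. These languages give the minimal graded free right $B$-module resolution $\cdots\to\mathbb{K}L_1\otimes B\to\mathbb{K}L_0\otimes B\to B\to\mathbb{K}\to 0$. The global (homological) dimension of a connected graded algebra is the length of the minimal graded free resolution of $\mathbb{K}$; for the monomial algebra $B$ it is $k+1$ if $k$ is the largest index with $L_k(B)\neq\emptyset$. A context-free grammar is unambiguous if every word of the language it generates has a unique leftmost derivation from the start variable; a language is an unambiguous context-free language if it is generated by some unambiguous context-free grammar. A monomial algebra $B$ (with all words of $L_1(B)$ of length at least $2$) is called homologically unambiguous if all chain languages $L_i(B)$ $(i\ge 1)$ are unambiguous context-free languages. *)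

theory Defs
  imports
    "HOL-Library.Poly_Mapping"
    "HOL-Library.Sublist"
    "HOL-Computational_Algebra.Formal_Laurent_Series"
    "HOL-Computational_Algebra.Polynomial_FPS"
    "HOL-Algebra.QuotRing"
    "HOL-Algebra.Embedded_Algebras"
    "HOL-Algebra.Algebraic_Closure_Type"
begin

section \<open>Languages\<close>

definition conc :: "'z list set \<Rightarrow> 'z list set \<Rightarrow> 'z list set" where
  "conc M N = {u @ v | u v. u \<in> M \<and> v \<in> N}"

definition lang_star :: "'z list set \<Rightarrow> 'z list set" where
  "lang_star M = (\<Union>d. (conc M ^^ d) {[]})"

text \<open>
  A context-free grammar is a finite set of productions together with a start variable.
  Variables are natural numbers (any finite set of variables can be renamed to such); a
  sentential form is a list over variables (\<open>Inl\<close>) and terminals (\<open>Inr\<close>).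
\<close>

type_synonym 'z productions = "(nat \<times> (nat + 'z) list) set"

definition step :: "'z productions \<Rightarrow> (nat + 'z) list \<Rightarrow> (nat + 'z) list \<Rightarrow> bool" where
  "step P \<phi> \<psi> \<longleftrightarrow>
     (\<exists>\<alpha> T \<beta> \<gamma>. (T, \<beta>) \<in> P \<and> \<phi> = \<alpha> @ Inl T # \<gamma> \<and> \<psi> = \<alpha> @ \<beta> @ \<gamma>)"

definition leftmost_step :: "'z productions \<Rightarrow> (nat + 'z) list \<Rightarrow> (nat + 'z) list \<Rightarrow> bool" where
  "leftmost_step P \<phi> \<psi> \<longleftrightarrow>
     (\<exists>w T \<beta> \<gamma>. (T, \<beta>) \<in> P \<and> \<phi> = map Inr w @ Inl T # \<gamma> \<and> \<psi> = map Inr w @ \<beta> @ \<gamma>)"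

definition cfg_lang :: "'z productions \<Rightarrow> nat \<Rightarrow> 'z list set" where
  "cfg_lang P S = {w. (step P)\<^sup>*\<^sup>* [Inl S] (map Inr w)}"

text \<open>
  A leftmost derivation is recorded by its sequence of sentential forms. Consecutive forms
  determine the production applied, so counting such sequences counts leftmost derivations.
\<close>

definition leftmost_derivation ::
  "'z productions \<Rightarrow> nat \<Rightarrow> 'z list \<Rightarrow> (nat + 'z) list list \<Rightarrow> bool" where
  "leftmost_derivation P S w \<Delta> \<longleftrightarrow>
     \<Delta> \<noteq> [] \<and> hd \<Delta> = [Inl S] \<and> last \<Delta> = map Inr w \<and> successively (leftmost_step P) \<Delta>"

definition unambiguous_grammar :: "'z productions \<Rightarrow> nat \<Rightarrow> bool" where
  "unambiguous_grammar P S \<longleftrightarrow> (\<forall>w \<in> cfg_lang P S. \<exists>!\<Delta>. leftmost_derivation P S w \<Delta>)"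

definition unambiguous_cfl :: "'z list set \<Rightarrow> bool" where
  "unambiguous_cfl L \<longleftrightarrow> (\<exists>P S. finite P \<and> unambiguous_grammar P S \<and> cfg_lang P S = L)"


section \<open>The free associative algebra and its quotients\<close>

text \<open>
  With words as an additively written monoid, finitely supported functions
  \<open>'z list \<Rightarrow>\<^sub>0 'k\<close> carry the convolution product of \<open>Poly_Mapping\<close>, i.e. they are
  the free associative algebra over \<open>'k\<close> on the letters \<open>'z\<close>.
\<close>

instantiation list :: (type) monoid_add
begin
definition zero_list :: "'a list" where "zero_list = []"
definition plus_list :: "'a list \<Rightarrow> 'a list \<Rightarrow> 'a list" where "plus_list u v = u @ v"
instance by standard (simp_all add: zero_list_def plus_list_def)
end

abbreviation free_alg :: "('z list \<Rightarrow>\<^sub>0 'k::field) ring" where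
  "free_alg \<equiv> ring_of_type_algebra"

definition word :: "'z list \<Rightarrow> ('z list \<Rightarrow>\<^sub>0 'k::field)" where
  "word w = Poly_Mapping.single w 1"

definition homogeneous :: "nat \<Rightarrow> ('z list \<Rightarrow>\<^sub>0 'k::field) set" where
  "homogeneous d = {f. \<forall>w \<in> Poly_Mapping.keys f. length w = d}"

definition quot_alg :: "('z list \<Rightarrow>\<^sub>0 'k::field) set \<Rightarrow> ('z list \<Rightarrow>\<^sub>0 'k) set ring" where
  "quot_alg I = free_alg Quot I"

definition quot_grade :: "('z list \<Rightarrow>\<^sub>0 'k::field) set \<Rightarrow> nat \<Rightarrow> ('z list \<Rightarrow>\<^sub>0 'k) set set" where
  "quot_grade I d = (\<lambda>f. I +>\<^bsub>free_alg\<^esub> f) ` homogeneous d"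

definition quot_scalars :: "('z list \<Rightarrow>\<^sub>0 'k::field) set \<Rightarrow> ('z list \<Rightarrow>\<^sub>0 'k) set set" where
  "quot_scalars I = range (\<lambda>c. I +>\<^bsub>free_alg\<^esub> Poly_Mapping.single [] c)"

text \<open>
  The coefficients are natural numbers; they are read in an arbitrary semiring so that the
  series can be viewed over the rationals or reals as well as over the ground field.
\<close>

definition hilbert_series :: "('z list \<Rightarrow>\<^sub>0 'k::field) set \<Rightarrow> 'c::semiring_1 fps" where
  "hilbert_series I =
     Abs_fps (\<lambda>d. of_nat (ring.dim (quot_alg I) (quot_scalars I) (quot_grade I d)))"


section \<open>Leading monomials\<close>

text \<open>Here \<open>r\<close> is the strict order on words, with \<open>(u, v) \<in> r\<close> meaning \<open>u \<prec> v\<close>.\<close>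

definition lm :: "'z list rel \<Rightarrow> ('z list \<Rightarrow>\<^sub>0 'k::field) \<Rightarrow> 'z list" where
  "lm r f = (THE w. w \<in> Poly_Mapping.keys f \<and> (\<forall>u \<in> Poly_Mapping.keys f. u \<noteq> w \<longrightarrow> (u, w) \<in> r))"

definition LM :: "'z list rel \<Rightarrow> ('z list \<Rightarrow>\<^sub>0 'k::field) set \<Rightarrow> ('z list \<Rightarrow>\<^sub>0 'k) set" where
  "LM r I = genideal free_alg {word (lm r f) | f. f \<in> I \<and> f \<noteq> 0}"


section \<open>Monomial algebras and chain languages\<close>

definition subword_antichain :: "'z list set \<Rightarrow> bool" where
  "subword_antichain G \<longleftrightarrow> (\<forall>u \<in> G. \<forall>v \<in> G. sublist u v \<longrightarrow> u = v)"

definition minimal_monomial_basis :: "('z list \<Rightarrow>\<^sub>0 'k::field) set \<Rightarrow> 'z list set" where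
  "minimal_monomial_basis J = (THE G. subword_antichain G \<and> J = genideal free_alg (word ` G))"

text \<open>
  \<open>extends G s t u\<close> says that \<open>(st, u)\<close> lies in the set \<open>L'\<^sub>i\<^sub>+\<^sub>1\<close> of candidate extensions
  of the chain \<open>st\<close> with prefix chain \<open>s\<close> and tail \<open>t\<close>, where \<open>G = L\<^sub>1\<close>.
\<close>

definition extends :: "'z list set \<Rightarrow> 'z list \<Rightarrow> 'z list \<Rightarrow> 'z list \<Rightarrow> bool" where
  "extends G s t u \<longleftrightarrow>
     (\<exists>w' \<in> G. \<exists>v. (s @ t) @ u = v @ w' \<and> length u < length w' \<and> length v \<ge> length s)"

text \<open>
  \<open>chains G n\<close> consists of the elements of \<open>L\<^sub>n\<^sub>+\<^sub>1\<close>, each recorded as the pair of its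
  prefix \<open>n\<close>-chain and its tail.
\<close>

fun chains :: "'z list set \<Rightarrow> nat \<Rightarrow> ('z list \<times> 'z list) set" where
  "chains G 0 = {(take 1 w, drop 1 w) | w. w \<in> G}"
| "chains G (Suc n) =
     {(s @ t, u) | s t u. (s, t) \<in> chains G n \<and> extends G s t u \<and>
        \<not> (\<exists>u1. strict_prefix u1 u \<and> extends G s t u1)}"

fun chain_lang :: "('z list \<Rightarrow>\<^sub>0 'k::field) set \<Rightarrow> nat \<Rightarrow> 'z list set" where
  "chain_lang J 0 = {[z] | z. True}"
| "chain_lang J (Suc n) = {s @ t | s t. (s, t) \<in> chains (minimal_monomial_basis J) n}"

definition homologically_unambiguous :: "('z list \<Rightarrow>\<^sub>0 'k::field) set \<Rightarrow> bool" where
  "homologically_unambiguous J \<longleftrightarrow>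
     (\<forall>w \<in> chain_lang J 1. length w \<ge> 2) \<and> (\<forall>i \<ge> 1. unambiguous_cfl (chain_lang J i))"


section \<open>Global dimension of a connected graded algebra\<close>

text \<open>
  Throughout, \<open>R\<close> is a ring graded by the components \<open>gr d\<close>. The graded free right module
  with homogeneous basis \<open>S\<close>, where \<open>i \<in> S\<close> has degree \<open>dg i\<close>, consists of the finitely
  supported coordinate functions. Basis elements are natural numbers, which suffices for
  minimal resolutions over algebras with finite-dimensional components: these have
  countable bases.
\<close>

definition free_module :: "('a, 'm) ring_scheme \<Rightarrow> nat set \<Rightarrow> (nat \<Rightarrow> 'a) set" where
  "free_module R S =
     {f. (\<forall>i \<in> S. f i \<in> carrier R) \<and> (\<forall>i. i \<notin> S \<longrightarrow> f i = \<zero>\<^bsub>R\<^esub>) \<and> finite {i. f i \<noteq> \<zero>\<^bsub>R\<^esub>}}"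

definition free_component ::
  "('a, 'm) ring_scheme \<Rightarrow> (nat \<Rightarrow> 'a set) \<Rightarrow> nat set \<Rightarrow> (nat \<Rightarrow> nat) \<Rightarrow> nat \<Rightarrow> (nat \<Rightarrow> 'a) set" where
  "free_component R gr S dg n =
     {f \<in> free_module R S. \<forall>i \<in> S. if dg i \<le> n then f i \<in> gr (n - dg i) else f i = \<zero>\<^bsub>R\<^esub>}"

definition vzero :: "('a, 'm) ring_scheme \<Rightarrow> nat \<Rightarrow> 'a" where
  "vzero R = (\<lambda>i. \<zero>\<^bsub>R\<^esub>)"

definition vadd :: "('a, 'm) ring_scheme \<Rightarrow> (nat \<Rightarrow> 'a) \<Rightarrow> (nat \<Rightarrow> 'a) \<Rightarrow> nat \<Rightarrow> 'a" where
  "vadd R f g = (\<lambda>i. f i \<oplus>\<^bsub>R\<^esub> g i)"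

definition vact :: "('a, 'm) ring_scheme \<Rightarrow> (nat \<Rightarrow> 'a) \<Rightarrow> 'a \<Rightarrow> nat \<Rightarrow> 'a" where
  "vact R f r = (\<lambda>i. f i \<otimes>\<^bsub>R\<^esub> r)"

text \<open>Right linearity on \<open>P\<close> of a map into a module with operations \<open>plusQ\<close> and \<open>actQ\<close>.\<close>

definition right_linear ::
  "('a, 'm) ring_scheme \<Rightarrow> (nat \<Rightarrow> 'a) set \<Rightarrow> ('q \<Rightarrow> 'q \<Rightarrow> 'q) \<Rightarrow> ('q \<Rightarrow> 'a \<Rightarrow> 'q)
     \<Rightarrow> ((nat \<Rightarrow> 'a) \<Rightarrow> 'q) \<Rightarrow> bool" where
  "right_linear R P plusQ actQ \<phi> \<longleftrightarrow>
     (\<forall>f \<in> P. \<forall>g \<in> P. \<phi> (vadd R f g) = plusQ (\<phi> f) (\<phi> g)) \<and>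
     (\<forall>f \<in> P. \<forall>r \<in> carrier R. \<phi> (vact R f r) = actQ (\<phi> f) r)"

definition positive_ideal :: "('a, 'm) ring_scheme \<Rightarrow> (nat \<Rightarrow> 'a set) \<Rightarrow> 'a set" where
  "positive_ideal R gr = genideal R (\<Union>d \<in> {0<..}. gr d)"

text \<open>
  For connected \<open>R\<close> the trivial module is \<open>R / R\<^sub>+\<close>, concentrated in degree \<open>0\<close>. The \<open>i\<close>-th
  term \<open>P\<^sub>i\<close> of the resolution has basis \<open>S i\<close> with degrees \<open>dg i\<close>; \<open>\<epsilon>\<close> is the augmentation
  on \<open>P\<^sub>0\<close>, and \<open>d i\<close> is the differential from \<open>P\<^sub>i\<^sub>+\<^sub>1\<close> to \<open>P\<^sub>i\<close>. Minimality is the condition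
  that the image of each differential lies in \<open>P\<^sub>i R\<^sub>+\<close>.
\<close>

definition minimal_free_resolution ::
  "('a, 'm) ring_scheme \<Rightarrow> (nat \<Rightarrow> 'a set) \<Rightarrow> (nat \<Rightarrow> nat set) \<Rightarrow> (nat \<Rightarrow> nat \<Rightarrow> nat)
     \<Rightarrow> ((nat \<Rightarrow> 'a) \<Rightarrow> 'a set) \<Rightarrow> (nat \<Rightarrow> (nat \<Rightarrow> 'a) \<Rightarrow> (nat \<Rightarrow> 'a)) \<Rightarrow> bool" where
  "minimal_free_resolution R gr S dg \<epsilon> d \<longleftrightarrow>
     (let P = (\<lambda>i. free_module R (S i));
          P_comp = (\<lambda>i. free_component R gr (S i) (dg i));
          R_plus = positive_ideal R gr;
          K = R Quot R_plus
      in
        \<comment> \<open>\<open>\<epsilon>\<close> is a surjective morphism of graded right modules onto the trivial module\<close>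
        right_linear R (P 0) (\<lambda>a b. a \<oplus>\<^bsub>K\<^esub> b) (\<lambda>a r. a \<otimes>\<^bsub>K\<^esub> (R_plus +>\<^bsub>R\<^esub> r)) \<epsilon> \<and>
        (\<forall>n > 0. \<forall>f \<in> P_comp 0 n. \<epsilon> f = \<zero>\<^bsub>K\<^esub>) \<and>
        \<epsilon> ` P 0 = carrier K \<and>
        \<comment> \<open>the differentials are morphisms of graded right modules\<close>
        (\<forall>i. d i ` P (Suc i) \<subseteq> P i \<and>
             right_linear R (P (Suc i)) (vadd R) (vact R) (d i) \<and>
             (\<forall>n. d i ` P_comp (Suc i) n \<subseteq> P_comp i n)) \<and>
        \<comment> \<open>exactness\<close>
        d 0 ` P 1 = {f \<in> P 0. \<epsilon> f = \<zero>\<^bsub>K\<^esub>} \<and>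
        (\<forall>i. d (Suc i) ` P (Suc (Suc i)) = {f \<in> P (Suc i). d i f = vzero R}) \<and>
        \<comment> \<open>minimality\<close>
        (\<forall>i. \<forall>f \<in> P (Suc i). \<forall>j. d i f j \<in> R_plus))"

text \<open>
  The minimal resolution is unique up to isomorphism, so its length does not depend on the
  choice made here.
\<close>

definition has_global_dimension ::
  "('a, 'm) ring_scheme \<Rightarrow> (nat \<Rightarrow> 'a set) \<Rightarrow> nat \<Rightarrow> bool" where
  "has_global_dimension R gr n \<longleftrightarrow>
     (\<exists>S dg \<epsilon> d. minimal_free_resolution R gr S dg \<epsilon> d \<and> S n \<noteq> {} \<and> (\<forall>i > n. S i = {}))"


section \<open>Algebraic power series\<close>

text \<open>The rational function field inside the field of Laurent series.\<close>

definition rational_functions :: "'k::field fls set" where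
  "rational_functions =
     {fps_to_fls (fps_of_poly p) / fps_to_fls (fps_of_poly q) | p q. q \<noteq> 0}"

definition algebraic_function :: "'k::field fps \<Rightarrow> bool" where
  "algebraic_function f \<longleftrightarrow>
     (\<exists>p :: 'k fls Polynomial.poly. p \<noteq> 0 \<and>
        (\<forall>i. Polynomial.coeff p i \<in> rational_functions) \<and> Polynomial.poly p (fps_to_fls f) = 0)"


section \<open>The presentation\<close>

text \<open>\<open>La'\<close> and \<open>Lb'\<close> are the primed letters \<open>a'\<close> and \<open>b'\<close>.\<close>

datatype letter = La' | Lb' | La | Lb | Le | Lx | Ly

fun letter_rank :: "letter \<Rightarrow> nat" where
  "letter_rank La' = 6"
| "letter_rank Lb' = 5"
| "letter_rank La = 4"
| "letter_rank Lb = 3"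
| "letter_rank Le = 2"
| "letter_rank Lx = 1"
| "letter_rank Ly = 0"

definition glex :: "letter list rel" where
  "glex = lenlex (measure letter_rank)"

abbreviation var :: "letter \<Rightarrow> (letter list \<Rightarrow>\<^sub>0 'k::field)" where
  "var z \<equiv> word [z]"

definition binomials_i :: "(letter list \<Rightarrow>\<^sub>0 'k::field) set" where
  "binomials_i = {var La' * var Lx - var Lx * var La', var Lb' * var Lx - var Lx * var Le}"

definition binomials_ii :: "(letter list \<Rightarrow>\<^sub>0 'k::field) set" where
  "binomials_ii =
     {var La' * var La - var La * var La', var La' * var Lb - var La * var Lb',
      var Lb' * var La - var Lb * var La', var Lb' * var Lb - var Lb * var Lb',
      var La' * var Le - var La * var Lb,  var Lb' * var Le - var Lb ^ 2}"

definition binomials_iii :: "(letter list \<Rightarrow>\<^sub>0 'k::field) set" where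
  "binomials_iii =
     {var La * var Ly - var Ly ^ 2,  var Lb * var Ly - var Ly ^ 2,
      var La' * var Ly - var Ly ^ 2, var Lb' * var Ly - var Ly ^ 2}"

definition dyck :: "letter list set" where
  "dyck = cfg_lang {(0, []), (0, [Inr La, Inl 0, Inr Lb, Inl 0])} 0"

end

theory Submission
  imports Defs "HOL-Library.Countable"
begin

text \<open>
  All relations are binomials or monomials, so the algebra \<open>A\<close> is a semigroup algebra with zero:
  every word equals, modulo \<open>I\<close>, either zero or a single normal word. The letters act on words (with an extra zero) so that
  all defining relations hold (\<open>act_rule2\<close>): a primed letter moves to the right through
  brackets, turns into a closing bracket when it meets \<open>e\<close>, and a \<open>y\<close> turns the letters
  \<open>a, b, a', b'\<close> directly to its left into \<open>y\<close>. Hence \<open>a' x w1 e w2 y = x a w1 b w2 y\<close> and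
  \<open>b' x w y = x e w y\<close>: starting from \<open>x y = 0\<close>, these two identities generate exactly
  \<open>x w y = 0\<close> for the words \<open>w\<close> in \<open>(D e)\<^sup>*\<close>, because every nonempty such word starts with
  \<open>e\<close> or with a matching pair of brackets (\<open>xLy_in\<close>). The action makes the normal form of a
  word well defined, and it lowers words in the monomial order, so the leading monomial ideal is
  spanned by the words that are not normal (\<open>lm_image_eq\<close>, \<open>LM_idealA\<close>). These are the words
  with a factor among the leading terms of the binomials and the words \<open>x w y\<close>; this set is an
  antichain and thus the minimal monomial basis.

  For the global dimension the minimal resolutions are written down as matrices over the free
  algebra. Exactness modulo the ideal is shown at each term by splitting off a complement of the
  image: a set of ``tight'' basis elements that, with the image, spans everything, and on which
  the next differential is injective by a triangularity argument (\<open>exact_if_split\<close>,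
  \<open>tight_injective\<close>). Over \<open>B\<close> this is the resolution by chains. Over \<open>A\<close> the chain resolution
  is not minimal, since \<open>A\<close> is finitely presented: the chains \<open>b' x w y\<close> and
  \<open>a' x w1 e w2 y\<close> with \<open>w2\<close> nonempty cancel against the relators \<open>x e w y\<close> and
  \<open>x a w1 b w2 y\<close>. What remains is thirteen relators, and the syzygies
  \<open>{a', b'} {a, b} y\<close> together with \<open>a' x w y\<close> for \<open>w\<close> empty or in \<open>D e\<close>.

  The chain languages are all generated by one grammar scheme, whose unambiguity follows because
  the next terminal letter determines the production to apply (\<open>unambiguous_chain_words\<close>).

  The Hilbert series of both algebras counts normal words. Reading a normal word from the left
  gives a linear equation for its generating function in terms of that of \<open>(D e)\<^sup>*\<close>, and the
  latter satisfies a quadratic equation since \<open>D = 1 + t\<^sup>2 D\<^sup>2\<close>. These identities hold over any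
  commutative ring, which gives algebraicity in every characteristic at once.
\<close>

section \<open>The free algebra and its quotients\<close>

abbreviation keys :: "('a \<Rightarrow>\<^sub>0 'b::zero) \<Rightarrow> 'a set" where "keys \<equiv> Poly_Mapping.keys"
abbreviation lookup :: "('a \<Rightarrow>\<^sub>0 'b::zero) \<Rightarrow> 'a \<Rightarrow> 'b" where "lookup \<equiv> Poly_Mapping.lookup"
abbreviation single :: "'a \<Rightarrow> 'b::zero \<Rightarrow> 'a \<Rightarrow>\<^sub>0 'b" where "single \<equiv> Poly_Mapping.single"

type_synonym ('z, 'k) falg = "'z list \<Rightarrow>\<^sub>0 'k"

lemma single_times_single [simp]:
  "single u c * single v d
     = (single (u @ v) (c * d) :: ('z, 'k::field) falg)"
  by (simp add: mult_single plus_list_def)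

lemma one_falg: "(1 :: ('z, 'k::field) falg) = single [] 1"
  by (simp add: zero_list_def flip: single_one)

lemma sum_keys_single:
  "(\<Sum>w\<in>keys f. single w (lookup f w)) = f"
  by (rule poly_mapping_eqI) (simp add: lookup_sum lookup_single when_def in_keys_iff)

text \<open>
  Additive statements only need to be checked on scaled basis vectors; restricting these to the
  support of \<open>f\<close> allows hypotheses on the support to be used.
\<close>

lemma poly_mapping_monomial_induct [case_names zero single add]:
  fixes f :: "'a \<Rightarrow>\<^sub>0 'b::ab_group_add"
  assumes "P 0" and "\<And>w c. w \<in> keys f \<Longrightarrow> P (single w c)"
    and "\<And>g h. P g \<Longrightarrow> P h \<Longrightarrow> P (g + h)"
  shows "P f"
proof -
  have "P (\<Sum>w\<in>A. single w (lookup f w))"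
    if "finite A" "A \<subseteq> keys f" for A
    using that by (induction A) (auto intro!: assms)
  then show ?thesis by (metis finite_keys order_refl sum_keys_single)
qed

lemma free_alg_simps [simp]:
  "carrier (free_alg :: ('z, 'k::field) falg ring) = UNIV"
  "monoid.mult (free_alg :: ('z, 'k) falg ring) = (\<lambda>x y. x * y)"
  "monoid.one (free_alg :: ('z, 'k) falg ring) = 1"
  "ring.zero (free_alg :: ('z, 'k) falg ring) = 0"
  "ring.add (free_alg :: ('z, 'k) falg ring) = (\<lambda>x y. x + y)"
  by (simp_all add: ring_of_type_algebra_def)

lemma ring_free_alg: "ring (free_alg :: ('z, 'k::field) falg ring)"
proof -
  have "\<exists>y. x + y = 0" for x :: "('z, 'k) falg"
    using add.right_inverse by blast
  then show ?thesis
    unfolding ring_of_type_algebra_def using add.right_inverse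
    by unfold_locales (auto simp: algebra_simps Units_def)
qed

interpretation F: ring "free_alg :: ('z, 'k::field) falg ring"
  by (rule ring_free_alg)

lemma free_alg_a_inv [simp]: "\<ominus>\<^bsub>free_alg\<^esub> (f :: ('z, 'k::field) falg) = - f"
  by (rule F.minus_equality) simp_all

lemma ideal_free_algI:
  fixes I :: "('z, 'k::field) falg set"
  assumes "0 \<in> I" "\<And>f g. f \<in> I \<Longrightarrow> g \<in> I \<Longrightarrow> f + g \<in> I"
    and "\<And>f g. f \<in> I \<Longrightarrow> g * f \<in> I" "\<And>f g. f \<in> I \<Longrightarrow> f * g \<in> I"
  shows "ideal I free_alg"
proof (rule idealI[OF ring_free_alg])
  have "- f \<in> I" if "f \<in> I" for f
    using assms(3)[OF that, of "- 1"] by simp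
  then show "subgroup I (add_monoid free_alg)"
    using assms(1,2) by (intro F.add.subgroupI) (auto simp flip: a_inv_def)
qed (use assms in auto)

locale free_ideal =
  fixes I :: "('z, 'k::field) falg set"
  assumes is_ideal: "ideal I free_alg"
begin

interpretation Id: ideal I free_alg by (rule is_ideal)

lemma zero_in: "0 \<in> I"
  using Id.zero_closed by simp
lemma add_in: "f \<in> I \<Longrightarrow> g \<in> I \<Longrightarrow> f + g \<in> I"
  using Id.a_closed[of f g] by simp
lemma uminus_in: "f \<in> I \<Longrightarrow> - f \<in> I"
  using Id.a_inv_closed[of f] by simp
lemma diff_in: "f \<in> I \<Longrightarrow> g \<in> I \<Longrightarrow> f - g \<in> I"
  using add_in[of f "- g"] uminus_in by simp
lemma lmult_in: "f \<in> I \<Longrightarrow> g * f \<in> I"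
  using Id.I_l_closed[of f g] by simp
lemma rmult_in: "f \<in> I \<Longrightarrow> f * g \<in> I"
  using Id.I_r_closed[of f g] by simp
lemma sum_in: "(\<And>x. x \<in> A \<Longrightarrow> f x \<in> I) \<Longrightarrow> sum f A \<in> I"
  by (induction A rule: infinite_finite_induct) (auto intro: zero_in add_in)
lemma diff_trans: "f - g \<in> I \<Longrightarrow> g - h \<in> I \<Longrightarrow> f - h \<in> I"
  using add_in[of "f - g" "g - h"] by simp
lemma diff_sym: "f - g \<in> I \<Longrightarrow> g - f \<in> I"
  using uminus_in[of "f - g"] by simp

abbreviation (input) cls :: "('z, 'k) falg \<Rightarrow> ('z, 'k) falg set" where
  "cls f \<equiv> I +>\<^bsub>free_alg\<^esub> f"

lemma ring_quot: "ring (quot_alg I)"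
  unfolding quot_alg_def by (rule Id.quotient_is_ring)

lemma cls_hom: "ring_hom_ring free_alg (quot_alg I) cls"
  unfolding quot_alg_def by (rule Id.rcos_ring_hom_ring)

lemma quot_carrier: "carrier (quot_alg I) = range cls"
  by (auto simp: quot_alg_def FactRing_def A_RCOSETS_def RCOSETS_def a_r_coset_def)

lemma cls_in_carrier [simp]: "cls f \<in> carrier (quot_alg I)"
  by (simp add: quot_carrier)

lemma quot_add: "cls f \<oplus>\<^bsub>quot_alg I\<^esub> cls g = cls (f + g)"
  using ring_hom_add[OF ring_hom_ring.homh[OF cls_hom], of f g] by simp
lemma quot_mult: "cls f \<otimes>\<^bsub>quot_alg I\<^esub> cls g = cls (f * g)"
  using ring_hom_mult[OF ring_hom_ring.homh[OF cls_hom], of f g] by simp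
lemma quot_one: "\<one>\<^bsub>quot_alg I\<^esub> = cls 1"
  using ring_hom_one[OF ring_hom_ring.homh[OF cls_hom]] by simp
lemma quot_zero: "\<zero>\<^bsub>quot_alg I\<^esub> = cls 0"
  using ring_hom_zero[OF ring_hom_ring.homh[OF cls_hom] ring_free_alg ring_quot] by simp

lemma cls_eq_iff: "cls f = cls g \<longleftrightarrow> f - g \<in> I"
proof
  assume "cls f = cls g"
  then have "f \<in> cls g" using Id.a_rcos_self[of f] by simp
  then obtain i where "i \<in> I" "f = i + g" by (auto simp: a_r_coset_def' )
  then show "f - g \<in> I" by simp
next
  assume "f - g \<in> I"
  then have "f \<in> cls g" by (auto simp: a_r_coset_def' intro!: bexI[of _ "f - g"])
  then show "cls f = cls g"
    using Id.a_repr_independence'[of f g] by simp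
qed

lemma quot_uminus: "\<ominus>\<^bsub>quot_alg I\<^esub> cls f = cls (- f)"
  by (rule abelian_group.minus_equality[OF ring.is_abelian_group[OF ring_quot]])
     (simp_all add: quot_add quot_zero)

end

lemma free_ideal_genideal: "free_ideal (genideal free_alg (S :: ('z, 'k::field) falg set))"
  by (simp add: free_ideal_def F.genideal_ideal)

lemma genideal_subset: "S \<subseteq> genideal free_alg (S :: ('z, 'k::field) falg set)"
  by (rule F.genideal_self) simp

lemma genideal_least:
  "ideal I free_alg \<Longrightarrow> S \<subseteq> I \<Longrightarrow> genideal free_alg (S :: ('z, 'k::field) falg set) \<subseteq> I"
  by (rule F.genideal_minimal)

section \<open>Dimensions of the graded components\<close>

context free_ideal
begin

lemma subfield_quot_scalars:
  assumes proper: "1 \<notin> I"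
  shows "subfield (quot_scalars I) (quot_alg I)"
proof -
  interpret R: ring "quot_alg I" by (rule ring_quot)
  let ?h = "\<lambda>c. cls (single [] c)"
  have inv: "?h c \<otimes>\<^bsub>quot_alg I\<^esub> ?h (inverse c) = \<one>\<^bsub>quot_alg I\<^esub>" if "c \<noteq> 0" for c
    using that by (simp add: quot_mult quot_one one_falg)
  have comm: "?h c \<otimes>\<^bsub>quot_alg I\<^esub> ?h d = ?h d \<otimes>\<^bsub>quot_alg I\<^esub> ?h c" for c d
    by (simp add: quot_mult mult.commute)
  have ne: "\<one>\<^bsub>quot_alg I\<^esub> \<noteq> \<zero>\<^bsub>quot_alg I\<^esub>"
    using proper by (simp add: quot_one quot_zero cls_eq_iff)
  have "subring (quot_scalars I) (quot_alg I)"
  proof (rule R.subringI)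
    show "\<one>\<^bsub>quot_alg I\<^esub> \<in> quot_scalars I"
      by (auto simp: quot_one one_falg quot_scalars_def)
    show "\<ominus>\<^bsub>quot_alg I\<^esub> h \<in> quot_scalars I" if "h \<in> quot_scalars I" for h
      using that by (auto simp: quot_scalars_def quot_uminus single_uminus[symmetric])
    show "g \<otimes>\<^bsub>quot_alg I\<^esub> h \<in> quot_scalars I" if "g \<in> quot_scalars I" "h \<in> quot_scalars I" for g h
      using that by (auto simp: quot_scalars_def quot_mult)
    show "g \<oplus>\<^bsub>quot_alg I\<^esub> h \<in> quot_scalars I" if "g \<in> quot_scalars I" "h \<in> quot_scalars I" for g h
      using that by (auto simp: quot_scalars_def quot_add single_add[symmetric])
  qed (auto simp: quot_scalars_def)
  then have "subcring (quot_scalars I) (quot_alg I)"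
    using comm by (intro R.subcringI) (auto simp: quot_scalars_def)
  moreover have "Units (quot_alg I \<lparr>carrier := quot_scalars I\<rparr>) = quot_scalars I - {\<zero>\<^bsub>quot_alg I\<^esub>}"
  proof (intro equalityI subsetI)
    fix x assume "x \<in> Units (quot_alg I \<lparr>carrier := quot_scalars I\<rparr>)"
    then obtain y where xy: "x \<in> quot_scalars I" "y \<in> quot_scalars I"
        "y \<otimes>\<^bsub>quot_alg I\<^esub> x = \<one>\<^bsub>quot_alg I\<^esub>"
      by (auto simp: Units_def)
    obtain c where c: "y = ?h c" using xy(2) unfolding quot_scalars_def by blast
    have "x \<noteq> \<zero>\<^bsub>quot_alg I\<^esub>"
    proof
      assume "x = \<zero>\<^bsub>quot_alg I\<^esub>"
      with xy(3) c ne show False by (simp add: R.r_null)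
    qed
    with xy(1) show "x \<in> quot_scalars I - {\<zero>\<^bsub>quot_alg I\<^esub>}" by blast
  next
    fix x assume x: "x \<in> quot_scalars I - {\<zero>\<^bsub>quot_alg I\<^esub>}"
    then obtain c where c: "x = ?h c" unfolding quot_scalars_def by blast
    have c0: "c \<noteq> 0" using x by (metis DiffE c insertI1 quot_zero single_zero)
    have "?h (inverse c) \<in> quot_scalars I" unfolding quot_scalars_def by blast
    moreover have "?h (inverse c) \<otimes>\<^bsub>quot_alg I\<^esub> x = \<one>\<^bsub>quot_alg I\<^esub>"
      "x \<otimes>\<^bsub>quot_alg I\<^esub> ?h (inverse c) = \<one>\<^bsub>quot_alg I\<^esub>"
      using inv[OF c0] comm[of c "inverse c"] by (simp_all only: c)
    ultimately show "x \<in> Units (quot_alg I \<lparr>carrier := quot_scalars I\<rparr>)"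
      using x unfolding Units_def by auto
  qed
  ultimately show ?thesis by (rule R.subfieldI)
qed

text \<open>
  A finite set of words that is linearly independent modulo \<open>I\<close> spans a space whose dimension
  is its cardinality: the span grows by one line for each word.
\<close>

lemma dimension_word_span:
  assumes "finite B" and indep: "\<And>f. keys f \<subseteq> B \<Longrightarrow> f \<in> I \<Longrightarrow> f = 0"
  shows "ring.dimension (quot_alg I) (card B) (quot_scalars I)
           (cls ` {f. keys f \<subseteq> B})"
  using assms
proof (induction B)
  case empty
  interpret R: ring "quot_alg I" by (rule ring_quot)
  show ?case using R.zero_dim by (simp add: quot_zero)
next
  case (insert b B)
  interpret R: ring "quot_alg I" by (rule ring_quot)
  let ?E = "cls ` {f. keys f \<subseteq> B}"
  have IH: "R.dimension (card B) (quot_scalars I) ?E"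
    using insert by blast
  have "cls (word b) \<notin> ?E"
  proof
    assume "cls (word b) \<in> ?E"
    then obtain f where f: "keys f \<subseteq> B" "word b - f \<in> I"
      by (auto simp: cls_eq_iff)
    have "keys (word b - f) \<subseteq> insert b B"
      using f(1) keys_diff[of "word b" f] by (auto simp: word_def split: if_splits)
    then have "word b - f = 0" using insert.prems f(2) by blast
    then have "lookup (word b - f) b = 0" by simp
    moreover have "lookup f b = 0"
      using f(1) insert.hyps by (auto simp: in_keys_iff)
    ultimately show False by (simp add: lookup_minus word_def)
  qed
  moreover have "R.line_extension (quot_scalars I) (cls (word b)) ?E
      = cls ` {f. keys f \<subseteq> insert b B}"
  proof (intro equalityI subsetI)
    fix x assume "x \<in> R.line_extension (quot_scalars I) (cls (word b)) ?E"
    then obtain c f where f: "keys f \<subseteq> B"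
      and x: "x = cls (single [] c) \<otimes>\<^bsub>quot_alg I\<^esub> cls (word b) \<oplus>\<^bsub>quot_alg I\<^esub> cls f"
      by (auto simp: R.line_extension_mem_iff quot_scalars_def)
    have "x = cls (single b c + f)"
      by (simp add: x quot_mult quot_add word_def)
    moreover have "keys (single b c + f) \<subseteq> insert b B"
      using f keys_add[of "single b c" f] by (auto split: if_splits)
    ultimately show "x \<in> cls ` {f. keys f \<subseteq> insert b B}" by blast
  next
    fix x assume "x \<in> cls ` {f. keys f \<subseteq> insert b B}"
    then obtain f where f: "keys f \<subseteq> insert b B" and x: "x = cls f" by auto
    let ?g = "f - single b (lookup f b)"
    have g: "keys ?g \<subseteq> B"
      using f by (auto simp: in_keys_iff lookup_minus lookup_single when_def split: if_splits)
    have "x = cls (single [] (lookup f b)) \<otimes>\<^bsub>quot_alg I\<^esub> cls (word b)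
                \<oplus>\<^bsub>quot_alg I\<^esub> cls ?g"
      by (simp add: x quot_mult quot_add word_def)
    moreover have "cls (single [] (lookup f b)) \<in> quot_scalars I"
      unfolding quot_scalars_def by blast
    moreover have "cls ?g \<in> ?E" using g by blast
    ultimately show "x \<in> R.line_extension (quot_scalars I) (cls (word b)) ?E"
      unfolding R.line_extension_mem_iff by blast
  qed
  ultimately show ?case
    using R.Suc_dim[OF _ _ IH, of "cls (word b)"] insert.hyps by simp
qed

text \<open>
  The degree condition on \<open>B\<close> makes the classes of words of \<open>B\<close> lie in the component, and
  \<open>span\<close> makes them exhaust it; \<open>1 \<notin> I\<close> is what makes the scalars a field.
\<close>

lemma dim_quot_grade:
  assumes "1 \<notin> I" "finite B" "\<And>w. w \<in> B \<Longrightarrow> length w = d"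
    and indep: "\<And>f. keys f \<subseteq> B \<Longrightarrow> f \<in> I \<Longrightarrow> f = 0"
    and span: "\<And>f. f \<in> homogeneous d \<Longrightarrow> \<exists>g. keys g \<subseteq> B \<and> f - g \<in> I"
  shows "ring.dim (quot_alg I) (quot_scalars I) (quot_grade I d) = card B"
proof -
  interpret R: ring "quot_alg I" by (rule ring_quot)
  have "quot_grade I d = cls ` {f. keys f \<subseteq> B}"
  proof (intro equalityI subsetI)
    fix x assume "x \<in> quot_grade I d"
    then obtain f where "f \<in> homogeneous d" "x = cls f" by (auto simp: quot_grade_def)
    with span[of f] show "x \<in> cls ` {f. keys f \<subseteq> B}"
      by (metis (mono_tags, lifting) cls_eq_iff image_eqI mem_Collect_eq)
  next
    fix x assume "x \<in> cls ` {f. keys f \<subseteq> B}"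
    then obtain f where f: "keys f \<subseteq> B" "x = cls f" by auto
    then have "f \<in> homogeneous d" using assms(3) by (auto simp: homogeneous_def)
    with f(2) show "x \<in> quot_grade I d" by (auto simp: quot_grade_def)
  qed
  then have "R.dimension (card B) (quot_scalars I) (quot_grade I d)"
    using dimension_word_span[OF assms(2) indep] by simp
  then show ?thesis
    using R.dimI[OF subfield_quot_scalars[OF assms(1)]] by (simp add: over_def)
qed

end

section \<open>Free resolutions given by matrices over the free algebra\<close>

text \<open>
  Vectors over the free algebra, indexed by words: a generator of a free module is named by the
  word that gives it its degree.
\<close>

type_synonym ('z, 'k) fvec = "'z list \<Rightarrow>\<^sub>0 ('z, 'k) falg"

definition rscale :: "('z, 'k::field) fvec \<Rightarrow> ('z, 'k) falg \<Rightarrow> ('z, 'k) fvec" where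
  "rscale v f = Poly_Mapping.map (\<lambda>x. x * f) v"

lemma lookup_rscale [simp]:
  "lookup (rscale v f) j = lookup v j * f"
  by (auto simp: rscale_def Poly_Mapping.map.rep_eq when_def)

lemma rscale_single [simp]: "rscale (single g f) h = single g (f * h)"
  by (rule poly_mapping_eqI) (simp add: lookup_single when_def)

lemma keys_rscale: "keys (rscale v f) \<subseteq> keys v"
  by (auto simp: in_keys_iff)

lemma rscale_add: "rscale (v + w) f = rscale v f + rscale w f"
  by (rule poly_mapping_eqI) (simp add: lookup_add algebra_simps)

lemma rscale_diff: "rscale (v - w) f = rscale v f - rscale w f"
  by (rule poly_mapping_eqI) (simp add: lookup_minus algebra_simps)

lemma rscale_zero [simp]: "rscale 0 f = 0" "rscale v 0 = 0"
  by (rule poly_mapping_eqI, simp)+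

text \<open>
  The right linear map whose value at the basis vector \<open>g\<close> is the column \<open>D g\<close>.
\<close>

definition dmap :: "('z list \<Rightarrow> ('z, 'k::field) fvec) \<Rightarrow> ('z, 'k) fvec \<Rightarrow> ('z, 'k) fvec" where
  "dmap D v = (\<Sum>g\<in>keys v. rscale (D g) (lookup v g))"

lemma lookup_dmap:
  assumes "finite A" "keys v \<subseteq> A"
  shows "lookup (dmap D v) j =
    (\<Sum>g\<in>A. lookup (D g) j * lookup v g)"
  unfolding dmap_def lookup_sum lookup_rscale
  by (rule sum.mono_neutral_left) (use assms in \<open>auto simp: in_keys_iff\<close>)

lemma lookup_dmap_keys:
  "lookup (dmap D v) j =
    (\<Sum>g\<in>keys v. lookup (D g) j * lookup v g)"
  by (rule lookup_dmap) auto

lemma dmap_zero [simp]: "dmap D 0 = 0"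
  by (simp add: dmap_def)

lemma dmap_single [simp]: "dmap D (single g f) = rscale (D g) f"
  by (cases "f = 0") (simp_all add: dmap_def)

lemma dmap_add: "dmap D (v + w) = dmap D v + dmap D w"
proof -
  have "rscale (D g) (f + h) = rscale (D g) f + rscale (D g) h" for g f h
    by (rule poly_mapping_eqI) (simp add: lookup_add algebra_simps)
  then show ?thesis unfolding dmap_def by (intro setsum_keys_plus_distrib) auto
qed

lemma dmap_uminus: "dmap D (- v) = - dmap D v"
  using dmap_add[of D v "- v"] by (simp add: eq_neg_iff_add_eq_0 add.commute)

lemma dmap_diff: "dmap D (v - w) = dmap D v - dmap D w"
  using dmap_add[of D v "- w"] by (simp add: dmap_uminus)

lemma dmap_rscale: "dmap D (rscale v f) = rscale (dmap D v) f"
proof (rule poly_mapping_eqI)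
  fix j
  have "keys (rscale v f) \<subseteq> keys v"
    by (auto simp: in_keys_iff)
  then show "lookup (dmap D (rscale v f)) j = lookup (rscale (dmap D v) f) j"
    by (simp add: lookup_dmap[of "keys v"] sum_distrib_right mult.assoc)
qed

lemma keys_dmap:
  assumes "\<And>g. g \<in> keys v \<Longrightarrow> keys (D g) \<subseteq> W"
  shows "keys (dmap D v) \<subseteq> W"
proof
  fix j assume "j \<in> keys (dmap D v)"
  then have "(\<Sum>g\<in>keys v. lookup (D g) j * lookup v g) \<noteq> 0"
    by (simp add: in_keys_iff lookup_dmap_keys)
  then obtain g where "g \<in> keys v" "lookup (D g) j \<noteq> 0"
    by (metis (no_types, lifting) mult_zero_left sum.neutral)
  then show "j \<in> W" using assms[of g] by (auto simp: in_keys_iff)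
qed

lemma homogeneous_mult:
  fixes f g :: "('z, 'k::field) falg"
  assumes "f \<in> homogeneous a" "g \<in> homogeneous b"
  shows "f * g \<in> homogeneous (a + b)"
  using assms keys_mult[of f g] by (fastforce simp: homogeneous_def plus_list_def)

lemma homogeneous_sum:
  "(\<And>x. x \<in> A \<Longrightarrow> f x \<in> homogeneous d) \<Longrightarrow> sum f A \<in> homogeneous d"
  using keys_sum[of f A] by (fastforce simp: homogeneous_def)

lemma homogeneous_zero [simp]: "0 \<in> homogeneous d"
  by (simp add: homogeneous_def)

definition augmentation_ideal :: "('z, 'k::field) falg set" where
  "augmentation_ideal = {f. lookup f [] = 0}"

lemma augmentation_ideal_mult:
  fixes f g :: "('z, 'k::field) falg"
  assumes "f \<in> augmentation_ideal \<or> g \<in> augmentation_ideal"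
  shows "f * g \<in> augmentation_ideal"
proof -
  have "[] \<notin> keys (f * g)"
  proof
    assume "[] \<in> keys (f * g)"
    then have "[] \<in> keys f" "[] \<in> keys g"
      using keys_mult[of f g] by (auto simp: plus_list_def)
    with assms show False by (auto simp: augmentation_ideal_def in_keys_iff)
  qed
  then show ?thesis by (simp add: augmentation_ideal_def in_keys_iff)
qed

lemma augmentation_ideal_sum:
  "(\<And>x. x \<in> A \<Longrightarrow> f x \<in> augmentation_ideal) \<Longrightarrow> sum f A \<in> augmentation_ideal"
  by (simp add: augmentation_ideal_def lookup_sum)

lemma homogeneous_in_augmentation_ideal:
  "f \<in> homogeneous d \<Longrightarrow> 0 < d \<Longrightarrow> f \<in> augmentation_ideal"
  by (auto simp: homogeneous_def augmentation_ideal_def in_keys_iff)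

context free_ideal
begin

text \<open>Such a vector represents zero in the free module over the quotient.\<close>

definition vec_null :: "('z, 'k) fvec \<Rightarrow> bool" where
  "vec_null v \<longleftrightarrow> (\<forall>j. lookup v j \<in> I)"

lemma vec_null_zero [simp]: "vec_null 0"
  by (simp add: vec_null_def zero_in)
lemma vec_null_add: "vec_null v \<Longrightarrow> vec_null w \<Longrightarrow> vec_null (v + w)"
  by (simp add: vec_null_def lookup_add add_in)
lemma vec_null_uminus: "vec_null v \<Longrightarrow> vec_null (- v)"
  by (simp add: vec_null_def uminus_in)
lemma vec_null_diff: "vec_null v \<Longrightarrow> vec_null w \<Longrightarrow> vec_null (v - w)"
  by (simp add: vec_null_def lookup_minus diff_in)
lemma vec_null_rscale: "vec_null v \<Longrightarrow> vec_null (rscale v f)"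
  by (simp add: vec_null_def rmult_in)
lemma vec_null_single: "f \<in> I \<Longrightarrow> vec_null (single g f)"
  by (simp add: vec_null_def lookup_single when_def zero_in)
lemma vec_null_dmap: "vec_null v \<Longrightarrow> vec_null (dmap D v)"
  by (simp add: vec_null_def lookup_dmap_keys sum_in lmult_in)
lemma vec_null_sym: "vec_null (u - v) \<Longrightarrow> vec_null (v - u)"
  using vec_null_uminus[of "u - v"] by simp

end

text \<open>
  A complex of matrices over the free algebra, with generators of the \<open>i\<close>-th module indexed by
  \<open>W i\<close>, which is exact after reduction modulo \<open>I\<close>. The entries have positive degree, so
  the resulting resolution is automatically minimal.
\<close>

locale word_resolution = free_ideal I for I :: "('z::countable, 'k::field) falg set" +
  fixes W :: "nat \<Rightarrow> 'z list set" and D :: "nat \<Rightarrow> 'z list \<Rightarrow> ('z, 'k) fvec"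
  assumes W0: "W 0 = {[]}"
    and W1: "W 1 = range (\<lambda>z. [z])"
    and D0: "D 0 [z] = single [] (word [z])"
    and keys_D: "g \<in> W (Suc i) \<Longrightarrow> keys (D i g) \<subseteq> W i"
    and length_D: "g \<in> W (Suc i) \<Longrightarrow> j \<in> keys (D i g) \<Longrightarrow> length j < length g"
    and homogeneous_D:
      "g \<in> W (Suc i) \<Longrightarrow> lookup (D i g) j \<in> homogeneous (length g - length j)"
    and exact: "keys v \<subseteq> W (Suc i) \<Longrightarrow>
      vec_null (dmap (D i) v) \<longleftrightarrow>
        (\<exists>u. keys u \<subseteq> W (Suc (Suc i)) \<and> vec_null (v - dmap (D (Suc i)) u))"
begin

abbreviation (input) R where "R \<equiv> quot_alg I"
abbreviation (input) gr where "gr \<equiv> quot_grade I"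
abbreviation (input) S :: "nat \<Rightarrow> nat set" where "S i \<equiv> to_nat ` W i"
abbreviation (input) dg :: "nat \<Rightarrow> nat \<Rightarrow> nat" where "dg \<equiv> (\<lambda>i n. length (inv_into (W i) to_nat n))"
abbreviation (input) R_plus where "R_plus \<equiv> positive_ideal R gr"

interpretation R: ring R by (rule ring_quot)

lemma inv_into_to_nat [simp]: "g \<in> W i \<Longrightarrow> inv_into (W i) to_nat (to_nat g) = g"
  by (rule inv_into_f_f) (auto simp: inj_on_def)

text \<open>The element of the free module over the quotient that a vector represents.\<close>

definition vec_cls :: "('z, 'k) fvec \<Rightarrow> nat \<Rightarrow> ('z, 'k) falg set" where
  "vec_cls v = (\<lambda>n. if n \<in> range (to_nat :: 'z list \<Rightarrow> nat)
                     then cls (lookup v (from_nat n)) else cls 0)"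

lemma vec_cls_to_nat [simp]: "vec_cls v (to_nat g) = cls (lookup v g)"
  by (simp add: vec_cls_def)

lemma vec_cls_eq_iff: "vec_cls v = vec_cls w \<longleftrightarrow> vec_null (v - w)"
proof
  assume "vec_cls v = vec_cls w"
  then have "vec_cls v (to_nat g) = vec_cls w (to_nat g)" for g :: "'z list" by simp
  then show "vec_null (v - w)" by (simp add: vec_null_def lookup_minus cls_eq_iff)
next
  assume "vec_null (v - w)"
  then show "vec_cls v = vec_cls w"
    by (auto simp: vec_null_def lookup_minus vec_cls_def cls_eq_iff fun_eq_iff)
qed

lemma vec_cls_zero: "vec_cls 0 = vzero R"
  by (rule ext) (simp add: vec_cls_def vzero_def quot_zero)

lemma vec_cls_add: "vadd R (vec_cls v) (vec_cls w) = vec_cls (v + w)"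
  by (rule ext) (simp add: vec_cls_def vadd_def quot_add lookup_add)

lemma vec_cls_rscale: "vact R (vec_cls v) (cls f) = vec_cls (rscale v f)"
  by (rule ext) (simp add: vec_cls_def vact_def quot_mult)

lemma vec_cls_in_free_module:
  assumes "keys v \<subseteq> W i"
  shows "vec_cls v \<in> free_module R (S i)"
proof -
  have zero: "vec_cls v n = \<zero>\<^bsub>R\<^esub>" if "n \<notin> to_nat ` keys v" for n
    using that by (auto simp: vec_cls_def quot_zero in_keys_iff image_iff)
  then have "{n. vec_cls v n \<noteq> \<zero>\<^bsub>R\<^esub>} \<subseteq> to_nat ` keys v"
    by blast
  then have "finite {n. vec_cls v n \<noteq> \<zero>\<^bsub>R\<^esub>}"
    by (rule finite_subset) simp
  moreover have "vec_cls v n = \<zero>\<^bsub>R\<^esub>" if "n \<notin> S i" for n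
    using assms that by (intro zero) blast
  ultimately show ?thesis
    by (auto simp: free_module_def)
qed

text \<open>
  Representatives of the coordinates can be chosen subject to any property \<open>Q\<close> that is available
  coordinatewise. The choice \<open>0\<close> for vanishing coordinates keeps the support finite; homogeneity
  of representatives is the application with a proper \<open>Q\<close>.
\<close>

lemma free_module_vec_cls:
  assumes f: "f \<in> free_module R (S i)"
    and Q: "\<And>g. g \<in> W i \<Longrightarrow> \<exists>h. cls h = f (to_nat g) \<and> Q g h"
  obtains v where "keys v \<subseteq> W i" "f = vec_cls v"
    "\<And>g. g \<in> keys v \<Longrightarrow> Q g (lookup v g)"
proof -
  let ?A = "{g \<in> W i. f (to_nat g) \<noteq> \<zero>\<^bsub>R\<^esub>}"
  obtain h where h: "\<And>g. g \<in> W i \<Longrightarrow> cls (h g) = f (to_nat g) \<and> Q g (h g)"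
    using Q by metis
  have "to_nat ` ?A \<subseteq> {n. f n \<noteq> \<zero>\<^bsub>R\<^esub>}" by auto
  moreover have "finite {n. f n \<noteq> \<zero>\<^bsub>R\<^esub>}" using f by (simp add: free_module_def)
  ultimately have "finite ?A"
    by (meson finite_imageD finite_subset inj_to_nat inj_on_subset subset_UNIV)
  define v where "v = Abs_poly_mapping (\<lambda>g. if g \<in> ?A then h g else 0)"
  have v: "lookup v g = (if g \<in> ?A then h g else 0)" for g
    unfolding v_def by (subst lookup_Abs_poly_mapping)
      (use \<open>finite ?A\<close> in \<open>auto intro: finite_subset[of _ ?A]\<close>)
  have keys: "keys v \<subseteq> ?A"
    by (auto simp: in_keys_iff v split: if_splits)
  have "f n = vec_cls v n" for n
  proof (cases "n \<in> S i")
    case True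
    then obtain g where g: "g \<in> W i" "n = to_nat g" by auto
    then show ?thesis using h[of g] by (auto simp: v quot_zero)
  next
    case False
    then have "f n = \<zero>\<^bsub>R\<^esub>" using f by (simp add: free_module_def)
    moreover have "vec_cls v n = \<zero>\<^bsub>R\<^esub>"
      using False by (auto simp: vec_cls_def v quot_zero)
    ultimately show ?thesis by simp
  qed
  then have "f = vec_cls v" by blast
  moreover have "Q g (lookup v g)" if "g \<in> keys v" for g
  proof -
    have g: "g \<in> ?A" using keys that by blast
    then have "lookup v g = h g" unfolding v by (rule if_P)
    then show ?thesis using h[of g] g by simp
  qed
  moreover have "keys v \<subseteq> W i" using keys by blast
  ultimately show thesis using that by blast
qed

lemma free_module_vec_clsE:
  assumes f: "f \<in> free_module R (S i)"
  obtains v where "keys v \<subseteq> W i" "f = vec_cls v"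
proof -
  have "\<exists>h. cls h = f (to_nat g) \<and> True" if "g \<in> W i" for g
  proof -
    have "f (to_nat g) \<in> carrier R" using f that by (auto simp: free_module_def)
    then show ?thesis by (auto simp: quot_carrier)
  qed
  then show ?thesis by (rule free_module_vec_cls[OF f]) (assumption, rule that)
qed

lemma free_module_image: "free_module R (S i) = vec_cls ` {v. keys v \<subseteq> W i}"
  by (blast intro: vec_cls_in_free_module elim: free_module_vec_clsE)

text \<open>
  The choice of a representing vector does not matter, as \<open>diff_vec_cls\<close> shows, because
  \<open>dmap\<close> preserves vectors with entries in \<open>I\<close>.
\<close>

definition diff :: "nat \<Rightarrow> (nat \<Rightarrow> ('z, 'k) falg set) \<Rightarrow> (nat \<Rightarrow> ('z, 'k) falg set)" where
  "diff i f = vec_cls (dmap (D i) (SOME v. keys v \<subseteq> W (Suc i) \<and> f = vec_cls v))"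

lemma diff_vec_cls:
  assumes "keys v \<subseteq> W (Suc i)"
  shows "diff i (vec_cls v) = vec_cls (dmap (D i) v)"
proof -
  let ?w = "SOME w. keys w \<subseteq> W (Suc i) \<and> vec_cls v = vec_cls w"
  have "keys ?w \<subseteq> W (Suc i) \<and> vec_cls v = vec_cls ?w"
    by (rule someI_ex) (use assms in blast)
  then have "vec_null (?w - v)" by (simp add: vec_cls_eq_iff vec_null_sym)
  then have "vec_null (dmap (D i) ?w - dmap (D i) v)"
    by (simp add: vec_null_dmap flip: dmap_diff)
  then show ?thesis by (simp add: diff_def vec_cls_eq_iff)
qed

lemma keys_dmap_D: "keys v \<subseteq> W (Suc i) \<Longrightarrow> keys (dmap (D i) v) \<subseteq> W i"
  using keys_D by (intro keys_dmap) blast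

lemma positive_ideal_is_ideal: "ideal R_plus R"
  unfolding positive_ideal_def
  by (rule R.genideal_ideal) (auto simp: quot_grade_def)

lemma positive_ideal_eq: "R_plus = cls ` augmentation_ideal"
proof
  have "ideal (cls ` augmentation_ideal) R"
  proof (rule idealI[OF ring_quot])
    have zero: "0 \<in> (augmentation_ideal :: ('z, 'k) falg set)"
      by (simp add: augmentation_ideal_def)
    have um: "- f \<in> augmentation_ideal" if "f \<in> augmentation_ideal" for f :: "('z, 'k) falg"
      using that by (simp add: augmentation_ideal_def)
    have add: "f + g \<in> augmentation_ideal"
      if "f \<in> augmentation_ideal" "g \<in> augmentation_ideal" for f g :: "('z, 'k) falg"
      using that by (simp add: augmentation_ideal_def lookup_add)
    show "subgroup (cls ` augmentation_ideal) (add_monoid R)"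
    proof (rule R.add.subgroupI)
      show "cls ` augmentation_ideal \<noteq> {}" using zero by blast
    next
      fix a assume "a \<in> cls ` augmentation_ideal"
      then show "\<ominus>\<^bsub>R\<^esub> a \<in> cls ` augmentation_ideal"
        using um by (auto simp: quot_uminus)
    next
      fix a b assume "a \<in> cls ` augmentation_ideal" "b \<in> cls ` augmentation_ideal"
      then show "a \<oplus>\<^bsub>R\<^esub> b \<in> cls ` augmentation_ideal"
        using add by (auto simp: quot_add)
    qed auto
    fix a x assume "a \<in> cls ` augmentation_ideal" "x \<in> carrier R"
    then obtain f g where "f \<in> augmentation_ideal" "a = cls f" "x = cls g"
      by (auto simp: quot_carrier)
    then show "x \<otimes>\<^bsub>R\<^esub> a \<in> cls ` augmentation_ideal" "a \<otimes>\<^bsub>R\<^esub> x \<in> cls ` augmentation_ideal"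
      by (simp_all add: quot_mult augmentation_ideal_mult)
  qed
  moreover have "(\<Union>d\<in>{0<..}. gr d) \<subseteq> cls ` augmentation_ideal"
    using homogeneous_in_augmentation_ideal by (fastforce simp: quot_grade_def)
  ultimately show "R_plus \<subseteq> cls ` augmentation_ideal"
    unfolding positive_ideal_def by (rule R.genideal_minimal)
next
  interpret P: ideal R_plus R by (rule positive_ideal_is_ideal)
  have "cls f \<in> R_plus" if "f \<in> augmentation_ideal" for f
  proof (rule poly_mapping_monomial_induct[of "\<lambda>f. cls f \<in> R_plus"])
    show "cls 0 \<in> R_plus" using P.zero_closed by (simp add: quot_zero)
    show "cls (g + h) \<in> R_plus" if "cls g \<in> R_plus" "cls h \<in> R_plus" for g h
      using P.a_closed[OF that] by (simp add: quot_add)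
    fix w c assume "w \<in> keys f"
    then have "w \<noteq> []" using that by (auto simp: augmentation_ideal_def in_keys_iff)
    then have "cls (single w c) \<in> (\<Union>d\<in>{0<..}. gr d)"
      by (auto simp: quot_grade_def homogeneous_def intro!: bexI[of _ "length w"] imageI split: if_splits)
    moreover have "(\<Union>d\<in>{0<..}. gr d) \<subseteq> R_plus"
      unfolding positive_ideal_def by (rule R.genideal_self) (auto simp: quot_grade_def)
    ultimately show "cls (single w c) \<in> R_plus" by blast
  qed
  then show "cls ` augmentation_ideal \<subseteq> R_plus" by blast
qed

definition aug :: "(nat \<Rightarrow> ('z, 'k) falg set) \<Rightarrow> ('z, 'k) falg set set" where
  "aug f = R_plus +>\<^bsub>R\<^esub> f (to_nat ([] :: 'z list))"

text \<open>
  A polynomial without constant term is a right linear combination of the letters: strip the first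
  letter of each word.
\<close>

lemma image_first_differential:
  fixes h :: "('z, 'k) falg"
  assumes "h \<in> augmentation_ideal"
  shows "\<exists>v. keys v \<subseteq> W 1 \<and> single [] h = dmap (D 0) v"
  using assms
proof -
  show ?thesis
  proof (rule poly_mapping_monomial_induct
      [of "\<lambda>h. \<exists>v. keys v \<subseteq> W 1 \<and> single [] h = dmap (D 0) v"])
    show "\<exists>v. keys v \<subseteq> W 1 \<and> single [] 0 = dmap (D 0) v"
      by (rule exI[of _ 0]) simp
  next
    fix g h :: "('z, 'k) falg"
    assume "\<exists>v. keys v \<subseteq> W 1 \<and> single [] g = dmap (D 0) v"
      and "\<exists>v. keys v \<subseteq> W 1 \<and> single [] h = dmap (D 0) v"
    then obtain v w where "keys v \<subseteq> W 1" "single [] g = dmap (D 0) v"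
      "keys w \<subseteq> W 1" "single [] h = dmap (D 0) w" by blast
    then show "\<exists>v. keys v \<subseteq> W 1 \<and> single [] (g + h) = dmap (D 0) v"
      using keys_add[of v w] by (intro exI[of _ "v + w"]) (auto simp: single_add dmap_add)
  next
    fix w c assume "w \<in> keys h"
    then have "w \<noteq> []" using assms by (auto simp: augmentation_ideal_def in_keys_iff)
    then obtain z m where w: "w = z # m" by (cases w) auto
    show "\<exists>v. keys v \<subseteq> W 1 \<and> single [] (single w c) = dmap (D 0) v"
      by (rule exI[of _ "single [z] (single m c)"])
         (auto simp: w W1[simplified] D0 word_def)
  qed
qed

lemma aug_zero_iff: "aug (vec_cls v) = \<zero>\<^bsub>R Quot R_plus\<^esub> \<longleftrightarrow> cls (lookup v []) \<in> R_plus"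
proof -
  interpret P: ideal R_plus R by (rule positive_ideal_is_ideal)
  let ?x = "cls (lookup v [])"
  have "R_plus +>\<^bsub>R\<^esub> ?x = R_plus \<longleftrightarrow> ?x \<in> R_plus"
    using P.a_rcos_const[of ?x] P.a_rcos_self[of ?x] by auto
  then show ?thesis by (simp add: aug_def FactRing_def)
qed

text \<open>
  A matrix complex over the free algebra that is exact modulo \<open>I\<close> descends to a minimal free
  resolution over the quotient; minimality holds because the entries have positive degree.
\<close>

theorem minimal_resolution: "minimal_free_resolution R gr S dg aug diff"
proof -
  interpret P: ideal R_plus R by (rule positive_ideal_is_ideal)
  have hom: "ring_hom_ring R (R Quot R_plus) (\<lambda>x. R_plus +>\<^bsub>R\<^esub> x)"
    by (rule P.rcos_ring_hom_ring)
  note hom' = ring_hom_ring.homh[OF hom]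
  have a: "right_linear R (free_module R (S 0)) (\<lambda>a b. a \<oplus>\<^bsub>R Quot R_plus\<^esub> b)
      (\<lambda>a r. a \<otimes>\<^bsub>R Quot R_plus\<^esub> (R_plus +>\<^bsub>R\<^esub> r)) aug"
  proof -
    have "f (to_nat ([] :: 'z list)) \<in> carrier R" if "f \<in> free_module R (S 0)" for f
      using that W0 by (auto simp: free_module_def)
    then show ?thesis
      using ring_hom_add[OF hom'] ring_hom_mult[OF hom']
      by (simp add: right_linear_def aug_def vadd_def vact_def)
  qed
  have b: "aug f = \<zero>\<^bsub>R Quot R_plus\<^esub>"
    if "n > 0" "f \<in> free_component R gr (S 0) (dg 0) n" for n f
  proof -
    have "f \<in> free_module R (S 0)" using that(2) by (simp add: free_component_def)
    then obtain v where v: "f = vec_cls v" by (rule free_module_vec_clsE)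
    have "f (to_nat ([] :: 'z list)) \<in> gr n"
      using that(2) W0 by (simp add: free_component_def)
    then have "f (to_nat ([] :: 'z list)) \<in> R_plus"
      using \<open>n > 0\<close> homogeneous_in_augmentation_ideal
      by (auto simp: positive_ideal_eq quot_grade_def)
    then show ?thesis unfolding v aug_zero_iff by simp
  qed
  have c: "aug ` free_module R (S 0) = carrier (R Quot R_plus)"
  proof (intro equalityI subsetI)
    fix y assume "y \<in> aug ` free_module R (S 0)"
    then obtain f where "f \<in> free_module R (S 0)" "y = aug f" by auto
    then show "y \<in> carrier (R Quot R_plus)"
      using W0 ring_hom_closed[OF hom', of "f (to_nat ([] :: 'z list))"]
      by (auto simp: free_module_def aug_def)
  next
    fix y assume "y \<in> carrier (R Quot R_plus)"
    then obtain x where x: "x \<in> carrier R" "y = R_plus +>\<^bsub>R\<^esub> x"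
      by (auto simp: FactRing_def A_RCOSETS_def RCOSETS_def a_r_coset_def)
    then obtain f where f: "x = cls f" by (auto simp: quot_carrier)
    have "vec_cls (single [] f) \<in> free_module R (S 0)"
      by (rule vec_cls_in_free_module) (simp add: W0)
    moreover have "y = aug (vec_cls (single [] f))"
      by (simp add: aug_def x f)
    ultimately show "y \<in> aug ` free_module R (S 0)" by blast
  qed
  have d: "diff i ` free_module R (S (Suc i)) \<subseteq> free_module R (S i)" for i
  proof
    fix y assume "y \<in> diff i ` free_module R (S (Suc i))"
    then obtain v where v: "keys v \<subseteq> W (Suc i)" "y = diff i (vec_cls v)"
      unfolding free_module_image by blast
    then show "y \<in> free_module R (S i)"
      by (simp add: diff_vec_cls vec_cls_in_free_module keys_dmap_D)
  qed
  have e: "right_linear R (free_module R (S (Suc i))) (vadd R) (vact R) (diff i)" for i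
    unfolding right_linear_def
  proof (intro conjI ballI)
    fix f g assume "f \<in> free_module R (S (Suc i))" "g \<in> free_module R (S (Suc i))"
    then obtain v w where vw: "keys v \<subseteq> W (Suc i)" "f = vec_cls v"
        "keys w \<subseteq> W (Suc i)" "g = vec_cls w"
      unfolding free_module_image by blast
    then have "keys (v + w) \<subseteq> W (Suc i)" using keys_add[of v w] by blast
    with vw show "diff i (vadd R f g) = vadd R (diff i f) (diff i g)"
      by (simp add: vec_cls_add diff_vec_cls dmap_add)
  next
    fix f r assume "f \<in> free_module R (S (Suc i))" "r \<in> carrier R"
    then obtain v h where vw: "keys v \<subseteq> W (Suc i)" "f = vec_cls v" "r = cls h"
      unfolding free_module_image quot_carrier by blast
    then have "keys (rscale v h) \<subseteq> W (Suc i)"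
      using keys_rscale[of v h] by blast
    with vw show "diff i (vact R f r) = vact R (diff i f) r"
      by (simp add: vec_cls_rscale diff_vec_cls dmap_rscale)
  qed
  have f: "diff i ` free_component R gr (S (Suc i)) (dg (Suc i)) n
             \<subseteq> free_component R gr (S i) (dg i) n" for i n
  proof
    fix y assume "y \<in> diff i ` free_component R gr (S (Suc i)) (dg (Suc i)) n"
    then obtain f where f: "f \<in> free_component R gr (S (Suc i)) (dg (Suc i)) n" "y = diff i f"
      by auto
    \<comment> \<open>A coordinate of degree larger than \<open>n\<close> vanishes and is represented by \<open>0\<close>.\<close>
    define Q where "Q g h \<longleftrightarrow> h = 0 \<or> length g \<le> n \<and> h \<in> homogeneous (n - length g)"
      for g :: "'z list" and h :: "('z, 'k) falg"
    have ex: "\<exists>h. cls h = f (to_nat g) \<and> Q g h" if "g \<in> W (Suc i)" for g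
    proof (cases "length g \<le> n")
      case True
      then have "f (to_nat g) \<in> gr (n - length g)"
        using f that by (auto simp: free_component_def)
      then show ?thesis using True by (auto simp: quot_grade_def Q_def)
    next
      case False
      then have "f (to_nat g) = \<zero>\<^bsub>R\<^esub>"
        using f that by (auto simp: free_component_def)
      then show ?thesis by (auto simp: quot_zero Q_def)
    qed
    have "f \<in> free_module R (S (Suc i))" using f by (simp add: free_component_def)
    then obtain v where v: "keys v \<subseteq> W (Suc i)" "f = vec_cls v"
      and Qv: "\<And>g. g \<in> keys v \<Longrightarrow> Q g (lookup v g)"
      using free_module_vec_cls[where Q = Q, OF _ ex] by blast
    have deg: "lookup (D i g) j * lookup v g = 0 \<or>
      length j \<le> n \<and>
      lookup (D i g) j * lookup v g \<in> homogeneous (n - length j)"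
      if g: "g \<in> keys v" for g j
    proof (cases "lookup (D i g) j = 0")
      case False
      have gW: "g \<in> W (Suc i)" using g v by blast
      have "length j < length g"
        using length_D[OF gW] False by (simp add: in_keys_iff)
      moreover have "length g \<le> n" "lookup v g \<in> homogeneous (n - length g)"
        using Qv[OF g] g by (auto simp: Q_def in_keys_iff)
      ultimately show ?thesis
        using homogeneous_mult[OF homogeneous_D[OF gW, of j], of "lookup v g" "n - length g"]
        by simp
    qed auto
    have dmap_deg: "if length j \<le> n then lookup (dmap (D i) v) j \<in> homogeneous (n - length j)
        else lookup (dmap (D i) v) j = 0" for j
    proof (cases "length j \<le> n")
      case True
      then have "lookup (D i g) j * lookup v g \<in> homogeneous (n - length j)"
        if "g \<in> keys v" for g
        using deg[OF that, of j] by auto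
      with True show ?thesis unfolding lookup_dmap_keys by (simp add: homogeneous_sum)
    next
      case False
      then have "lookup (D i g) j * lookup v g = 0"
        if "g \<in> keys v" for g
        using deg[OF that, of j] by auto
      with False show ?thesis unfolding lookup_dmap_keys by simp
    qed
    have "vec_cls (dmap (D i) v) \<in> free_component R gr (S i) (dg i) n"
      unfolding free_component_def
    proof (intro CollectI conjI ballI)
      show "vec_cls (dmap (D i) v) \<in> free_module R (S i)"
        by (rule vec_cls_in_free_module[OF keys_dmap_D[OF v(1)]])
      fix s assume "s \<in> S i"
      then obtain g where s: "s = to_nat g" "g \<in> W i" by auto
      show "if dg i s \<le> n then vec_cls (dmap (D i) v) s \<in> gr (n - dg i s)
            else vec_cls (dmap (D i) v) s = \<zero>\<^bsub>R\<^esub>"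
        using dmap_deg[of g] s(2) by (auto simp: s(1) quot_grade_def quot_zero split: if_splits)
    qed
    then show "y \<in> free_component R gr (S i) (dg i) n"
      using f(2) v by (simp add: diff_vec_cls)
  qed
  have g: "diff 0 ` free_module R (S 1) = {f \<in> free_module R (S 0). aug f = \<zero>\<^bsub>R Quot R_plus\<^esub>}"
  proof (intro equalityI subsetI)
    fix y assume "y \<in> diff 0 ` free_module R (S 1)"
    then obtain v where "keys v \<subseteq> W 1" "y = diff 0 (vec_cls v)"
      unfolding free_module_image by blast
    then have v: "keys v \<subseteq> W 1" "y = vec_cls (dmap (D 0) v)"
      using diff_vec_cls[of v 0] by simp_all
    have "lookup (D 0 g) [] * lookup v g \<in> augmentation_ideal"
      if "g \<in> keys v" for g
    proof (rule augmentation_ideal_mult, rule disjI1)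
      have "g \<in> range (\<lambda>z. [z])" using that v(1) unfolding W1 by blast
      then obtain z where "g = [z]" by blast
      then show "lookup (D 0 g) [] \<in> augmentation_ideal"
        by (simp add: D0 augmentation_ideal_def word_def lookup_single)
    qed
    then have "lookup (dmap (D 0) v) [] \<in> augmentation_ideal"
      unfolding lookup_dmap_keys by (rule augmentation_ideal_sum)
    then have "cls (lookup (dmap (D 0) v) []) \<in> R_plus"
      unfolding positive_ideal_eq by blast
    then have "aug y = \<zero>\<^bsub>R Quot R_plus\<^esub>"
      unfolding v(2) aug_zero_iff .
    moreover have "y \<in> free_module R (S 0)"
      unfolding v(2) by (intro vec_cls_in_free_module keys_dmap_D) (use v(1) in simp)
    ultimately show "y \<in> {f \<in> free_module R (S 0). aug f = \<zero>\<^bsub>R Quot R_plus\<^esub>}" by blast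
  next
    fix y assume "y \<in> {f \<in> free_module R (S 0). aug f = \<zero>\<^bsub>R Quot R_plus\<^esub>}"
    then have y: "y \<in> free_module R (S 0)" "aug y = \<zero>\<^bsub>R Quot R_plus\<^esub>" by auto
    from y(1) obtain v where v: "keys v \<subseteq> W 0" "y = vec_cls v"
      by (rule free_module_vec_clsE)
    from y(2) have "cls (lookup v []) \<in> R_plus"
      unfolding v(2) aug_zero_iff .
    then obtain h where h: "h \<in> augmentation_ideal" "lookup v [] - h \<in> I"
      unfolding positive_ideal_eq by (auto simp: cls_eq_iff)
    obtain u where u: "keys u \<subseteq> W 1" "single [] h = dmap (D 0) u"
      using image_first_differential[OF h(1)] by blast
    have "lookup v j = 0" if "j \<noteq> []" for j
      using v(1) that by (auto simp: W0 in_keys_iff)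
    then have "vec_null (v - single [] h)"
      using h(2) by (auto simp: vec_null_def lookup_minus lookup_single when_def zero_in)
    then have "vec_null (v - dmap (D 0) u)" by (simp add: u(2))
    then have "y = diff 0 (vec_cls u)"
      using u(1) by (simp add: v(2) diff_vec_cls vec_cls_eq_iff)
    then show "y \<in> diff 0 ` free_module R (S 1)"
      using vec_cls_in_free_module[OF u(1)] by blast
  qed
  have h: "diff (Suc i) ` free_module R (S (Suc (Suc i)))
      = {f \<in> free_module R (S (Suc i)). diff i f = vzero R}" for i
  proof (intro equalityI subsetI)
    fix y assume "y \<in> diff (Suc i) ` free_module R (S (Suc (Suc i)))"
    then obtain u where "keys u \<subseteq> W (Suc (Suc i))" "y = diff (Suc i) (vec_cls u)"
      unfolding free_module_image by blast
    then have u: "keys u \<subseteq> W (Suc (Suc i))" "y = vec_cls (dmap (D (Suc i)) u)"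
      using diff_vec_cls[of u "Suc i"] by simp_all
    note k = keys_dmap_D[OF u(1)]
    have "vec_null (dmap (D i) (dmap (D (Suc i)) u))"
      using exact[OF k] u(1) by auto
    then have "diff i y = vzero R"
      using k by (simp add: u(2) diff_vec_cls vec_cls_eq_iff flip: vec_cls_zero)
    then show "y \<in> {f \<in> free_module R (S (Suc i)). diff i f = vzero R}"
      using vec_cls_in_free_module[OF k] u(2) by simp
  next
    fix y assume "y \<in> {f \<in> free_module R (S (Suc i)). diff i f = vzero R}"
    then have y: "y \<in> free_module R (S (Suc i))" "diff i y = vzero R" by auto
    from y(1) obtain v where v: "keys v \<subseteq> W (Suc i)" "y = vec_cls v"
      by (rule free_module_vec_clsE)
    have "vec_null (dmap (D i) v)"
      using y(2) v by (simp add: diff_vec_cls vec_cls_eq_iff flip: vec_cls_zero)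
    then obtain u where u: "keys u \<subseteq> W (Suc (Suc i))" "vec_null (v - dmap (D (Suc i)) u)"
      using exact[OF v(1)] by blast
    then have "y = diff (Suc i) (vec_cls u)"
      by (simp add: v(2) diff_vec_cls vec_cls_eq_iff)
    then show "y \<in> diff (Suc i) ` free_module R (S (Suc (Suc i)))"
      using vec_cls_in_free_module[OF u(1)] by blast
  qed
  have m: "diff i f j \<in> R_plus" if f: "f \<in> free_module R (S (Suc i))" for i f j
  proof -
    from f obtain v where v: "keys v \<subseteq> W (Suc i)" "f = vec_cls v"
      by (rule free_module_vec_clsE)
    have "lookup (D i g) l * lookup v g \<in> augmentation_ideal"
      if "g \<in> keys v" for g l
    proof (cases "lookup (D i g) l = 0")
      case False
      have "g \<in> W (Suc i)" using that v(1) by blast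
      then have "lookup (D i g) l \<in> augmentation_ideal"
        using length_D[of g i l] homogeneous_D[of g i l] False
        by (intro homogeneous_in_augmentation_ideal[of _ "length g - length l"])
           (auto simp: in_keys_iff)
      then show ?thesis by (simp add: augmentation_ideal_mult)
    qed (simp add: augmentation_ideal_def)
    then have "lookup (dmap (D i) v) l \<in> augmentation_ideal" for l
      unfolding lookup_dmap_keys by (rule augmentation_ideal_sum)
    moreover have "0 \<in> (augmentation_ideal :: ('z, 'k) falg set)"
      by (simp add: augmentation_ideal_def)
    ultimately have "vec_cls (dmap (D i) v) j \<in> cls ` augmentation_ideal"
      unfolding vec_cls_def by simp
    then show ?thesis
      using v by (simp add: positive_ideal_eq diff_vec_cls)
  qed
  show ?thesis
    unfolding minimal_free_resolution_def Let_def
    by (intro conjI allI impI ballI a b c d e f g h m) assumption+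
qed

lemma global_dimension:
  assumes "W n \<noteq> {}" "\<And>i. i > n \<Longrightarrow> W i = {}"
  shows "has_global_dimension R gr n"
  unfolding has_global_dimension_def
  using minimal_resolution assms by (intro exI[of _ S] exI[of _ dg] exI conjI) auto

end

section \<open>Ideals described by a normal form on words\<close>

text \<open>
  The value \<open>None\<close> of a normal form stands for a word that is zero in the quotient.
\<close>

definition nf_word :: "'z list option \<Rightarrow> 'k::field \<Rightarrow> ('z, 'k) falg" where
  "nf_word r c = (case r of None \<Rightarrow> 0 | Some v \<Rightarrow> single v c)"

lemma nf_word_simps [simp]:
  "nf_word None c = 0" "nf_word (Some v) c = single v c" "nf_word r 0 = 0"
  by (auto simp: nf_word_def split: option.split)

lemma lookup_nf_word: "lookup (nf_word r c) v = (if r = Some v then c else 0)"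
  by (cases r) (simp_all add: lookup_single when_def)

lemma nf_word_add: "nf_word r (c + d) = nf_word r c + nf_word r d"
  by (auto simp: nf_word_def single_add split: option.split)

definition reduce :: "('z list \<Rightarrow> 'z list option) \<Rightarrow> ('z, 'k::field) falg \<Rightarrow> ('z, 'k) falg" where
  "reduce nf f = (\<Sum>w\<in>keys f. nf_word (nf w) (lookup f w))"

lemma reduce_zero [simp]: "reduce nf 0 = 0"
  by (simp add: reduce_def)

lemma reduce_single [simp]: "reduce nf (single w c) = nf_word (nf w) c"
  by (cases "c = 0") (simp_all add: reduce_def)

lemma reduce_add: "reduce nf (f + g) = reduce nf f + reduce nf g"
  unfolding reduce_def by (rule setsum_keys_plus_distrib) (auto simp: nf_word_add)

lemma reduce_uminus: "reduce nf (- f) = - reduce nf f"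
  using reduce_add[of nf f "- f"] by (simp add: eq_neg_iff_add_eq_0 add.commute)

lemma reduce_diff: "reduce nf (f - g) = reduce nf f - reduce nf g"
  using reduce_add[of nf f "- g"] by (simp add: reduce_uminus)

lemma reduce_sum: "reduce nf (sum f A) = (\<Sum>x\<in>A. reduce nf (f x))"
  by (induction A rule: infinite_finite_induct) (auto simp: reduce_add)

lemma lookup_reduce:
  "lookup (reduce nf f) v =
    (\<Sum>w\<in>keys f. if nf w = Some v then lookup f w else 0)"
  by (simp add: reduce_def lookup_sum lookup_nf_word)

lemma keys_reduceE:
  assumes "v \<in> keys (reduce nf f)"
  obtains w where "w \<in> keys f" "nf w = Some v"
proof -
  have "\<exists>w\<in>keys f. nf w = Some v"
  proof (rule ccontr)
    assume "\<not> (\<exists>w\<in>keys f. nf w = Some v)"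
    then have "lookup (reduce nf f) v = 0"
      unfolding lookup_reduce by (intro sum.neutral) simp
    with assms show False by (simp add: in_keys_iff)
  qed
  with that show thesis by blast
qed

lemma reduce_normal:
  assumes "\<And>w. w \<in> keys f \<Longrightarrow> nf w = Some w"
  shows "reduce nf f = f"
proof (rule poly_mapping_eqI)
  fix v
  have "(\<Sum>w\<in>keys f. if nf w = Some v then lookup f w else 0)
      = (\<Sum>w\<in>keys f. if w = v then lookup f w else 0)"
    by (rule sum.cong) (auto simp: assms)
  then show "lookup (reduce nf f) v = lookup f v"
    by (simp add: lookup_reduce in_keys_iff)
qed

text \<open>
  The polynomials all of whose multiples have vanishing normal form are an ideal, so it is
  enough to test generators.
\<close>

definition nf_null :: "('z list \<Rightarrow> 'z list option) \<Rightarrow> ('z, 'k::field) falg set" where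
  "nf_null nf = {f. \<forall>p q. reduce nf (p * f * q) = 0}"

lemma ideal_nf_null: "ideal (nf_null nf) free_alg"
proof (rule ideal_free_algI)
  fix f g :: "('a, 'b) falg" assume f: "f \<in> nf_null nf"
  have "reduce nf (p * (g * f) * q) = 0" for p q
    using f unfolding nf_null_def by (simp flip: mult.assoc)
  then show "g * f \<in> nf_null nf" by (simp add: nf_null_def)
  have "reduce nf (p * f * (g * q)) = 0" for p q
    using f unfolding nf_null_def by blast
  then show "f * g \<in> nf_null nf" by (simp add: nf_null_def mult.assoc)
qed (simp_all add: nf_null_def distrib_left distrib_right reduce_add)

lemma nf_null_reduce: "f \<in> nf_null nf \<Longrightarrow> reduce nf f = 0"
  unfolding nf_null_def by (metis (mono_tags, lifting) mem_Collect_eq mult_1 mult_1_right)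

lemma nf_nullI:
  fixes f :: "('z, 'k::field) falg"
  assumes "\<And>u v c. reduce nf (single u c * f * single v 1) = 0"
  shows "f \<in> nf_null nf"
  unfolding nf_null_def
proof (intro CollectI allI)
  fix p q :: "('z, 'k) falg"
  have 1: "reduce nf (p * f * single v 1) = 0" for v
    by (induction p rule: poly_mapping_monomial_induct)
       (simp_all add: assms distrib_left distrib_right reduce_add)
  have scalar: "single v c = single [] c * single v 1"
    for v :: "'z list" and c :: 'k by simp
  have central: "f * single [] c = single [] c * f"
    for f :: "('z, 'k) falg" and c
    by (induction f rule: poly_mapping_monomial_induct) (simp_all add: algebra_simps)
  have "reduce nf (p * f * single v c) = 0" for v c
  proof -
    have "p * f * single v c = (p * f * single [] c) * single v 1"
      by (subst scalar) (simp only: mult.assoc)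
    also have "\<dots> = (single [] c * (p * f)) * single v 1"
      by (simp only: central)
    finally have "p * f * single v c
        = (single [] c * p) * f * single v 1"
      by (simp only: mult.assoc)
    moreover have "reduce nf ((single [] c * p) * f * single v 1) = 0"
      by (induction p rule: poly_mapping_monomial_induct)
         (simp_all add: assms distrib_left distrib_right reduce_add)
    ultimately show ?thesis by simp
  qed
  then show "reduce nf (p * f * q) = 0"
    by (induction q rule: poly_mapping_monomial_induct) (simp_all add: distrib_left reduce_add)
qed

text \<open>
  The quotient by \<open>I\<close> has a basis of words: each word is congruent to its normal form, and the
  linear extension of the normal form kills \<open>I\<close>. That normal forms are fixed points, and that
  these are linearly independent modulo \<open>I\<close>, is a consequence.
\<close>

locale normal_form = free_ideal I for I :: "('z, 'k::field) falg set" +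
  fixes nf :: "'z list \<Rightarrow> 'z list option"
  assumes reduce_null: "f \<in> I \<Longrightarrow> reduce nf f = 0"
    and nf_cong: "single w 1 - nf_word (nf w) 1 \<in> I"
    and nf_length: "nf w = Some v \<Longrightarrow> length v = length w"
    and nf_Nil: "nf [] = Some []"
begin

abbreviation normal :: "'z list \<Rightarrow> bool" where "normal w \<equiv> nf w = Some w"

lemma single_nf_in: "single w c - nf_word (nf w) c \<in> I"
proof -
  have "single w c - nf_word (nf w) c
      = single [] c * (single w 1 - nf_word (nf w) 1)"
    by (cases "nf w") (simp_all add: right_diff_distrib)
  then show ?thesis using lmult_in[OF nf_cong] by simp
qed

lemma single_cong:
  assumes "nf w = nf v"
  shows "single w c - single v c \<in> I"
  using diff_in[OF single_nf_in[of w c] single_nf_in[of v c]] assms by simp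

lemma single_None: "nf w = None \<Longrightarrow> single w c \<in> I"
  using single_nf_in[of w c] by simp

lemma reduce_cong: "f - reduce nf f \<in> I"
proof (induction f rule: poly_mapping_monomial_induct)
  case (add g h)
  then show ?case using add_in[OF add] by (simp add: reduce_add algebra_simps)
qed (auto simp: zero_in single_nf_in)

lemma nf_idem:
  assumes "nf w = Some v" shows "normal v"
proof -
  have "lookup (reduce nf (single w (1 :: 'k) - single v 1)) v = 0"
    using reduce_null[OF nf_cong[of w]] assms by simp
  then show ?thesis
    by (simp add: reduce_diff lookup_minus lookup_nf_word assms split: if_splits)
qed

lemma normal_independent:
  assumes "\<And>w. w \<in> keys f \<Longrightarrow> normal w" "f \<in> I"
  shows "f = 0"
  using assms reduce_normal[of f nf] reduce_null by metis

lemma keys_reduce: "w \<in> keys (reduce nf f) \<Longrightarrow> normal w"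
  by (elim keys_reduceE) (rule nf_idem)

lemma one_not_in: "1 \<notin> I"
proof
  assume "1 \<in> I"
  from reduce_null[OF this] have "(1 :: ('z, 'k) falg) = 0" by (simp add: one_falg nf_Nil)
  then show False by simp
qed

lemma hilbert_series_normal:
  assumes "finite (UNIV :: 'z set)"
  shows "hilbert_series I = Abs_fps (\<lambda>d. of_nat (card {w. normal w \<and> length w = d}))"
proof -
  have "ring.dim (quot_alg I) (quot_scalars I) (quot_grade I d) = card {w. normal w \<and> length w = d}" for d
  proof (rule dim_quot_grade[OF one_not_in])
    have "{w. normal w \<and> length w = d} \<subseteq> {w. set w \<subseteq> UNIV \<and> length w = d}" by auto
    then show "finite {w. normal w \<and> length w = d}"
      using finite_lists_length_eq[OF assms] by (rule finite_subset)
    show "f = 0" if "keys f \<subseteq> {w. normal w \<and> length w = d}" "f \<in> I" for f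
      using that by (intro normal_independent) auto
    show "\<exists>g. keys g \<subseteq> {w. normal w \<and> length w = d} \<and> f - g \<in> I"
      if "f \<in> homogeneous d" for f
    proof (intro exI conjI subsetI)
      fix w assume w: "w \<in> keys (reduce nf f)"
      from w obtain v where "v \<in> keys f" "nf v = Some w" by (rule keys_reduceE)
      with that have "length w = d" by (auto simp: homogeneous_def nf_length)
      with keys_reduce[OF w] show "w \<in> {w. normal w \<and> length w = d}" by simp
    qed (rule reduce_cong)
  qed auto
  then show ?thesis by (simp add: hilbert_series_def)
qed

end

section \<open>Leading monomials from a descending normal form\<close>

locale word_order =
  fixes r :: "'z list rel"
  assumes trans_r: "trans r" and irrefl_r: "irrefl r" and total_r: "total r"
begin

lemma lm_eqI:
  assumes "w \<in> keys f" "\<And>u. u \<in> keys f \<Longrightarrow> u \<noteq> w \<Longrightarrow> (u, w) \<in> r"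
  shows "lm r f = w"
  unfolding lm_def
proof (rule the_equality)
  show "w \<in> keys f \<and> (\<forall>u\<in>keys f. u \<noteq> w \<longrightarrow> (u, w) \<in> r)"
    using assms by blast
  fix v assume v: "v \<in> keys f \<and> (\<forall>u\<in>keys f. u \<noteq> v \<longrightarrow> (u, v) \<in> r)"
  show "v = w"
  proof (rule ccontr)
    assume "v \<noteq> w"
    then have "(v, w) \<in> r" "(w, v) \<in> r" using v assms by auto
    then show False using trans_r irrefl_r by (meson irrefl_def transD)
  qed
qed

lemma lm_props:
  assumes "f \<noteq> 0"
  shows "lm r f \<in> keys f"
    and "u \<in> keys f \<Longrightarrow> u \<noteq> lm r f \<Longrightarrow> (u, lm r f) \<in> r"
proof -
  have "\<exists>w\<in>A. \<forall>u\<in>A. u \<noteq> w \<longrightarrow> (u, w) \<in> r" if "finite A" "A \<noteq> {}" for A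
    using that
  proof (induction A rule: finite_ne_induct)
    case (insert x A)
    then obtain w where w: "w \<in> A" "\<forall>u\<in>A. u \<noteq> w \<longrightarrow> (u, w) \<in> r" by blast
    have "x \<noteq> w" using w(1) insert.hyps by blast
    then consider "(x, w) \<in> r" | "(w, x) \<in> r" using total_r by (meson UNIV_I total_on_def)
    then show ?case
    proof cases
      case 1
      then show ?thesis using w by (intro bexI[of _ w]) auto
    next
      case 2
      then have "(u, x) \<in> r" if "u \<in> A" for u
        using w(2) that trans_r by (cases "u = w") (auto dest: transD)
      then show ?thesis by (intro bexI[of _ x]) auto
    qed
  qed auto
  then obtain w where w: "w \<in> keys f" "\<forall>u\<in>keys f. u \<noteq> w \<longrightarrow> (u, w) \<in> r"
    using assms by (metis finite_keys keys_eq_empty)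
  then have "lm r f = w" by (intro lm_eqI) auto
  with w show "lm r f \<in> keys f"
    "u \<in> keys f \<Longrightarrow> u \<noteq> lm r f \<Longrightarrow> (u, lm r f) \<in> r" by auto
qed

end

text \<open>
  If the leading word of \<open>f \<in> I\<close> were normal, then no other word of \<open>f\<close> could have it as normal
  form, since normal forms descend; its coefficient would survive in the normal form of \<open>f\<close>,
  which is zero. Conversely a word that is not normal is the leading word of its difference to its
  normal form.
\<close>

lemma (in normal_form) lm_image_eq:
  assumes "word_order r" and desc: "\<And>w v. nf w = Some v \<Longrightarrow> v \<noteq> w \<Longrightarrow> (v, w) \<in> r"
  shows "{word (lm r f) | f. f \<in> I \<and> f \<noteq> 0} = (word ` {w. \<not> normal w} :: ('z, 'k) falg set)"
proof -
  interpret word_order r by fact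
  have asym: "(v, w) \<in> r \<Longrightarrow> (w, v) \<notin> r" for v w
    using trans_r irrefl_r by (meson irrefl_def transD)
  have "\<not> normal (lm r f)" if f: "f \<in> I" "f \<noteq> 0" for f
  proof
    assume n: "normal (lm r f)"
    have "(if nf w = Some (lm r f) then lookup f w else 0)
        = (if w = lm r f then lookup f w else 0)" if "w \<in> keys f" for w
      using n desc[of w "lm r f"] lm_props(2)[OF f(2) that] asym by auto
    then have "lookup (reduce nf f) (lm r f)
        = (\<Sum>w\<in>keys f. if w = lm r f then lookup f w else 0)"
      unfolding lookup_reduce by (intro sum.cong) simp_all
    then have "lookup (reduce nf f) (lm r f) = lookup f (lm r f)"
      by (simp add: in_keys_iff)
    then show False
      using reduce_null[OF f(1)] lm_props(1)[OF f(2)] by (simp add: in_keys_iff)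
  qed
  moreover have "\<exists>f. word w = (word (lm r f) :: ('z, 'k) falg) \<and> f \<in> I \<and> f \<noteq> 0" if w: "\<not> normal w" for w
  proof -
    let ?f = "single w 1 - nf_word (nf w) 1 :: ('z, 'k) falg"
    have l: "lookup ?f w = 1"
      using w by (auto simp: lookup_nf_word lookup_minus)
    then have "?f \<noteq> 0" by auto
    moreover have "lm r ?f = w"
    proof (rule lm_eqI)
      show "w \<in> keys ?f" using l by (simp add: in_keys_iff)
      fix u assume "u \<in> keys ?f" "u \<noteq> w"
      then have "nf w = Some u"
        by (auto simp: lookup_nf_word in_keys_iff lookup_minus lookup_single when_def split: if_splits)
      with \<open>u \<noteq> w\<close> show "(u, w) \<in> r" by (intro desc)
    qed
    ultimately show ?thesis using nf_cong[of w] by (intro exI[of _ ?f]) simp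
  qed
  ultimately show ?thesis by blast
qed

section \<open>Exactness by splitting off tight basis elements\<close>

abbreviation bvec :: "'z list \<Rightarrow> 'z list \<Rightarrow> 'k \<Rightarrow> ('z, 'k::field) fvec" where
  "bvec g m c \<equiv> single g (single m c)"

text \<open>
  One place \<open>D \<circ> D'\<close> of a complex over the quotient, together with a choice of basis elements
  \<open>g m\<close> called tight, which are meant to span a complement of the image of \<open>D'\<close>.
\<close>

locale exactness = normal_form I nf for I :: "('z, 'k::field) falg set" and nf +
  fixes W W' :: "'z list set" and D D' :: "'z list \<Rightarrow> ('z, 'k) fvec"
    and tight :: "'z list \<Rightarrow> 'z list \<Rightarrow> bool"
begin

definition tight_vec :: "('z, 'k) fvec \<Rightarrow> bool" where
  "tight_vec t \<longleftrightarrow> keys t \<subseteq> W \<and>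
     (\<forall>g. \<forall>m\<in>keys (lookup t g). normal m \<and> tight g m)"

definition splits :: "('z, 'k) fvec \<Rightarrow> bool" where
  "splits v \<longleftrightarrow> (\<exists>u t. keys u \<subseteq> W' \<and> tight_vec t \<and> vec_null (v - dmap D' u - t))"

lemma tight_vec_zero: "tight_vec 0"
  by (simp add: tight_vec_def)

lemma tight_vec_add: "tight_vec s \<Longrightarrow> tight_vec t \<Longrightarrow> tight_vec (s + t)"
  using keys_add[of s t] keys_add[of "lookup s g" "lookup t g" for g]
  unfolding tight_vec_def lookup_add by blast

lemma splits_add: "splits v \<Longrightarrow> splits w \<Longrightarrow> splits (v + w)"
  unfolding splits_def
proof (elim exE conjE)
  fix u t u' t'
  assume a: "keys u \<subseteq> W'" "tight_vec t" "vec_null (v - dmap D' u - t)"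
    "keys u' \<subseteq> W'" "tight_vec t'" "vec_null (w - dmap D' u' - t')"
  have "vec_null (v + w - dmap D' (u + u') - (t + t'))"
    using vec_null_add[OF a(3) a(6)] by (simp add: dmap_add algebra_simps)
  then show "\<exists>u t. keys u \<subseteq> W' \<and> tight_vec t \<and> vec_null (v + w - dmap D' u - t)"
    using a(1,4) keys_add[of u u'] tight_vec_add[OF a(2,5)]
    by (intro exI[of _ "u + u'"] exI[of _ "t + t'"] conjI) auto
qed

lemma splits_image: "keys u \<subseteq> W' \<Longrightarrow> splits (dmap D' u)"
  unfolding splits_def by (intro exI[of _ u] exI[of _ 0]) (simp add: tight_vec_zero)

lemma splits_null: "vec_null v \<Longrightarrow> splits v"
  unfolding splits_def by (intro exI[of _ 0]) (simp add: tight_vec_zero)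

lemma splits_cong:
  assumes "splits w" "vec_null (v - w)" shows "splits v"
  using splits_add[OF assms(1) splits_null[OF assms(2)]] by simp

lemma splits_tight:
  assumes "g \<in> W" "normal m" "tight g m"
  shows "splits (bvec g m c)"
proof -
  have "tight_vec (bvec g m c)"
    using assms by (auto simp: tight_vec_def lookup_single when_def split: if_splits)
  then show ?thesis
    unfolding splits_def by (intro exI[of _ 0] exI[of _ "bvec g m c"]) simp
qed

lemma bvec_cong: "nf w = nf v \<Longrightarrow> vec_null (bvec g w c - bvec g v c)"
  using vec_null_single[OF single_cong, of w v g c] by (simp add: single_diff)

lemma splits_bvec:
  assumes "\<And>m. normal m \<Longrightarrow> splits (bvec g m c)"
  shows "splits (bvec g w c)"
proof (cases "nf w")
  case None
  then show ?thesis by (intro splits_null vec_null_single single_None)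
next
  case (Some m)
  then have "normal m" by (rule nf_idem)
  then have "vec_null (bvec g w c - bvec g m c)" using Some by (intro bvec_cong) simp
  with assms[OF \<open>normal m\<close>] show ?thesis by (rule splits_cong)
qed

text \<open>
  In applications the first term of \<open>D' g\<close> times \<open>m\<close> is the basis element \<open>v\<close> and the remaining
  terms are already known to split.
\<close>

lemma splits_step:
  assumes "g \<in> W'" and "splits (v - rscale (D' g) (single m c))"
  shows "splits v"
proof -
  have "splits (rscale (D' g) (single m c))"
    using splits_image[of "bvec g m c"] assms(1) by (simp split: if_splits)
  from splits_add[OF assms(2) this] show ?thesis by simp
qed


text \<open>The matrix of the differential with respect to the bases formed by normal words.\<close>

definition entry :: "'z list \<Rightarrow> 'z list \<Rightarrow> 'z list \<Rightarrow> 'z list \<Rightarrow> 'k" where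
  "entry g m j w =
     lookup (reduce nf (lookup (D g) j * single m 1)) w"

lemma lookup_reduce_mult:
  fixes p f :: "('z, 'k) falg"
  shows "lookup (reduce nf (p * f)) w =
    (\<Sum>m\<in>keys f.
       lookup (reduce nf (p * single m 1)) w * lookup f m)"
proof -
  let ?e = "\<lambda>m. lookup (reduce nf (p * single m 1)) w"
  have single: "lookup (reduce nf (p * single m c)) w = ?e m * c" for m c
    by (induction p rule: poly_mapping_monomial_induct)
       (simp_all add: distrib_right reduce_add lookup_add lookup_nf_word)
  have "reduce nf (p * f) =
      reduce nf (p * (\<Sum>m\<in>keys f. single m (lookup f m)))"
    by (simp only: sum_keys_single)
  also have "lookup \<dots> w = (\<Sum>m\<in>keys f.
      lookup (reduce nf (p * single m (lookup f m))) w)"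
    by (simp add: sum_distrib_left reduce_sum lookup_sum)
  also have "\<dots> = (\<Sum>m\<in>keys f. ?e m * lookup f m)"
    by (rule sum.cong[OF refl single])
  finally show ?thesis .
qed

text \<open>
  In a nonzero kernel element, look at a tight basis element of least rank. At the row that it owns,
  all other basis elements of the kernel element have coefficient zero, since the only exceptions
  allowed have smaller rank; so its own coefficient must vanish.
\<close>

lemma tight_injective:
  fixes rank :: "'z list \<Rightarrow> 'z list \<Rightarrow> nat"
  assumes leading: "\<And>g m. g \<in> W \<Longrightarrow> normal m \<Longrightarrow> tight g m \<Longrightarrow> \<exists>j w. entry g m j w \<noteq> 0 \<and>
      (\<forall>g' m'. g' \<in> W \<longrightarrow> normal m' \<longrightarrow> tight g' m' \<longrightarrow> entry g' m' j w \<noteq> 0 \<longrightarrow>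
          g' = g \<and> m' = m \<or> rank g' m' < rank g m)"
    and t: "tight_vec t" and null: "vec_null (dmap D t)"
  shows "t = 0"
proof (rule ccontr)
  assume "t \<noteq> 0"
  let ?K = "SIGMA g:keys t. keys (lookup t g)"
  obtain g where g: "g \<in> keys t"
    using \<open>t \<noteq> 0\<close> by (metis all_not_in_conv keys_eq_empty)
  then have "lookup t g \<noteq> 0" by (simp add: in_keys_iff)
  then obtain m where "m \<in> keys (lookup t g)"
    by (metis all_not_in_conv keys_eq_empty)
  with g have "(g, m) \<in> ?K" by blast
  from ex_has_least_nat[of "\<lambda>k. k \<in> ?K", OF this, of "\<lambda>(g, m). rank g m"]
  obtain g m where gmK: "(g, m) \<in> ?K"
    and min: "\<And>g' m'. (g', m') \<in> ?K \<Longrightarrow> rank g m \<le> rank g' m'"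
    by force
  then have g: "g \<in> keys t" and m: "m \<in> keys (lookup t g)"
    by auto
  have gm: "g \<in> W" "normal m" "tight g m"
    using t g m by (auto simp: tight_vec_def)
  from leading[OF this] obtain j w where own: "entry g m j w \<noteq> 0"
    and others: "\<And>g' m'. g' \<in> W \<Longrightarrow> normal m' \<Longrightarrow> tight g' m' \<Longrightarrow> entry g' m' j w \<noteq> 0 \<Longrightarrow>
          g' = g \<and> m' = m \<or> rank g' m' < rank g m" by blast
  let ?c = "\<lambda>g' m'. entry g' m' j w * lookup (lookup t g') m'"
  have vanish: "?c g' m' = 0"
    if "g' \<in> keys t" "m' \<in> keys (lookup t g')"
      "\<not> (g' = g \<and> m' = m)" for g' m'
  proof -
    have "g' \<in> W" "normal m'" "tight g' m'" using t that by (auto simp: tight_vec_def)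
    then have "entry g' m' j w = 0" using others[of g' m'] min[of g' m'] that by fastforce
    then show ?thesis by simp
  qed
  have "lookup (reduce nf (lookup (dmap D t) j)) w
      = (\<Sum>g'\<in>keys t. \<Sum>m'\<in>keys (lookup t g'). ?c g' m')"
    unfolding lookup_dmap_keys reduce_sum lookup_sum entry_def
    by (rule sum.cong[OF refl lookup_reduce_mult])
  also have "\<dots> = (\<Sum>m'\<in>keys (lookup t g). ?c g m')"
    using g vanish by (subst sum.remove[OF _ g]) (auto intro!: sum.neutral)
  also have "\<dots> = ?c g m"
  proof (subst sum.remove[OF _ m])
    have "(\<Sum>m'\<in>keys (lookup t g) - {m}. ?c g m') = 0"
      using vanish[OF g] by (intro sum.neutral) blast
    then show "?c g m + (\<Sum>m'\<in>keys (lookup t g) - {m}. ?c g m') = ?c g m"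
      by simp
  qed simp
  finally have "?c g m = 0"
    using reduce_null null by (simp add: vec_null_def)
  then show False using own m by (simp add: in_keys_iff)
qed

text \<open>
  Subtracting an element of the image from a kernel element leaves a tight kernel element, which is
  zero by injectivity.
\<close>

lemma exact_if_split:
  assumes complex: "\<And>g. g \<in> W' \<Longrightarrow> vec_null (dmap D (D' g))"
    and split: "\<And>g m c. g \<in> W \<Longrightarrow> normal m \<Longrightarrow> splits (bvec g m c)"
    and inj: "\<And>t. tight_vec t \<Longrightarrow> vec_null (dmap D t) \<Longrightarrow> t = 0"
    and v: "keys v \<subseteq> W"
  shows "vec_null (dmap D v) \<longleftrightarrow> (\<exists>u. keys u \<subseteq> W' \<and> vec_null (v - dmap D' u))"
proof -
  have "splits (single g f)" if "g \<in> W" for g f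
    by (induction f rule: poly_mapping_monomial_induct)
       (auto simp: single_add intro: splits_add splits_null splits_bvec split that)
  then have "splits v"
    by (intro poly_mapping_monomial_induct[of splits v])
       (use v in \<open>auto intro: splits_add splits_null\<close>)
  then obtain u t where ut: "keys u \<subseteq> W'" "tight_vec t" "vec_null (v - dmap D' u - t)"
    unfolding splits_def by blast
  have compl: "vec_null (dmap D (dmap D' u))" if "keys u \<subseteq> W'" for u
  proof (rule poly_mapping_monomial_induct[of "\<lambda>u. vec_null (dmap D (dmap D' u))"])
    fix g f assume "g \<in> keys u"
    then have "vec_null (dmap D (D' g))" using that by (intro complex) auto
    then show "vec_null (dmap D (dmap D' (single g f)))"
      by (simp add: dmap_rscale vec_null_rscale)
  qed (auto simp: dmap_add intro: vec_null_add)
  show ?thesis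
  proof
    assume "vec_null (dmap D v)"
    moreover have "dmap D t = dmap D v - dmap D (dmap D' u) - dmap D (v - dmap D' u - t)"
      by (simp add: dmap_diff)
    ultimately have "vec_null (dmap D t)"
      using compl[OF ut(1)] ut(3) by (simp add: vec_null_diff vec_null_dmap)
    then have "t = 0" using inj[OF ut(2)] by blast
    then show "\<exists>u. keys u \<subseteq> W' \<and> vec_null (v - dmap D' u)" using ut by auto
  next
    assume "\<exists>u. keys u \<subseteq> W' \<and> vec_null (v - dmap D' u)"
    then obtain u where u: "keys u \<subseteq> W'" "vec_null (v - dmap D' u)" by blast
    have "dmap D v = dmap D (v - dmap D' u) + dmap D (dmap D' u)" by (simp add: dmap_diff)
    then show "vec_null (dmap D v)" using u compl by (simp add: vec_null_add vec_null_dmap)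
  qed
qed

end

section \<open>Balanced words\<close>

instance letter :: countable
  by countable_datatype

lemma UNIV_letter: "(UNIV :: letter set) = {La', Lb', La, Lb, Le, Lx, Ly}"
  by (auto intro: letter.exhaust)

lemma finite_letter: "finite (UNIV :: letter set)"
  by (simp add: UNIV_letter)

inductive_set balanced :: "letter list set" where
  Nil: "[] \<in> balanced"
| step: "u \<in> balanced \<Longrightarrow> v \<in> balanced \<Longrightarrow> La # u @ Lb # v \<in> balanced"

inductive_set blocks :: "letter list set" where
  Nil: "[] \<in> blocks"
| step: "u \<in> balanced \<Longrightarrow> v \<in> blocks \<Longrightarrow> u @ Le # v \<in> blocks"

lemma balanced_letters: "u \<in> balanced \<Longrightarrow> set u \<subseteq> {La, Lb}"
  by (induction rule: balanced.induct) auto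

lemma blocks_letters: "w \<in> blocks \<Longrightarrow> set w \<subseteq> {La, Lb, Le}"
  by (induction rule: blocks.induct) (auto dest: balanced_letters)

lemma blocks_Cons_e: "v \<in> blocks \<Longrightarrow> Le # v \<in> blocks"
  using blocks.step[OF balanced.Nil] by simp

lemma blocks_wrap:
  assumes "u \<in> balanced" "v \<in> blocks" "v \<noteq> []"
  shows "La # u @ Lb # v \<in> blocks"
  using assms(2,3)
proof cases
  case (step u' v')
  then show ?thesis
    using blocks.step[OF balanced.step[OF assms(1) step(2)] step(3)] by simp
qed simp

text \<open>
  The case distinction behind the Groebner basis: the second case arises from \<open>b'\<close>, the third from
  \<open>a'\<close>. In the third case \<open>v\<close> cannot be empty, because the block containing the bracket pair still
  has its final \<open>e\<close>.
\<close>

lemma blocks_cases_head: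
  assumes "w \<in> blocks"
  obtains "w = []" | v where "w = Le # v" "v \<in> blocks"
    | u v where "w = La # u @ Lb # v" "u \<in> balanced" "v \<in> blocks" "v \<noteq> []"
  using assms
proof cases
  case (step u v)
  from step(2) show ?thesis
  proof cases
    case Nil
    then show ?thesis using step that(2) by simp
  next
    case (step u' v')
    then show ?thesis
      using that(3)[of u' "v' @ Le # v"] blocks.step[OF step(3) \<open>v \<in> blocks\<close>] \<open>w = u @ Le # v\<close> by simp
  qed
qed (rule that(1))

text \<open>
  A balanced word followed by a letter other than the opening bracket can be read off from the
  left, so the factorisations below are unique.
\<close>

lemma balanced_unique:
  assumes "u \<in> balanced" "u' \<in> balanced" "u @ c # m = u' @ c' # m'" "c \<noteq> La" "c' \<noteq> La"
  shows "u = u' \<and> c # m = c' # m'"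
  using assms
proof (induction arbitrary: u' c m c' m' rule: balanced.induct)
  case Nil
  from Nil(1) show ?case using Nil by cases auto
next
  case (step p q)
  from step.prems(1) show ?case
  proof cases
    case Nil
    then show ?thesis using step.prems by auto
  next
    case (step p' q')
    then have eq: "p @ Lb # (q @ c # m) = p' @ Lb # (q' @ c' # m')" using step.prems by simp
    from step.IH(1)[OF step(2) eq] have p: "p = p'" and q: "q @ c # m = q' @ c' # m'" by simp_all
    from step.IH(2)[OF step(3) q] step.prems(3,4) have "q = q' \<and> c # m = c' # m'" by blast
    with p step(1) show ?thesis by simp
  qed
qed

lemma blocks_unique:
  assumes "w \<in> blocks" "w' \<in> blocks" "w @ Ly # m = w' @ Ly # m'"
  shows "w = w' \<and> m = m'"
  using assms
proof (induction arbitrary: w' rule: blocks.induct)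
  case Nil
  show ?case
  proof (cases w')
    case (Cons c s)
    then show ?thesis using blocks_letters[OF Nil(1)] Nil(2) by simp
  qed (use Nil(2) in simp)
next
  case (step u v)
  from step.prems(1) show ?case
  proof cases
    case Nil
    then show ?thesis using step.prems(2) balanced_letters[OF step.hyps(1)] by (cases u) auto
  next
    case (step u' v')
    then have "u = u' \<and> Le # (v @ Ly # m) = Le # (v' @ Ly # m')"
      using step.hyps(1) step.prems by (intro balanced_unique) auto
    with step.IH[OF step(3)] step(1) show ?thesis by auto
  qed
qed

section \<open>The rewriting system\<close>

text \<open>
  Left sides are the leading monomials of the binomials, right sides the remaining monomials.
\<close>

fun rule2 :: "letter \<Rightarrow> letter \<Rightarrow> (letter \<times> letter) option" where
  "rule2 La' Lx = Some (Lx, La')"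
| "rule2 La' La = Some (La, La')"
| "rule2 La' Lb = Some (La, Lb')"
| "rule2 La' Le = Some (La, Lb)"
| "rule2 La' Ly = Some (Ly, Ly)"
| "rule2 Lb' Lx = Some (Lx, Le)"
| "rule2 Lb' La = Some (Lb, La')"
| "rule2 Lb' Lb = Some (Lb, Lb')"
| "rule2 Lb' Le = Some (Lb, Lb)"
| "rule2 Lb' Ly = Some (Ly, Ly)"
| "rule2 La Ly = Some (Ly, Ly)"
| "rule2 Lb Ly = Some (Ly, Ly)"
| "rule2 _ _ = None"

definition xLy_words :: "letter list set" where
  "xLy_words = {Lx # w @ [Ly] | w. w \<in> blocks}"

text \<open>
  The minimal monomial basis of the leading monomial ideal (\<open>minimal_monomial_basis_B\<close>).
\<close>

definition obstructions :: "letter list set" where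
  "obstructions = {[p, z] | p z. rule2 p z \<noteq> None} \<union> xLy_words"

abbreviation primed :: "letter \<Rightarrow> bool" where "primed p \<equiv> p = La' \<or> p = Lb'"

text \<open>
  Multiplying such a word by \<open>x\<close> from the left gives zero.
\<close>

definition blocked :: "letter list \<Rightarrow> bool" where
  "blocked n \<longleftrightarrow> (\<exists>w\<in>blocks. \<exists>m. n = w @ Ly # m)"

text \<open>
  The normal form of \<open>z n\<close> for a normal word \<open>n\<close>, defined on all words so that the relations
  hold without a normality assumption. This part treats the unprimed letters; a primed letter is
  rewritten along its word by recursion.
\<close>

definition base_act :: "letter \<Rightarrow> letter list \<Rightarrow> letter list option" where
  "base_act z n =
    (if z = Lx then if blocked n then None else Some (Lx # n)
     else if (z = La \<or> z = Lb) \<and> n \<noteq> [] \<and> hd n = Ly then Some (Ly # n)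
     else Some (z # n))"

primrec primed_act :: "letter list \<Rightarrow> letter \<Rightarrow> letter list option" where
  "primed_act [] p = Some [p]"
| "primed_act (z # n) p =
    (case rule2 p z of
       None \<Rightarrow> Some (p # z # n)
     | Some (u, v) \<Rightarrow> Option.bind (if primed v then primed_act n v else base_act v n) (base_act u))"

definition act :: "letter \<Rightarrow> letter list \<Rightarrow> letter list option" where
  "act z n = (if primed z then primed_act n z else base_act z n)"

primrec act_word :: "letter list \<Rightarrow> letter list \<Rightarrow> letter list option" where
  "act_word [] n = Some n"
| "act_word (z # u) n = Option.bind (act_word u n) (act z)"

definition nfA :: "letter list \<Rightarrow> letter list option" where
  "nfA w = act_word w []"

lemma nfA_simps [simp]: "nfA [] = Some []" "nfA (z # w) = Option.bind (nfA w) (act z)"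
  by (simp_all add: nfA_def)

lemma act_word_append: "act_word (u @ v) n = Option.bind (act_word v n) (act_word u)"
  by (induction u) auto

lemma nfA_append: "nfA (u @ v) = Option.bind (nfA v) (act_word u)"
  by (simp add: nfA_def act_word_append)

lemma act_y [simp]: "act Ly n = Some (Ly # n)" and act_e [simp]: "act Le n = Some (Le # n)"
  by (simp_all add: act_def base_act_def)

lemma act_unprimed: "\<not> primed z \<Longrightarrow> act z = base_act z"
  by (rule ext) (simp add: act_def)

lemma rule2_unprimed: "rule2 p z = Some (u, v) \<Longrightarrow> \<not> primed u"
  by (cases p; cases z; auto)

lemma act_Cons_rule:
  assumes "primed p"
  shows "act p (z # n) =
    (case rule2 p z of None \<Rightarrow> Some (p # z # n) | Some (u, v) \<Rightarrow> Option.bind (act v n) (act u))"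
proof (cases "rule2 p z")
  case (Some uv)
  obtain u v where uv: "uv = (u, v)" by (cases uv)
  have u: "base_act u = act u"
    using act_unprimed[OF rule2_unprimed[OF Some[unfolded uv]]] by (rule sym)
  have v: "(if primed v then primed_act n v else base_act v n) = act v n"
    by (simp only: act_def)
  have "act p (z # n) = primed_act (z # n) p" using assms by (simp only: act_def if_True)
  then show ?thesis
    by (simp only: primed_act.simps Some uv option.case prod.case u v)
qed (use assms in \<open>simp add: act_def\<close>)

lemma act_ab:
  "z = La \<or> z = Lb \<Longrightarrow> act z n = Some (if n \<noteq> [] \<and> hd n = Ly then Ly # n else z # n)"
  by (auto simp: act_def base_act_def)

lemma act_x: "act Lx n = (if blocked n then None else Some (Lx # n))"
  by (simp add: act_def base_act_def)

lemma blocked_y [simp]: "blocked (Ly # m)"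
  unfolding blocked_def using blocks.Nil by (intro bexI[of _ "[]"] exI[of _ m]) auto

lemma blocked_e [simp]: "blocked (Le # n) \<longleftrightarrow> blocked n"
proof
  assume "blocked n"
  then obtain w m where "w \<in> blocks" "n = w @ Ly # m" by (auto simp: blocked_def)
  then show "blocked (Le # n)"
    unfolding blocked_def using blocks_Cons_e[of w] by (intro bexI[of _ "Le # w"]) auto
next
  assume "blocked (Le # n)"
  then obtain w m where "w \<in> blocks" "Le # n = w @ Ly # m" by (auto simp: blocked_def)
  then show "blocked n"
    by (elim blocks_cases_head[of w]) (auto simp: blocked_def)
qed

definition unprime :: "letter \<Rightarrow> letter" where "unprime p = (if p = La' then La else Lb)"

lemma rule2_primed:
  assumes "primed p"
  shows "rule2 p La = Some (unprime p, La')" "rule2 p Lb = Some (unprime p, Lb')"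
    "rule2 p Le = Some (unprime p, Lb)" "rule2 p Ly = Some (Ly, Ly)"
  using assms by (auto simp: unprime_def)

text \<open>
  A primed letter travels through a word in the brackets and turns the next \<open>e\<close> into a
  closing bracket; if a \<open>y\<close> follows, everything to its left collapses to a power of \<open>y\<close>.
\<close>

lemma act_through_brackets:
  assumes "set s \<subseteq> {La, Lb}" "primed p"
  shows "act p (s @ Le # m) =
    Some (if m \<noteq> [] \<and> hd m = Ly then replicate (length s + 2) Ly @ m else unprime p # s @ Lb # m)"
  using assms
proof (induction s arbitrary: p)
  case Nil
  then show ?case
    by (auto simp: act_Cons_rule rule2_primed act_ab unprime_def)
next
  case (Cons c s)
  then obtain q where q: "primed q" "unprime q = c" "rule2 p c = Some (unprime p, q)"
    by (auto simp: rule2_primed unprime_def)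
  have IH: "act q (s @ Le # m) =
      Some (if m \<noteq> [] \<and> hd m = Ly then replicate (length s + 2) Ly @ m else c # s @ Lb # m)"
    using Cons.IH[of q] Cons.prems q by simp
  have p: "unprime p = La \<or> unprime p = Lb" and c: "c \<noteq> Ly"
    using Cons.prems by (auto simp: unprime_def)
  have "act p ((c # s) @ Le # m) = Option.bind (act q (s @ Le # m)) (act (unprime p))"
    using act_Cons_rule[OF Cons.prems(2), of c "s @ Le # m"] by (simp only: q append_Cons option.case prod.case)
  then show ?case
    using c by (simp add: IH act_ab[OF p])
qed

lemma act_prime_y: "primed p \<Longrightarrow> act p (Ly # m) = Some (Ly # Ly # m)"
  by (auto simp: act_Cons_rule)

lemma blocks_hd_not_y: "v \<in> blocks \<Longrightarrow> v \<noteq> [] \<Longrightarrow> hd (v @ m) \<noteq> Ly"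
  using blocks_letters[of v] by (cases v) auto

lemma act_block:
  assumes "u \<in> balanced" "v \<in> blocks" "primed p"
  shows "act p (u @ Le # v @ Ly # m) =
    Some (if v = [] then replicate (length u + 2) Ly @ Ly # m else unprime p # u @ Lb # v @ Ly # m)"
  using act_through_brackets[OF balanced_letters[OF assms(1)] assms(3), of "v @ Ly # m"]
    blocks_hd_not_y[OF assms(2), of "Ly # m"] by (cases "v = []") auto

text \<open>
  This is the overlap of \<open>a' x\<close> with \<open>x w y\<close>: the opening bracket produced by \<open>a'\<close> is closed at
  the first \<open>e\<close>, so the result starts again with a word in \<open>(D e)\<^sup>* y\<close>. If there was only one block,
  everything collapses to a power of \<open>y\<close>, which is also blocked.
\<close>

lemma blocked_act_La':
  assumes "blocked n" shows "\<exists>r. act La' n = Some r \<and> blocked r"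
proof -
  from assms obtain w m where w: "w \<in> blocks" "n = w @ Ly # m" by (auto simp: blocked_def)
  from w(1) show ?thesis
  proof cases
    case Nil
    then show ?thesis using w by (simp add: act_prime_y)
  next
    case (step u v)
    have "blocked (La # u @ Lb # v @ Ly # m)" if "v \<noteq> []"
      unfolding blocked_def using blocks_wrap[OF step(2,3) that]
      by (intro bexI[of _ "La # u @ Lb # v"] exI[of _ m]) simp_all
    moreover have "replicate (length u + 2) Ly @ Ly # m = Ly # (replicate (length u + 1) Ly @ Ly # m)"
      by simp
    ultimately show ?thesis
      using act_block[OF step(2,3), of La' m] w(2) step(1) by (auto simp: unprime_def)
  qed
qed

text \<open>
  All relations hold in the representation. The two cases not immediate from the definition are the
  collapse at \<open>y\<close> after a bracket, and \<open>x\<close> applied to a blocked word.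
\<close>

lemma act_rule2:
  assumes "rule2 p z = Some (u, v)"
  shows "Option.bind (act z n) (act p) = Option.bind (act v n) (act u)"
proof -
  consider "primed p" "z \<noteq> Lx" | "primed p" "z = Lx" | "\<not> primed p" by blast
  then show ?thesis
  proof cases
    case 1
    show ?thesis
    proof (cases "act z n = Some (z # n)")
      case True
      then show ?thesis using 1 assms by (simp add: act_Cons_rule)
    next
      case False
      then have z: "z = La \<or> z = Lb" "n \<noteq> []" "hd n = Ly"
        using 1 assms by (cases p; cases z; auto simp: act_ab split: if_splits)+
      then obtain n' where n: "n = Ly # n'" by (cases n) auto
      have "primed v" "u = La \<or> u = Lb" using z 1 assms by auto
      then show ?thesis using z 1 by (auto simp: n act_ab act_prime_y)
    qed
  next
    case 2
    show ?thesis
    proof (cases "blocked n")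
      case True
      then show ?thesis using 2 assms blocked_act_La'[OF True] by (auto simp: act_x)
    next
      case False
      then show ?thesis using 2 assms by (simp add: act_x act_Cons_rule)
    qed
  next
    case 3
    then have "p = La \<or> p = Lb" "z = Ly" "u = Ly" "v = Ly"
      using assms by (cases p; cases z; auto)+
    then show ?thesis by (auto simp: act_ab)
  qed
qed

lemma nfA_rule2: "rule2 p z = Some (u, v) \<Longrightarrow> nfA (s @ [p, z] @ t) = nfA (s @ [u, v] @ t)"
  by (cases "nfA t") (simp_all add: nfA_append act_rule2)

lemma nfA_xy: "nfA (s @ [Lx, Ly] @ t) = None"
  by (cases "nfA t") (simp_all add: nfA_append act_x)

section \<open>Normal words\<close>

lemma rank_rule2: "rule2 p z = Some (u, v) \<Longrightarrow> letter_rank u < letter_rank p"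
  by (cases p; cases z; auto)

lemma base_act_rank:
  "base_act z n = Some r \<Longrightarrow>
    length r = Suc (length n) \<and> (r = z # n \<or> letter_rank (hd r) < letter_rank z)"
  by (auto simp: base_act_def split: if_splits)

text \<open>
  A letter that does not simply get prepended is replaced at the front by a smaller letter, so the
  action descends in the monomial order.
\<close>

lemma act_rank:
  "act z n = Some r \<Longrightarrow>
    length r = Suc (length n) \<and> (r = z # n \<or> letter_rank (hd r) < letter_rank z)"
proof (induction n arbitrary: z r)
  case Nil
  then show ?case by (auto simp: act_def base_act_def split: if_splits)
next
  case (Cons c n)
  show ?case
  proof (cases "primed z")
    case True
    show ?thesis
    proof (cases "rule2 z c")
      case None
      then show ?thesis using Cons.prems True by (auto simp: act_Cons_rule)
    next
      case (Some uv)
      then obtain u v where uv: "rule2 z c = Some (u, v)" by (cases uv) auto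
      then obtain s where s: "act v n = Some s" "act u s = Some r"
        using Cons.prems True by (auto simp: act_Cons_rule bind_eq_Some_conv)
      have "base_act u s = Some r" using s(2) act_unprimed[OF rule2_unprimed[OF uv]] by simp
      from base_act_rank[OF this] Cons.IH[OF s(1)] rank_rule2[OF uv] show ?thesis by auto
    qed
  next
    case False
    then show ?thesis using base_act_rank Cons.prems by (simp add: act_def)
  qed
qed

lemma word_order_glex: "word_order glex"
proof
  have "trans (measure letter_rank)" by (simp add: trans_def)
  then show "trans glex" unfolding glex_def by (rule lenlex_transI)
  have "wf glex" unfolding glex_def by (simp add: wf_lenlex)
  then show "irrefl glex" by (rule wf_imp_irrefl)
  have "p \<noteq> q \<Longrightarrow> letter_rank p < letter_rank q \<or> letter_rank q < letter_rank p" for p q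
    by (cases p; cases q; simp)
  then have "total (measure letter_rank)" by (simp add: total_on_def)
  then show "total glex" unfolding glex_def by (rule total_lenlex)
qed

lemma glex_hd: "length r = Suc (length n) \<Longrightarrow> letter_rank (hd r) < letter_rank z \<Longrightarrow> (r, z # n) \<in> glex"
  by (cases r) (auto simp: glex_def lenlex_conv)

lemma glex_Cons: "(u, v) \<in> glex \<Longrightarrow> (z # u, z # v) \<in> glex"
  by (simp add: glex_def Cons_lenlex_iff)

lemma nfA_descends: "nfA w = Some v \<Longrightarrow> length v = length w \<and> (v = w \<or> (v, w) \<in> glex)"
proof (induction w arbitrary: v)
  case (Cons z w)
  then obtain v' where v': "nfA w = Some v'" "act z v' = Some v" by (auto simp: bind_eq_Some_conv)
  interpret word_order glex by (rule word_order_glex)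
  from act_rank[OF v'(2)] Cons.IH[OF v'(1)] show ?case
    using glex_hd[of v v' z] glex_Cons[of v' w z] trans_r by (auto dest: transD)
qed simp

abbreviation normal_word :: "letter list \<Rightarrow> bool" where "normal_word w \<equiv> nfA w = Some w"

lemma normal_Cons: "normal_word (z # w) \<longleftrightarrow> normal_word w \<and> act z w = Some (z # w)"
proof
  assume a: "normal_word (z # w)"
  then obtain v where v: "nfA w = Some v" "act z v = Some (z # w)" by (auto simp: bind_eq_Some_conv)
  interpret word_order glex by (rule word_order_glex)
  from act_rank[OF v(2)] have "v = w" by auto
  with v show "normal_word w \<and> act z w = Some (z # w)" by simp
qed simp

lemma prefix_xLy_iff: "(\<exists>g\<in>xLy_words. prefix g (z # w)) \<longleftrightarrow> z = Lx \<and> blocked w"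
proof -
  have "prefix (Lx # u @ [Ly]) (z # w) \<longleftrightarrow> z = Lx \<and> (\<exists>m. w = u @ Ly # m)" for u
    by (auto simp: prefix_def)
  then show ?thesis unfolding xLy_words_def blocked_def by blast
qed

lemma prefix_rule_iff:
  "(\<exists>g\<in>{[p, c] | p c. rule2 p c \<noteq> None}. prefix g (z # w)) \<longleftrightarrow>
     w \<noteq> [] \<and> rule2 z (hd w) \<noteq> None"
proof -
  have "(\<exists>g\<in>{[p, c] | p c. rule2 p c \<noteq> None}. prefix g (z # w))
      \<longleftrightarrow> (\<exists>p c. rule2 p c \<noteq> None \<and> prefix [p, c] (z # w))" by blast
  then show ?thesis by (cases w) simp_all
qed

lemma act_tight_iff: "act z w = Some (z # w) \<longleftrightarrow> \<not> (\<exists>g\<in>obstructions. prefix g (z # w))"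
proof -
  have "act z w = Some (z # w) \<longleftrightarrow>
      \<not> (z = Lx \<and> blocked w) \<and> \<not> (w \<noteq> [] \<and> rule2 z (hd w) \<noteq> None)"
  proof (cases "primed z")
    case True
    show ?thesis
    proof (cases w)
      case (Cons c n)
      have "act z (c # n) \<noteq> Some (z # c # n)" if uv: "rule2 z c = Some (u, v)" for u v
      proof
        assume "act z (c # n) = Some (z # c # n)"
        then obtain s where s: "act v n = Some s" "act u s = Some (z # c # n)"
          using uv True by (auto simp: act_Cons_rule bind_eq_Some_conv)
        then show False using act_rank[OF s(2)] rank_rule2[OF uv] by auto
      qed
      then show ?thesis using True Cons by (cases "rule2 z c") (auto simp: act_Cons_rule)
    qed (use True in \<open>auto simp: act_def\<close>)
  next
    case False
    then have "rule2 z (hd w) \<noteq> None \<longleftrightarrow> (z = La \<or> z = Lb) \<and> hd w = Ly"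
      by (cases z; cases "hd w"; simp)
    then show ?thesis using False by (auto simp: act_def base_act_def)
  qed
  then show ?thesis
    unfolding obstructions_def bex_Un prefix_xLy_iff prefix_rule_iff by blast
qed

lemma normal_iff_sublist: "normal_word w \<longleftrightarrow> \<not> (\<exists>g\<in>obstructions. sublist g w)"
proof (induction w)
  case Nil
  then show ?case by (auto simp: obstructions_def xLy_words_def)
next
  case (Cons z w)
  then show ?case
    unfolding normal_Cons act_tight_iff by (auto simp: sublist_Cons_right)
qed

lemma normal_factor: "normal_word (u @ w @ v) \<Longrightarrow> normal_word w"
  unfolding normal_iff_sublist using sublist_order.order.trans sublist_appendI by blast

section \<open>The Groebner basis\<close>

lemma word_mult [simp]: "word u * word v = (word (u @ v) :: ('z, 'k::field) falg)"
  by (simp add: word_def)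

definition rule_pairs :: "letter list set" where
  "rule_pairs = {[p, z] | p z. rule2 p z \<noteq> None}"

lemma binomials_eq:
  "(binomials_i \<union> binomials_ii \<union> binomials_iii :: (letter, 'k::field) falg set) =
     {word [p, z] - word [u, v] | p z u v. rule2 p z = Some (u, v)}" (is "?l = ?r")
proof
  show "?l \<subseteq> ?r"
    unfolding binomials_i_def binomials_ii_def binomials_iii_def power2_eq_square
    by (auto intro!: exI)
  show "?r \<subseteq> ?l"
  proof
    fix f :: "(letter, 'k) falg" assume "f \<in> ?r"
    then obtain p z u v where "f = word [p, z] - word [u, v]" "rule2 p z = Some (u, v)" by blast
    then show "f \<in> ?l"
      unfolding binomials_i_def binomials_ii_def binomials_iii_def power2_eq_square
      by (cases p; cases z; simp)
  qed
qed

locale presented = free_ideal I for I :: "(letter, 'k::field) falg set" +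
  assumes rule_in: "rule2 p z = Some (u, v) \<Longrightarrow> word [p, z] - word [u, v] \<in> I"
    and xy_in: "word [Lx, Ly] \<in> I"
begin

lemma cong_context:
  assumes "word w - word v \<in> I"
  shows "word (s @ w @ t) - word (s @ v @ t) \<in> I"
proof -
  have "word s * (word w - word v) * word t \<in> I"
    using assms by (intro rmult_in lmult_in)
  then show ?thesis by (simp add: algebra_simps)
qed

lemma in_context:
  assumes "word w \<in> I" shows "word (s @ w @ t) \<in> I"
proof -
  have "word s * word w * word t \<in> I"
    using assms by (intro rmult_in lmult_in)
  then show ?thesis by simp
qed

lemma cong_rule: "rule2 p z = Some (u, v) \<Longrightarrow> word (s @ p # z # t) - word (s @ u # v # t) \<in> I"
  using cong_context[OF rule_in, of p z u v s t] by simp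

lemma cong_in: "word w - word v \<in> I \<Longrightarrow> word v \<in> I \<Longrightarrow> word w \<in> I"
  using add_in[of "word w - word v" "word v"] by simp

lemma cong_through_brackets:
  assumes "set s \<subseteq> {La, Lb}" "primed p"
  shows "word (p # s @ Le # m) - word (unprime p # s @ Lb # m) \<in> I"
  using assms
proof (induction s arbitrary: p)
  case Nil
  then show ?case using cong_rule[of p Le "unprime p" Lb "[]" m] by (auto simp: unprime_def)
next
  case (Cons c s)
  then obtain q where q: "primed q" "unprime q = c" "rule2 p c = Some (unprime p, q)"
    by (auto simp: rule2_primed unprime_def)
  have "word (p # c # s @ Le # m) - word (unprime p # q # s @ Le # m) \<in> I"
    using cong_rule[OF q(3), of "[]"] by simp
  moreover have "word (unprime p # q # s @ Le # m) - word (unprime p # c # s @ Lb # m) \<in> I"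
    using cong_context[OF Cons.IH[of q], of "[unprime p]" "[]"] Cons.prems q by simp
  ultimately show ?case using diff_trans by simp
qed

text \<open>
  A word \<open>x w y\<close> with \<open>w\<close> starting in \<open>e\<close> is the rewrite of \<open>b' x v y\<close>, one with \<open>w\<close> starting in
  a bracket pair is the rewrite of \<open>a' x v y\<close>, where in both cases \<open>v\<close> is shorter than \<open>w\<close>. So all
  these words are consequences of \<open>x y\<close>.
\<close>

lemma xLy_in: "w \<in> blocks \<Longrightarrow> word (Lx # w @ Ly # m) \<in> I"
proof (induction "length w" arbitrary: w rule: less_induct)
  case less
  from less.prems show ?case
  proof (cases rule: blocks_cases_head)
    case 1
    then show ?thesis using in_context[OF xy_in, of "[]" m] by simp
  next
    case (2 v)
    have "word (Lx # v @ Ly # m) \<in> I" using less.hyps[of v] 2 by simp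
    then have "word (Lb' # Lx # v @ Ly # m) \<in> I" using in_context[of _ "[Lb']" "[]"] by simp
    moreover have "word (Lx # Le # v @ Ly # m) - word (Lb' # Lx # v @ Ly # m) \<in> I"
      using cong_rule[of Lb' Lx Lx Le "[]" "v @ Ly # m"] by (simp add: diff_sym)
    ultimately show ?thesis using cong_in 2(1) by simp
  next
    case (3 u v)
    have "u @ Le # v \<in> blocks" using 3 by (intro blocks.step)
    then have "word (Lx # u @ Le # v @ Ly # m) \<in> I" using less.hyps[of "u @ Le # v"] 3 by simp
    then have "word (La' # Lx # u @ Le # v @ Ly # m) \<in> I" using in_context[of _ "[La']" "[]"] by simp
    moreover have "word (Lx # La' # u @ Le # v @ Ly # m) - word (La' # Lx # u @ Le # v @ Ly # m) \<in> I"
      using cong_rule[of La' Lx Lx La' "[]" "u @ Le # v @ Ly # m"] by (simp add: diff_sym)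
    moreover have "word (Lx # La # u @ Lb # v @ Ly # m) - word (Lx # La' # u @ Le # v @ Ly # m) \<in> I"
      using cong_context[OF cong_through_brackets[OF balanced_letters[OF 3(2)], of La' "v @ Ly # m"], of "[Lx]" "[]"]
      by (simp add: diff_sym unprime_def)
    ultimately show ?thesis using cong_in 3(1) by simp
  qed
qed

lemma cong_act: "word (z # n) - nf_word (act z n) 1 \<in> I"
proof -
  have base: "word (z # n) - nf_word (base_act z n) 1 \<in> I" for z n
  proof -
    have "z = Lx \<and> blocked n \<or> (z = La \<or> z = Lb) \<and> n \<noteq> [] \<and> hd n = Ly
        \<or> base_act z n = Some (z # n)"
      by (simp add: base_act_def)
    then consider "z = Lx" "blocked n" | "z = La \<or> z = Lb" "n \<noteq> []" "hd n = Ly"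
      | "base_act z n = Some (z # n)" by blast
    then show ?thesis
    proof cases
      case 1
      then show ?thesis using xLy_in by (auto simp: base_act_def blocked_def)
    next
      case 2
      then obtain m where n: "n = Ly # m" by (cases n) auto
      have "rule2 z Ly = Some (Ly, Ly)" using 2(1) by auto
      from cong_rule[OF this, of "[]" m] show ?thesis
        using 2 by (auto simp: n base_act_def word_def)
    next
      case 3
      then show ?thesis by (simp add: word_def zero_in)
    qed
  qed
  show ?thesis
  proof (induction n arbitrary: z)
    case Nil
    show ?case using base by (cases "primed z") (auto simp: act_def word_def zero_in)
  next
    case (Cons c n)
    show ?case
    proof (cases "primed z")
      case False
      then show ?thesis using base by (simp add: act_unprimed)
    next
      case True
      show ?thesis
      proof (cases "rule2 z c")
        case None
        then show ?thesis using True by (simp add: act_Cons_rule word_def zero_in)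
      next
        case (Some uv)
        then obtain u v where uv: "rule2 z c = Some (u, v)" by (cases uv) auto
        have act: "act z (c # n) = Option.bind (act v n) (act u)"
          using uv True by (simp add: act_Cons_rule)
        have step: "word (z # c # n) - word (u # v # n) \<in> I"
          using cong_rule[OF uv, of "[]"] by simp
        show ?thesis
        proof (cases "act v n")
          case None
          then have "word (v # n) \<in> I" using Cons.IH[of v] by simp
          then have "word (u # v # n) \<in> I" using in_context[of _ "[u]" "[]"] by simp
          then show ?thesis using cong_in[OF step] None act by simp
        next
          case (Some s)
          then have "word (v # n) - word s \<in> I" using Cons.IH[of v] by (simp add: word_def)
          then have "word (u # v # n) - word (u # s) \<in> I" using cong_context[of _ _ "[u]" "[]"] by simp
          moreover have "word (u # s) - nf_word (act u s) 1 \<in> I"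
            using base act_unprimed[OF rule2_unprimed[OF uv]] by simp
          ultimately show ?thesis using diff_trans[OF step diff_trans] Some act by simp
        qed
      qed
    qed
  qed
qed

lemma cong_nfA: "single w 1 - nf_word (nfA w) 1 \<in> I"
proof (induction w)
  case Nil
  then show ?case by (simp add: zero_in)
next
  case (Cons z w)
  show ?case
  proof (cases "nfA w")
    case None
    then have "word w \<in> I" using Cons.IH by (simp add: word_def)
    then have "word (z # w) \<in> I" using in_context[of _ "[z]" "[]"] by simp
    then show ?thesis using None by (simp add: word_def)
  next
    case (Some n)
    then have "word w - word n \<in> I" using Cons.IH by (simp add: word_def)
    then have "word (z # w) - word (z # n) \<in> I" using cong_context[of _ _ "[z]" "[]"] by simp
    from diff_trans[OF this cong_act] Some show ?thesis by (simp add: word_def)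
  qed
qed

end

definition idealA :: "(letter, 'k::field) falg set" where
  "idealA = genideal free_alg (binomials_i \<union> binomials_ii \<union> binomials_iii \<union> {var Lx * var Ly})"

lemma presented_idealA: "presented (idealA :: (letter, 'k::field) falg set)"
  unfolding presented_def presented_axioms_def
proof (intro conjI allI impI)
  show "free_ideal (idealA :: (letter, 'k) falg set)"
    unfolding idealA_def by (rule free_ideal_genideal)
  have sub: "binomials_i \<union> binomials_ii \<union> binomials_iii \<union> {var Lx * var Ly}
      \<subseteq> (idealA :: (letter, 'k) falg set)"
    unfolding idealA_def by (rule genideal_subset)
  show "word [p, z] - word [u, v] \<in> (idealA :: (letter, 'k) falg set)"
    if "rule2 p z = Some (u, v)" for p z u v
    using sub that unfolding binomials_eq by blast
  show "word [Lx, Ly] \<in> (idealA :: (letter, 'k) falg set)" using sub by simp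
qed

lemma idealA_subset: "idealA \<subseteq> (nf_null nfA :: (letter, 'k::field) falg set)"
  unfolding idealA_def
proof (rule genideal_least[OF ideal_nf_null], rule subsetI)
  fix f :: "(letter, 'k) falg"
  assume "f \<in> binomials_i \<union> binomials_ii \<union> binomials_iii \<union> {var Lx * var Ly}"
  then consider p z u v where "f = word [p, z] - word [u, v]" "rule2 p z = Some (u, v)"
    | "f = word [Lx, Ly]" unfolding binomials_eq by auto
  then show "f \<in> nf_null nfA"
  proof cases
    case 1
    show ?thesis
    proof (rule nf_nullI)
      fix s t :: "letter list" and c :: 'k
      have "reduce nfA (single s c * f * single t 1)
          = nf_word (nfA (s @ [p, z] @ t)) c - nf_word (nfA (s @ [u, v] @ t)) c"
        unfolding 1 word_def by (simp add: left_diff_distrib right_diff_distrib reduce_diff del: nfA_simps)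
      then show "reduce nfA (single s c * f * single t 1) = 0"
        using nfA_rule2[OF 1(2)] by simp
    qed
  next
    case 2
    show ?thesis
    proof (rule nf_nullI)
      fix s t :: "letter list" and c :: 'k
      have "reduce nfA (single s c * f * single t 1)
          = nf_word (nfA (s @ [Lx, Ly] @ t)) c"
        unfolding 2 word_def by (simp del: nfA_simps)
      then show "reduce nfA (single s c * f * single t 1) = 0"
        by (simp only: nfA_xy nf_word_simps)
    qed
  qed
qed

lemma normal_form_A: "normal_form (idealA :: (letter, 'k::field) falg set) nfA"
proof -
  interpret presented "idealA :: (letter, 'k) falg set" by (rule presented_idealA)
  show ?thesis
  proof
    show "reduce nfA f = 0" if "f \<in> idealA" for f :: "(letter, 'k) falg"
      using that idealA_subset nf_null_reduce by blast
  qed (use cong_nfA nfA_descends in auto)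
qed

definition idealB :: "(letter, 'k::field) falg set" where
  "idealB = genideal free_alg (word ` obstructions)"

text \<open>
  In the monomial algebra a word is either normal or zero.
\<close>

definition nfB :: "letter list \<Rightarrow> letter list option" where
  "nfB w = (if normal_word w then Some w else None)"

lemma nfB_normal [simp]: "nfB w = Some w \<longleftrightarrow> normal_word w"
  by (simp add: nfB_def)

text \<open>
  A monomial ideal is spanned by the words that it contains.
\<close>

lemma genideal_word_mem:
  fixes G :: "'z list set"
  shows "genideal free_alg (word ` G) =
    {f :: ('z, 'k::field) falg. \<forall>w\<in>keys f. \<exists>g\<in>G. sublist g w}" (is "_ = ?S")
proof
  have "ideal ?S (free_alg :: ('z, 'k) falg ring)"
  proof (rule ideal_free_algI)
    fix f g :: "('z, 'k) falg" assume "f \<in> ?S"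
    then have f: "\<exists>h\<in>G. sublist h (s @ w @ t)" if "w \<in> keys f" for w s t
      using that sublist_order.order.trans[OF _ sublist_appendI] by blast
    have "\<exists>h\<in>G. sublist h v" if v: "v \<in> keys (g * f)" for v
    proof -
      obtain u w where "v = u @ w" "w \<in> keys f"
        using subsetD[OF keys_mult v] by (auto simp: plus_list_def)
      then show ?thesis using f[of w u "[]"] by simp
    qed
    then show "g * f \<in> ?S" by blast
    have "\<exists>h\<in>G. sublist h v" if v: "v \<in> keys (f * g)" for v
    proof -
      obtain w u where "v = w @ u" "w \<in> keys f"
        using subsetD[OF keys_mult v] by (auto simp: plus_list_def)
      then show ?thesis using f[of w "[]" u] by simp
    qed
    then show "f * g \<in> ?S" by blast
  next
    fix f g :: "('z, 'k) falg" assume "f \<in> ?S" "g \<in> ?S"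
    then show "f + g \<in> ?S" using keys_add[of f g] by blast
  qed simp
  then show "genideal free_alg (word ` G) \<subseteq> ?S"
    by (rule genideal_least) (auto simp: word_def)
next
  interpret free_ideal "genideal free_alg (word ` G) :: ('z, 'k) falg set"
    by (rule free_ideal_genideal)
  show "?S \<subseteq> genideal free_alg (word ` G)"
  proof
    fix f :: "('z, 'k) falg" assume f: "f \<in> ?S"
    show "f \<in> genideal free_alg (word ` G)"
    proof (rule poly_mapping_monomial_induct[of "\<lambda>f. f \<in> genideal free_alg (word ` G)"])
      fix w and c :: 'k assume "w \<in> keys f"
      then obtain g s t where g: "g \<in> G" "w = s @ g @ t" using f by (auto simp: sublist_def)
      have "(word g :: ('z, 'k) falg) \<in> genideal free_alg (word ` G)" using genideal_subset g(1) by blast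
      then have "single s c * word g * word t \<in> genideal free_alg (word ` G)"
        by (intro rmult_in lmult_in)
      then show "single w c \<in> genideal free_alg (word ` G)"
        by (simp add: g(2) word_def)
    qed (auto intro: zero_in add_in)
  qed
qed

text \<open>
  Two antichains generating the same ideal have the same multiples; an element of one has a factor in
  the other, which has a factor in the first, and the antichain property makes all three equal.
\<close>

lemma minimal_monomial_basis_eq:
  assumes "subword_antichain G"
  shows "minimal_monomial_basis (genideal free_alg (word ` G) :: ('z, 'k::field) falg set) = G"
  unfolding minimal_monomial_basis_def
proof (rule the_equality)
  fix G' assume a: "subword_antichain G' \<and>
    (genideal free_alg (word ` G) :: ('z, 'k) falg set) = genideal free_alg (word ` G')"
  have iff: "(\<exists>g\<in>G. sublist g w) \<longleftrightarrow> (\<exists>g\<in>G'. sublist g w)" for w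
  proof -
    have "(\<exists>g\<in>H. sublist g w) \<longleftrightarrow> (word w :: ('z, 'k) falg) \<in> genideal free_alg (word ` H)" for H
      unfolding genideal_word_mem by (simp add: word_def)
    then show ?thesis using a by simp
  qed
  have sub: "H \<subseteq> H'" if H: "subword_antichain H" "subword_antichain H'"
    "\<And>w. (\<exists>g\<in>H. sublist g w) \<longleftrightarrow> (\<exists>g\<in>H'. sublist g w)" for H H' :: "'z list set"
  proof
    fix g assume g: "g \<in> H"
    then obtain g' where g': "g' \<in> H'" "sublist g' g" using H(3)[of g] by blast
    then obtain g'' where g'': "g'' \<in> H" "sublist g'' g'" using H(3)[of g'] by blast
    have "g'' = g"
      using H(1) g g'' g' sublist_order.order.trans unfolding subword_antichain_def by blast
    then have "g' = g" using g' g'' by (simp add: sublist_order.order.antisym)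
    with g'(1) show "g \<in> H'" by simp
  qed
  show "G' = G" using sub[of G G'] sub[of G' G] assms a iff by blast
qed (use assms in simp)

text \<open>
  Inside \<open>x w y\<close> a shorter obstruction could only be a bracket followed by \<open>y\<close>, but a nonempty \<open>w\<close>
  ends in \<open>e\<close>.
\<close>

lemma xLy_words_normal_inside:
  "g \<in> xLy_words \<Longrightarrow> sublist u g \<Longrightarrow> u \<in> obstructions \<Longrightarrow> u = g"
proof -
  assume g: "g \<in> xLy_words" and s: "sublist u g" and u: "u \<in> obstructions"
  from g obtain w where w: "w \<in> blocks" "g = Lx # w @ [Ly]" by (auto simp: xLy_words_def)
  have wl: "set w \<subseteq> {La, Lb, Le}" by (rule blocks_letters[OF w(1)])
  from s obtain s t where st: "Lx # w @ [Ly] = s @ u @ t" by (auto simp: sublist_def w(2))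
  from u consider p z where "u = [p, z]" "rule2 p z \<noteq> None" | v where "v \<in> blocks" "u = Lx # v @ [Ly]"
    by (auto simp: obstructions_def xLy_words_def)
  then show "u = g"
  proof cases
    case 1
    have "p \<noteq> Lx" "\<not> primed p"
    proof -
      show "p \<noteq> Lx" using 1 by (cases z) auto
      have "p \<in> set (Lx # w @ [Ly])" unfolding st 1(1) by simp
      then show "\<not> primed p" using wl by auto
    qed
    then have pz: "p = La \<or> p = Lb" "z = Ly" using 1(2) by (cases p; cases z; simp)+
    have "s \<noteq> []" using st 1 \<open>p \<noteq> Lx\<close> by (cases s) auto
    then obtain s' where s': "s = Lx # s'" "w @ [Ly] = s' @ p # Ly # t" using st 1 pz by (cases s) auto
    have "t = []"
    proof (rule ccontr)
      assume "t \<noteq> []"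
      then obtain t' c where "t = t' @ [c]" by (cases t rule: rev_cases) auto
      then have "Ly \<in> set w" using s'(2) by (simp flip: append_assoc append_Cons)
      then show False using wl by auto
    qed
    then have "w = s' @ [p]" using s'(2) by (metis append_Cons append_Nil append_assoc butlast_snoc)
    moreover have "w \<noteq> [] \<Longrightarrow> last w = Le" using w(1) by (induction rule: blocks.induct) auto
    ultimately show ?thesis using pz by auto
  next
    case 2
    have "s = []"
    proof (cases s)
      case (Cons c s')
      then have "Lx \<in> set (w @ [Ly])" using st 2 by auto
      then show ?thesis using wl by auto
    qed simp
    then have "w @ Ly # [] = v @ Ly # t" using st 2 by simp
    from blocks_unique[OF w(1) 2(1) this] show ?thesis using 2 w by simp
  qed
qed

lemma antichain_obstructions: "subword_antichain obstructions"
  unfolding subword_antichain_def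
proof (intro ballI impI)
  fix u g assume u: "u \<in> obstructions" and g: "g \<in> obstructions" and s: "sublist u g"
  show "u = g"
  proof (cases "g \<in> xLy_words")
    case True
    then show ?thesis using xLy_words_normal_inside u s by blast
  next
    case False
    then have "length g = 2" using g by (auto simp: obstructions_def)
    moreover have "2 \<le> length u" using u by (auto simp: obstructions_def xLy_words_def)
    ultimately show ?thesis
      using s sublist_length_le[OF s] by (auto simp: sublist_def)
  qed
qed

lemma minimal_monomial_basis_B:
  "minimal_monomial_basis (idealB :: (letter, 'k::field) falg set) = obstructions"
  unfolding idealB_def by (rule minimal_monomial_basis_eq[OF antichain_obstructions])

lemma idealB_eq: "idealB = {f :: (letter, 'k::field) falg. \<forall>w\<in>keys f. \<not> normal_word w}"
  unfolding idealB_def genideal_word_mem normal_iff_sublist by simp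

text \<open>
  The words that are not normal form a two-sided ideal of words, so they already span the ideal that
  they generate.
\<close>

lemma LM_idealA: "LM glex (idealA :: (letter, 'k::field) falg set) = idealB"
proof -
  interpret normal_form "idealA :: (letter, 'k) falg set" nfA by (rule normal_form_A)
  have "LM glex (idealA :: (letter, 'k) falg set) = genideal free_alg (word ` {w. \<not> normal_word w})"
  proof -
    have "(v, w) \<in> glex" if "nfA w = Some v" "v \<noteq> w" for v w
      using nfA_descends that by blast
    from lm_image_eq[OF word_order_glex this] show ?thesis unfolding LM_def by simp
  qed
  also have "\<dots> = idealB"
  proof -
    have "(\<exists>g\<in>{w. \<not> normal_word w}. sublist g w) \<longleftrightarrow> \<not> normal_word w" for w
    proof
      show "\<exists>g\<in>{w. \<not> normal_word w}. sublist g w" if "\<not> normal_word w"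
        using that by (intro bexI[of _ w]) simp_all
    qed (auto simp: sublist_def dest: normal_factor)
    then show ?thesis unfolding genideal_word_mem idealB_eq by simp
  qed
  finally show ?thesis .
qed

lemma normal_form_B: "normal_form (idealB :: (letter, 'k::field) falg set) nfB"
proof -
  interpret free_ideal "idealB :: (letter, 'k) falg set"
    unfolding idealB_def by (rule free_ideal_genideal)
  show ?thesis
  proof
    show "reduce nfB f = 0" if "f \<in> idealB" for f :: "(letter, 'k) falg"
      using that unfolding reduce_def idealB_eq by (intro sum.neutral) (auto simp: nfB_def)
    show "single w 1 - nf_word (nfB w) 1 \<in> (idealB :: (letter, 'k) falg set)" for w
      by (cases "normal_word w") (auto simp: nfB_def idealB_eq)
  qed (auto simp: nfB_def split: if_splits)
qed

lemma lm_binomial: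
  assumes "rule2 p z = Some (u, v)"
  shows "lm glex (word [p, z] - word [u, v] :: (letter, 'k::field) falg) = [p, z]"
proof -
  interpret word_order glex by (rule word_order_glex)
  have r: "([u, v], [p, z]) \<in> glex" using rank_rule2[OF assms] by (intro glex_hd) auto
  then have "[u, v] \<noteq> [p, z]" using irrefl_r by (auto simp: irrefl_def)
  then show ?thesis
    using r by (intro lm_eqI) (auto simp: word_def in_keys_iff lookup_minus lookup_single when_def split: if_splits)
qed

lemma lm_binomials:
  "lm glex ` (binomials_i \<union> binomials_ii \<union> binomials_iii :: (letter, 'k::field) falg set) = rule_pairs"
  unfolding binomials_eq
proof (intro equalityI subsetI)
  fix x assume "x \<in> lm glex ` {word [p, z] - word [u, v] :: (letter, 'k) falg
      | p z u v. rule2 p z = Some (u, v)}"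
  then obtain p z u v where "rule2 p z = Some (u, v)"
    "x = lm glex (word [p, z] - word [u, v] :: (letter, 'k) falg)" by blast
  then show "x \<in> rule_pairs" by (simp add: lm_binomial rule_pairs_def)
next
  fix x assume "x \<in> rule_pairs"
  then obtain p z u v where r: "x = [p, z]" "rule2 p z = Some (u, v)"
    unfolding rule_pairs_def by auto
  then have "x = lm glex (word [p, z] - word [u, v] :: (letter, 'k) falg)"
    by (simp add: lm_binomial)
  then show "x \<in> lm glex ` {word [p, z] - word [u, v] :: (letter, 'k) falg
      | p z u v. rule2 p z = Some (u, v)}"
    using r(2) by blast
qed

section \<open>Resolutions of length three\<close>

text \<open>
  The condition on a column of a differential under which it is homogeneous of degree zero and has
  entries of positive degree.
\<close>

definition graded_column :: "'z list set \<Rightarrow> 'z list \<Rightarrow> ('z, 'k::field) fvec \<Rightarrow> bool" where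
  "graded_column W g v \<longleftrightarrow> keys v \<subseteq> W \<and>
     (\<forall>j\<in>keys v. length j < length g \<and>
        lookup v j \<in> homogeneous (length g - length j))"

lemma homogeneous_add: "f \<in> homogeneous d \<Longrightarrow> g \<in> homogeneous d \<Longrightarrow> f + g \<in> homogeneous d"
  using keys_add[of f g] by (auto simp: homogeneous_def)

lemma graded_column_add:
  assumes "graded_column W g v" "graded_column W g w"
  shows "graded_column W g (v + w)"
proof -
  have "lookup u j \<in> homogeneous (length g - length j)" if "graded_column W g u"
    for u :: "('a, 'b) fvec" and j
    using that by (cases "j \<in> keys u") (auto simp: graded_column_def in_keys_iff)
  then have "lookup (v + w) j \<in> homogeneous (length g - length j)" for j
    using assms by (simp add: lookup_add homogeneous_add)
  moreover have "j \<in> keys v \<or> j \<in> keys w"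
    if "j \<in> keys (v + w)" for j
    using that keys_add[of v w] by blast
  ultimately show ?thesis using assms unfolding graded_column_def by blast
qed

lemma graded_column_bvec:
  "j \<in> W \<Longrightarrow> length g = length j + length m \<Longrightarrow> m \<noteq> [] \<Longrightarrow> graded_column W g (bvec j m c)"
  by (auto simp: graded_column_def homogeneous_def split: if_splits)

lemma graded_column_diff_bvec:
  assumes "graded_column W g v" "j \<in> W" "length g = length j + length m" "m \<noteq> []"
  shows "graded_column W g (v - bvec j m c)"
  using graded_column_add[OF assms(1) graded_column_bvec[OF assms(2-4), of "- c"]]
  by (simp add: single_uminus)

abbreviation letter_words :: "'z list set" where "letter_words \<equiv> range (\<lambda>z. [z])"

definition augmentation_column :: "'z list \<Rightarrow> ('z, 'k::field) fvec" where
  "augmentation_column g = bvec [] g 1"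

lemma global_dimension_three:
  fixes I :: "('z::countable, 'k::field) falg set" and D1 D2 :: "'z list \<Rightarrow> ('z, 'k) fvec"
  assumes "normal_form I nf" "W3 \<noteq> {}"
    and D1: "\<And>g. g \<in> W2 \<Longrightarrow> graded_column letter_words g (D1 g)"
    and D2: "\<And>g. g \<in> W3 \<Longrightarrow> graded_column W2 g (D2 g)"
    and ex1: "\<And>v. keys v \<subseteq> letter_words \<Longrightarrow>
      free_ideal.vec_null I (dmap augmentation_column v) \<longleftrightarrow>
        (\<exists>u. keys u \<subseteq> W2 \<and> free_ideal.vec_null I (v - dmap D1 u))"
    and ex2: "\<And>v. keys v \<subseteq> W2 \<Longrightarrow>
      free_ideal.vec_null I (dmap D1 v) \<longleftrightarrow>
        (\<exists>u. keys u \<subseteq> W3 \<and> free_ideal.vec_null I (v - dmap D2 u))"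
    and ex3: "\<And>v. keys v \<subseteq> W3 \<Longrightarrow>
      free_ideal.vec_null I (dmap D2 v) \<longleftrightarrow>
        (\<exists>u. keys u \<subseteq> {} \<and> free_ideal.vec_null I (v - dmap (\<lambda>_. 0) u))"
  shows "has_global_dimension (quot_alg I) (quot_grade I) 3"
proof -
  interpret normal_form I nf by fact
  define W :: "nat \<Rightarrow> 'z list set" where
    "W = (\<lambda>i. if i = 0 then {[]} else if i = 1 then letter_words else if i = 2 then W2
              else if i = 3 then W3 else {})"
  define D :: "nat \<Rightarrow> 'z list \<Rightarrow> ('z, 'k) fvec" where
    "D = (\<lambda>i. if i = 0 then augmentation_column else if i = 1 then D1 else if i = 2 then D2
              else (\<lambda>_. 0))"
  have W: "W 0 = {[]}" "W 1 = letter_words" "W 2 = W2" "W 3 = W3" "\<And>i. i > 3 \<Longrightarrow> W i = {}"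
    by (simp_all add: W_def)
  have D: "D 0 = augmentation_column" "D 1 = D1" "D 2 = D2" "\<And>i. i > 2 \<Longrightarrow> D i = (\<lambda>_. 0)"
    by (simp_all add: D_def)
  have small: "i = 0 \<or> i = 1 \<or> i = 2 \<or> i > 2" for i :: nat by linarith
  have col: "graded_column (W i) g (D i g)" if g: "g \<in> W (Suc i)" for i g
  proof -
    from small[of i] show ?thesis
    proof (elim disjE)
      assume "i = 0"
      then show ?thesis using g W(1,2) D(1)
        by (auto simp: augmentation_column_def intro: graded_column_bvec)
    next
      assume "i = 1"
      then show ?thesis using g W(2,3) D(2) D1 by (simp add: numeral_2_eq_2)
    next
      assume "i = 2"
      then show ?thesis using g W(3,4) D(3) D2 by (simp add: numeral_3_eq_3 numeral_2_eq_2)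
    next
      assume "i > 2"
      then show ?thesis using g W(5)[of "Suc i"] by simp
    qed
  qed
  interpret word_resolution I W D
  proof
    show "W 0 = {[]}" "W 1 = range (\<lambda>z. [z])" by (rule W)+
    show "D 0 [z] = single [] (word [z])" for z
      by (simp add: D augmentation_column_def word_def)
    fix g i assume g: "g \<in> W (Suc i)"
    note c = col[OF g, unfolded graded_column_def]
    show "keys (D i g) \<subseteq> W i" using c by blast
    show "length j < length g" if "j \<in> keys (D i g)" for j using c that by blast
    show "lookup (D i g) j \<in> homogeneous (length g - length j)" for j
      using c by (cases "j \<in> keys (D i g)") (auto simp: in_keys_iff)
  next
    fix v :: "('z, 'k) fvec" and i
    assume v: "keys v \<subseteq> W (Suc i)"
    from small[of i]
    show "vec_null (dmap (D i) v) \<longleftrightarrow>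
        (\<exists>u. keys u \<subseteq> W (Suc (Suc i)) \<and> vec_null (v - dmap (D (Suc i)) u))"
    proof (elim disjE)
      assume i: "i = 0"
      show ?thesis using ex1[of v] v W(2,3) D(1,2) unfolding i by (simp add: numeral_2_eq_2)
    next
      assume i: "i = 1"
      show ?thesis using ex2[of v] v W(3,4) D(2,3) unfolding i
        by (simp add: numeral_3_eq_3 numeral_2_eq_2)
    next
      assume i: "i = 2"
      have "W (Suc (Suc 2)) = {}" "D (Suc 2) = (\<lambda>_. 0)" "W (Suc 2) = W3"
        using W(4,5) D(4) by (simp_all add: numeral_3_eq_3 numeral_2_eq_2)
      then show ?thesis using ex3[of v] v D(3) unfolding i by simp
    next
      assume i: "i > 2"
      then have "v = 0" using v W(5)[of "Suc i"] by simp
      then show ?thesis by (auto intro!: exI[of _ 0])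
    qed
  qed
  show ?thesis by (rule global_dimension) (use assms(2) W in auto)
qed

text \<open>
  The generators of the last module in the resolution over \<open>B\<close>; they turn out to be its \<open>2\<close>-chains
  (\<open>chains_1\<close>).
\<close>

definition chains3 :: "letter list set" where
  "chains3 = {[p, c, Ly] | p c. primed p \<and> (c = La \<or> c = Lb)} \<union>
             {p # Lx # w @ [Ly] | p w. primed p \<and> w \<in> blocks}"

lemma rule2_cases:
  assumes "rule2 p z \<noteq> None"
  obtains "primed p" "z = Lx" | "primed p" "z = La \<or> z = Lb" | "primed p" "z = Le \<or> z = Ly"
    | "p = La \<or> p = Lb" "z = Ly"
  using assms by (cases p; cases z; auto)

lemma normal_act: "normal_word m \<Longrightarrow> nfA (z # m) = act z m"
  by simp

lemma normal_y [simp]: "normal_word (Ly # m) \<longleftrightarrow> normal_word m"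
  and normal_e [simp]: "normal_word (Le # m) \<longleftrightarrow> normal_word m"
  by (simp_all add: normal_Cons del: nfA_simps)

lemma normal_y_power: "normal_word m \<Longrightarrow> normal_word (replicate k Ly @ m)"
  by (induction k) (simp_all del: nfA_simps)

lemma normal_brackets:
  "set s \<subseteq> {La, Lb} \<Longrightarrow> normal_word (c # m) \<Longrightarrow> c \<noteq> Ly \<Longrightarrow> normal_word (s @ c # m)"
proof (induction s)
  case (Cons b s)
  then have "hd (s @ c # m) \<noteq> Ly" by (cases s) auto
  with Cons show ?case by (auto simp: normal_Cons act_ab simp del: nfA_simps)
qed simp

lemma normal_blocks: "w \<in> blocks \<Longrightarrow> normal_word m \<Longrightarrow> normal_word (w @ Ly # m)"
proof (induction rule: blocks.induct)
  case (step u v)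
  then show ?case using normal_brackets[OF balanced_letters[OF step(1)], of Le "v @ Ly # m"]
    by (simp del: nfA_simps)
qed (simp del: nfA_simps)

lemma normal_x: "normal_word (Lx # m) \<longleftrightarrow> normal_word m \<and> \<not> blocked m"
  by (auto simp: normal_Cons act_x simp del: nfA_simps)

lemma normal_ab:
  "c = La \<or> c = Lb \<Longrightarrow> normal_word (c # m) \<longleftrightarrow> normal_word m \<and> \<not> (m \<noteq> [] \<and> hd m = Ly)"
  by (auto simp: normal_Cons act_ab simp del: nfA_simps)

section \<open>The resolution over the monomial algebra\<close>

context exactness
begin

text \<open>
  If each column has a single monomial entry, the differential maps tight basis elements to basis
  elements, and it is injective on their span as soon as it is injective on them.
\<close>

lemma monomial_injective:
  assumes D: "\<And>g. g \<in> W \<Longrightarrow> D g = bvec (h g) (s g) 1"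
    and normal: "\<And>g m. g \<in> W \<Longrightarrow> normal m \<Longrightarrow> tight g m \<Longrightarrow> normal (s g @ m)"
    and unique: "\<And>g g' m m'. g \<in> W \<Longrightarrow> g' \<in> W \<Longrightarrow> h g = h g' \<Longrightarrow> s g @ m = s g' @ m' \<Longrightarrow>
      g = g' \<and> m = m'"
    and t: "tight_vec t" "vec_null (dmap D t)"
  shows "t = 0"
proof (rule tight_injective[OF _ t, of "\<lambda>_ _. 0"])
  have entry: "entry g m j w = (if h g = j \<and> s g @ m = w then 1 else 0)"
    if "g \<in> W" "normal m" "tight g m" for g m j w
    using normal[OF that] by (auto simp: entry_def D[OF that(1)] lookup_nf_word lookup_single when_def)
  fix g m assume g: "g \<in> W" "normal m" "tight g m"
  have "entry g m (h g) (s g @ m) \<noteq> 0" by (simp add: entry[OF g])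
  moreover have "g' = g \<and> m' = m"
    if g': "g' \<in> W" "normal m'" "tight g' m'" and "entry g' m' (h g) (s g @ m) \<noteq> 0" for g' m'
    using that(4) unique[OF g(1) g'(1), of m m'] by (simp add: entry[OF g'] split: if_splits)
  ultimately show "\<exists>j w. entry g m j w \<noteq> 0 \<and> (\<forall>g' m'. g' \<in> W \<longrightarrow> normal m' \<longrightarrow> tight g' m' \<longrightarrow>
      entry g' m' j w \<noteq> 0 \<longrightarrow> g' = g \<and> m' = m \<or> (0::nat) < 0)"
    by blast
qed

end

definition DB1 :: "letter list \<Rightarrow> (letter, 'k::field) fvec" where
  "DB1 g = bvec (take 1 g) (drop 1 g) 1"

definition DB2 :: "letter list \<Rightarrow> (letter, 'k::field) fvec" where
  "DB2 g = bvec (take 2 g) (drop 2 g) 1"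

lemma obstructions_cases:
  assumes "g \<in> obstructions"
  obtains p z where "g = [p, z]" "rule2 p z \<noteq> None" | w where "g = Lx # w @ [Ly]" "w \<in> blocks"
  using assms by (auto simp: obstructions_def xLy_words_def)

lemma chains3_cases:
  assumes "g \<in> chains3"
  obtains p c where "g = [p, c, Ly]" "primed p" "c = La \<or> c = Lb"
    | p w where "g = p # Lx # w @ [Ly]" "primed p" "w \<in> blocks"
  using assms unfolding chains3_def by blast

lemma obstruction_prefix_unique:
  assumes "g \<in> obstructions" "g' \<in> obstructions" "g @ m = g' @ m'"
  shows "g = g' \<and> m = m'"
proof -
  have "prefix g (g' @ m')" "prefix g' (g' @ m')" by (simp flip: assms(3), simp)
  then have "prefix g g' \<or> prefix g' g" by (rule prefix_same_cases)
  then have "g = g'"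
    using antichain_obstructions assms(1,2) unfolding subword_antichain_def
    by (metis prefix_imp_sublist)
  with assms(3) show ?thesis by simp
qed

lemma chains3_prefix_unique:
  assumes "g \<in> chains3" "g' \<in> chains3" "g @ m = g' @ m'"
  shows "g = g' \<and> m = m'"
  using assms(1)
proof (cases rule: chains3_cases)
  case (1 p c)
  from assms(2) show ?thesis by (cases rule: chains3_cases) (use 1 assms(3) in auto)
next
  case (2 p w)
  from assms(2) show ?thesis
  proof (cases rule: chains3_cases)
    case 1
    then show ?thesis using 2 assms(3) by auto
  next
    case (2 p' w')
    then show ?thesis
      using blocks_unique[of w w' m m'] \<open>g = p # Lx # w @ [Ly]\<close> \<open>w \<in> blocks\<close> assms(3) by simp
  qed
qed

lemma obstruction_not_normal: "g \<in> obstructions \<Longrightarrow> \<not> normal_word (s @ g @ t)"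
  unfolding normal_iff_sublist by (metis sublist_appendI)

lemma chains3_tail_normal: "g \<in> chains3 \<Longrightarrow> normal_word m \<Longrightarrow> normal_word (drop 2 g @ m)"
  by (elim chains3_cases) (use normal_blocks in \<open>simp_all del: nfA_simps\<close>)

text \<open>
  The chain resolution. A basis element is tight if its tail times the word stays normal; otherwise
  the product contains an obstruction, and the element is a multiple of the image of the chain
  obtained by appending the tail of that obstruction.
\<close>

theorem global_dimension_B:
  "has_global_dimension (quot_alg (idealB :: (letter, 'k::field) falg set)) (quot_grade idealB) 3"
proof (rule global_dimension_three[OF normal_form_B, of chains3 obstructions DB1 DB2])
  show "chains3 \<noteq> {}" by (auto simp: chains3_def)
  show "graded_column letter_words g (DB1 g)" if "g \<in> obstructions" for g
    using that by (cases rule: obstructions_cases) (auto simp: DB1_def intro!: graded_column_bvec)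
  show "graded_column obstructions g (DB2 g)" if "g \<in> chains3" for g
    using that
  proof (cases rule: chains3_cases)
    case (1 p c)
    then have "[p, c] \<in> obstructions" by (auto simp: obstructions_def)
    with 1 show ?thesis by (auto simp: DB2_def intro!: graded_column_bvec)
  next
    case (2 p w)
    then have "[p, Lx] \<in> obstructions" by (auto simp: obstructions_def)
    with 2 show ?thesis by (auto simp: DB2_def intro!: graded_column_bvec)
  qed
next
  fix v :: "(letter, 'k) fvec"
  assume v: "keys v \<subseteq> letter_words"
  interpret exactness "idealB :: (letter, 'k) falg set" nfB letter_words obstructions
    augmentation_column DB1 "\<lambda>g m. normal_word (g @ m)"
    unfolding exactness_def by (rule normal_form_B)
  show "vec_null (dmap augmentation_column v) \<longleftrightarrow>
      (\<exists>u. keys u \<subseteq> obstructions \<and> vec_null (v - dmap DB1 u))"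
  proof (rule exact_if_split[OF _ _ _ v])
    fix g assume g: "g \<in> obstructions"
    then have "g = take 1 g @ drop 1 g" "length (take 1 g) = 1"
      by (auto elim!: obstructions_cases)
    then obtain z where z: "g = [z] @ drop 1 g" "take 1 g = [z]"
      by (metis length_Suc_conv length_0_conv One_nat_def)
    have "nfB g = None" using obstruction_not_normal[OF g, of "[]" "[]"] by (simp add: nfB_def)
    then show "vec_null (dmap augmentation_column (DB1 g))"
      using z by (auto simp: DB1_def augmentation_column_def intro!: vec_null_single single_None)
  next
    fix g m :: "letter list" and c :: 'k assume g: "g \<in> letter_words" and m: "nfB m = Some m"
    show "splits (bvec g m c)"
    proof (cases "normal_word (g @ m)")
      case True
      then show ?thesis using splits_tight g m by blast
    next
      case False
      obtain z where z: "g = [z]" using g by blast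
      have "act z m \<noteq> Some (z # m)" using False m by (simp add: z normal_Cons del: nfA_simps)
      then obtain h where h: "h \<in> obstructions" "prefix h (z # m)" unfolding act_tight_iff by blast
      then obtain t where t: "z # m = h @ t" by (auto simp: prefix_def)
      have "h \<noteq> []" using h(1) by (cases rule: obstructions_cases) simp_all
      then have th: "take 1 h = [z]" "drop 1 h @ t = m"
        using t by (cases h; simp)+
      have "bvec g m c - rscale (DB1 h) (single t c) = 0"
        by (simp add: DB1_def z th del: drop_0 One_nat_def)
      then show ?thesis using splits_step[OF h(1), of "bvec g m c" t c] splits_null[of 0] by simp
    qed
  next
    fix t assume t: "tight_vec t" "vec_null (dmap augmentation_column t)"
    show "t = 0"
      by (rule monomial_injective[OF _ _ _ t, of "\<lambda>_. []" "\<lambda>g. g"])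
         (auto simp: augmentation_column_def nfB_def)
  qed
next
  fix v :: "(letter, 'k) fvec"
  assume v: "keys v \<subseteq> obstructions"
  interpret exactness "idealB :: (letter, 'k) falg set" nfB obstructions chains3
    DB1 DB2 "\<lambda>g m. normal_word (drop 1 g @ m)"
    unfolding exactness_def by (rule normal_form_B)
  show "vec_null (dmap DB1 v) \<longleftrightarrow>
      (\<exists>u. keys u \<subseteq> chains3 \<and> vec_null (v - dmap DB2 u))"
  proof (rule exact_if_split[OF _ _ _ v])
    fix g assume g: "g \<in> chains3"
    then have "\<exists>h\<in>obstructions. drop 1 (take 2 g) @ drop 2 g = h"
      by (cases rule: chains3_cases) (auto simp: obstructions_def xLy_words_def)
    then have "nfB (drop 1 (take 2 g) @ drop 2 g) = None"
      using obstruction_not_normal[of _ "[]" "[]"] by (auto simp: nfB_def)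
    then show "vec_null (dmap DB1 (DB2 g))"
      by (auto simp: DB1_def DB2_def intro!: vec_null_single single_None)
  next
    fix g m :: "letter list" and c :: 'k assume g: "g \<in> obstructions" and m: "nfB m = Some m"
    show "splits (bvec g m c)"
    proof (cases "normal_word (drop 1 g @ m)")
      case True
      then show ?thesis using splits_tight g m by blast
    next
      case False
      have mm: "normal_word m" using m by simp
      have "\<exists>h\<in>chains3. \<exists>t. take 2 h = g \<and> m = drop 2 h @ t"
        using g
      proof (cases rule: obstructions_cases)
        case (1 p z)
        from 1(2) show ?thesis
        proof (cases rule: rule2_cases)
          case A: 1
          then have "blocked m" using False mm 1 by (simp add: normal_x del: nfA_simps)
          then obtain w t where "w \<in> blocks" "m = w @ Ly # t" by (auto simp: blocked_def)
          then show ?thesis using A 1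
            by (intro bexI[of _ "p # Lx # w @ [Ly]"] exI[of _ t]) (auto simp: chains3_def)
        next
          case A: 2
          then have "m \<noteq> []" "hd m = Ly" using False mm 1 by (auto simp: normal_ab simp del: nfA_simps)
          then obtain t where "m = Ly # t" by (cases m) auto
          then show ?thesis using A 1
            by (intro bexI[of _ "[p, z, Ly]"] exI[of _ t]) (auto simp: chains3_def)
        qed (use False mm 1 in \<open>auto simp del: nfA_simps\<close>)
      next
        case (2 w)
        then show ?thesis using False normal_blocks[OF 2(2) mm] by (simp del: nfA_simps)
      qed
      then obtain h t where h: "h \<in> chains3" "take 2 h = g" "m = drop 2 h @ t" by blast
      have "bvec g m c - rscale (DB2 h) (single t c) = 0"
        by (simp add: DB2_def h(2,3))
      then show ?thesis using splits_step[OF h(1), of "bvec g m c" t c] splits_null[of 0] by simp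
    qed
  next
    fix t assume t: "tight_vec t" "vec_null (dmap DB1 t)"
    show "t = 0"
    proof (rule monomial_injective[OF _ _ _ t, of "take 1" "drop 1"])
      fix g g' m m' :: "letter list"
      assume g: "g \<in> obstructions" "g' \<in> obstructions"
        and "take 1 g = take 1 g'" "drop 1 g @ m = drop 1 g' @ m'"
      then have "g @ m = g' @ m'" by (metis append_assoc append_take_drop_id)
      then show "g = g' \<and> m = m'" by (rule obstruction_prefix_unique[OF g])
    qed (simp_all add: DB1_def nfB_def)
  qed
next
  fix v :: "(letter, 'k) fvec"
  assume v: "keys v \<subseteq> chains3"
  interpret exactness "idealB :: (letter, 'k) falg set" nfB chains3 "{}"
    DB2 "\<lambda>_. 0" "\<lambda>_ _. True"
    unfolding exactness_def by (rule normal_form_B)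
  show "vec_null (dmap DB2 v) \<longleftrightarrow>
      (\<exists>u. keys u \<subseteq> {} \<and> vec_null (v - dmap (\<lambda>_. 0) u))"
  proof (rule exact_if_split[OF _ _ _ v])
    fix t assume t: "tight_vec t" "vec_null (dmap DB2 t)"
    show "t = 0"
    proof (rule monomial_injective[OF _ _ _ t, of "take 2" "drop 2"])
      fix g g' m m' :: "letter list"
      assume g: "g \<in> chains3" "g' \<in> chains3"
        and "take 2 g = take 2 g'" "drop 2 g @ m = drop 2 g' @ m'"
      then have "g @ m = g' @ m'" by (metis append_assoc append_take_drop_id)
      then show "g = g' \<and> m = m'" by (rule chains3_prefix_unique[OF g])
    next
      fix g m assume "g \<in> chains3" "nfB m = Some m"
      then have "normal_word (drop 2 g @ m)" by (simp add: chains3_tail_normal del: nfA_simps)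
      then show "nfB (drop 2 g @ m) = Some (drop 2 g @ m)" by simp
    qed (simp add: DB2_def)
  qed (auto intro: splits_tight)
qed

section \<open>The minimal resolution over the binomial algebra\<close>

text \<open>
  The words \<open>w\<close> for which \<open>a' x w y\<close> remains a generator of the minimal resolution: those with at
  most one block, for which \<open>a' w y\<close> collapses to a power of \<open>y\<close>.
\<close>

definition short_blocks :: "letter list set" where
  "short_blocks = insert [] {u @ [Le] | u. u \<in> balanced}"

definition relatorsA :: "letter list set" where
  "relatorsA = insert [Lx, Ly] rule_pairs"

definition syzygiesA :: "letter list set" where
  "syzygiesA = {[p, c, Ly] | p c. primed p \<and> (c = La \<or> c = Lb)} \<union>
               {La' # Lx # w @ [Ly] | w. w \<in> short_blocks}"

text \<open>
  The column of a relation \<open>p z = u v\<close> is \<open>e\<^sub>p z - e\<^sub>u v\<close>.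
\<close>

definition DA1 :: "letter list \<Rightarrow> (letter, 'k::field) fvec" where
  "DA1 g = bvec (take 1 g) (drop 1 g) 1 -
     (case rule2 (hd g) (hd (tl g)) of None \<Rightarrow> 0 | Some (u, v) \<Rightarrow> bvec [u] [v] 1)"

text \<open>
  The first syzygy expresses that \<open>a' x w y\<close> reduces to \<open>x y\<close> times a power of \<open>y\<close>, the second that
  \<open>p c y\<close> collapses to \<open>y\<^sup>3\<close> along both orders of rewriting.
\<close>

definition DA2 :: "letter list \<Rightarrow> (letter, 'k::field) fvec" where
  "DA2 g = (if take 2 g = [La', Lx]
     then bvec [La', Lx] (drop 2 g) 1 + bvec [Lx, Ly] (replicate (length g - 2) Ly) 1
     else bvec (take 2 g) [Ly] 1 - bvec [hd g, Ly] [Ly] 1 + bvec [unprime (hd g), Ly] [Ly] 1)"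

lemma DA1_rule: "rule2 p z = Some (u, v) \<Longrightarrow> DA1 [p, z] = bvec [p] [z] 1 - bvec [u] [v] 1"
  by (simp add: DA1_def)

lemma DA1_xy: "DA1 [Lx, Ly] = bvec [Lx] [Ly] 1"
  by (simp add: DA1_def)

lemma DA2_bracket:
  "c = La \<or> c = Lb \<Longrightarrow>
    DA2 [p, c, Ly] = bvec [p, c] [Ly] 1 - bvec [p, Ly] [Ly] 1 + bvec [unprime p, Ly] [Ly] 1"
  by (auto simp: DA2_def)

lemma DA2_x: "DA2 (La' # Lx # s) = bvec [La', Lx] s 1 + bvec [Lx, Ly] (replicate (length s) Ly) 1"
  by (simp add: DA2_def)

lemma relatorsA_cases:
  assumes "g \<in> relatorsA"
  obtains p z u v where "g = [p, z]" "rule2 p z = Some (u, v)" | "g = [Lx, Ly]"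
  using assms by (auto simp: relatorsA_def rule_pairs_def)

lemma relatorsA_rule: "rule2 p z = Some uv \<Longrightarrow> [p, z] \<in> relatorsA"
  by (auto simp: relatorsA_def rule_pairs_def)

lemma relatorsA_xy: "[Lx, Ly] \<in> relatorsA"
  by (simp add: relatorsA_def)

lemma syzygiesA_cases:
  assumes "g \<in> syzygiesA"
  obtains p c where "g = [p, c, Ly]" "primed p" "c = La \<or> c = Lb"
    | w where "g = La' # Lx # w @ [Ly]" "w \<in> short_blocks"
  using assms unfolding syzygiesA_def by blast

lemma short_blocks_blocks: "w \<in> short_blocks \<Longrightarrow> w \<in> blocks"
  using blocks.step[OF _ blocks.Nil] by (auto simp: short_blocks_def blocks.Nil)

lemma syzygiesA_chains3: "g \<in> syzygiesA \<Longrightarrow> g \<in> chains3"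
  using short_blocks_blocks by (elim syzygiesA_cases) (auto simp: chains3_def)

lemma nfA_through_brackets:
  "set s \<subseteq> {La, Lb} \<Longrightarrow> primed p \<Longrightarrow> nfA (p # s @ Le # t) = nfA (unprime p # s @ Lb # t)"
proof (induction s arbitrary: p)
  case Nil
  then show ?case using nfA_rule2[of p Le "unprime p" Lb "[]" t] rule2_primed(3)[of p]
    by (simp del: nfA_simps)
next
  case (Cons c s)
  then obtain q where q: "primed q" "unprime q = c" "rule2 p c = Some (unprime p, q)"
    by (auto simp: rule2_primed unprime_def)
  have "nfA (p # c # s @ Le # t) = nfA (unprime p # q # s @ Le # t)"
    using nfA_rule2[OF q(3), of "[]" "s @ Le # t"] by (simp del: nfA_simps)
  also have "\<dots> = Option.bind (nfA (q # s @ Le # t)) (act (unprime p))"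
    by (rule nfA_simps(2))
  also have "nfA (q # s @ Le # t) = nfA (c # s @ Lb # t)"
    using Cons.IH[of q] Cons.prems(1) q by (simp del: nfA_simps)
  finally show ?case by simp
qed

text \<open>
  The statement concerns words only; the coefficient field of the ideal used in the proof is
  arbitrary.
\<close>

lemma nfA_xLy:
  assumes "w \<in> blocks" shows "nfA (Lx # w @ Ly # m) = None"
proof -
  interpret P: presented "idealA :: (letter, rat) falg set" by (rule presented_idealA)
  interpret normal_form "idealA :: (letter, rat) falg set" nfA by (rule normal_form_A)
  have "reduce nfA (word (Lx # w @ Ly # m) :: (letter, rat) falg) = 0"
    by (rule reduce_null[OF P.xLy_in[OF assms]])
  then have *: "nf_word (nfA (Lx # w @ Ly # m)) 1 = (0 :: (letter, rat) falg)"
    by (simp add: word_def del: nfA_simps)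
  show ?thesis
  proof (cases "nfA (Lx # w @ Ly # m)")
    case (Some v)
    have "lookup (nf_word (nfA (Lx # w @ Ly # m)) (1 :: rat)) v = 0"
      unfolding * by simp
    then show ?thesis using Some by (simp add: lookup_nf_word del: nfA_simps)
  qed
qed

lemma act_La'_short:
  assumes "w \<in> short_blocks"
  shows "act La' (w @ Ly # m) = Some (replicate (length w + 2) Ly @ m)"
proof (cases "w = []")
  case False
  then obtain u where "u \<in> balanced" "w = u @ [Le]" using assms by (auto simp: short_blocks_def)
  then show ?thesis using act_block[OF _ blocks.Nil, of u La' m]
    by (simp add: replicate_append_same flip: replicate_Suc)
qed (simp add: act_prime_y numeral_2_eq_2)

definition short_blocked :: "letter list \<Rightarrow> bool" where
  "short_blocked m \<longleftrightarrow> (\<exists>w\<in>short_blocks. \<exists>t. m = w @ Ly # t)"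

lemma long_blockedE:
  assumes "blocked m" "\<not> short_blocked m"
  obtains u v t where "u \<in> balanced" "v \<in> blocks" "v \<noteq> []" "m = u @ Le # v @ Ly # t"
proof -
  from assms(1) obtain w t where w: "w \<in> blocks" "m = w @ Ly # t" by (auto simp: blocked_def)
  then have ns: "w \<notin> short_blocks" using assms(2) by (auto simp: short_blocked_def)
  from w(1) show thesis
  proof cases
    case (step u v)
    then have "v \<noteq> []" using ns by (auto simp: short_blocks_def)
    with step w that show thesis by simp
  qed (use ns in \<open>simp add: short_blocks_def\<close>)
qed

text \<open>
  A blocked multiple of the relator \<open>a' x\<close> is tight unless the blocking prefix is short: the other
  blocking prefixes have taken over the role of relators \<open>x w y\<close>.
\<close>

definition tightA :: "letter list \<Rightarrow> letter list \<Rightarrow> bool" where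
  "tightA g m \<longleftrightarrow> (g = [La', Lx] \<longrightarrow> \<not> short_blocked m) \<and>
     (drop 1 g = [La] \<or> drop 1 g = [Lb] \<longrightarrow> \<not> (m \<noteq> [] \<and> hd m = Ly))"

text \<open>
  The relators \<open>x w y\<close> that are absent from the minimal resolution are recovered here: a basis element
  \<open>e\<^sub>x w y m\<close> is, up to sign, a multiple of the column of \<open>b' x\<close> or of \<open>a' x\<close>, whose other terms vanish
  in the algebra.
\<close>

lemma exact_at_generators:
  fixes v :: "(letter, 'k::field) fvec"
  assumes v: "keys v \<subseteq> letter_words"
  shows "free_ideal.vec_null idealA (dmap augmentation_column v) \<longleftrightarrow>
    (\<exists>u. keys u \<subseteq> relatorsA \<and> free_ideal.vec_null idealA (v - dmap DA1 u))"
proof -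
  interpret exactness "idealA :: (letter, 'k) falg set" nfA letter_words relatorsA
    augmentation_column DA1 "\<lambda>g m. normal_word (g @ m)"
    unfolding exactness_def by (rule normal_form_A)
  have tight: "splits (bvec [z] m c)" if "normal_word (z # m)" for z m and c :: 'k
    using that by (intro splits_tight) (auto simp: normal_Cons simp del: nfA_simps)
  have base_x: "splits (bvec [Lx] m c)" if m: "normal_word m" for m and c :: 'k
  proof (cases "blocked m")
    case False
    then show ?thesis using m by (intro tight) (simp add: normal_x del: nfA_simps)
  next
    case True
    then obtain w t where w: "w \<in> blocks" "m = w @ Ly # t" by (auto simp: blocked_def)
    from w(1) show ?thesis
    proof (cases rule: blocks_cases_head)
      case 1
      have "bvec [Lx] m c - rscale (DA1 [Lx, Ly]) (single t c) = 0"
        by (simp add: DA1_xy w(2) 1)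
      then show ?thesis
        using splits_step[OF relatorsA_xy, of "bvec [Lx] m c" t c] splits_null[of 0] by simp
    next
      case (2 w')
      let ?s = "w' @ Ly # t"
      have "bvec [Lx] m c - rscale (DA1 [Lb', Lx]) (single ?s (- c)) = bvec [Lb'] (Lx # ?s) c"
        by (simp add: DA1_rule w(2) 2 rscale_diff single_uminus)
      moreover have "vec_null (bvec [Lb'] (Lx # ?s) c)"
        using nfA_xLy[OF 2(2)] by (intro vec_null_single single_None)
      ultimately show ?thesis
        using splits_step[of "[Lb', Lx]" "bvec [Lx] m c" ?s "- c"] splits_null relatorsA_rule[of Lb' Lx] by simp
    next
      case (3 u w')
      let ?s = "u @ Le # w' @ Ly # t"
      have "bvec [Lx] m c - rscale (DA1 [La', Lx]) (single ?s (- c))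
          = (bvec [Lx] (La # u @ Lb # w' @ Ly # t) c - bvec [Lx] (La' # ?s) c) + bvec [La'] (Lx # ?s) c"
        by (simp add: DA1_rule w(2) 3 rscale_diff single_uminus)
      moreover have "vec_null (bvec [La'] (Lx # ?s) c)"
        using nfA_xLy[OF blocks.step[OF 3(2,3)]] by (intro vec_null_single single_None) simp
      moreover have "nfA (La # u @ Lb # w' @ Ly # t) = nfA (La' # ?s)"
        using nfA_through_brackets[OF balanced_letters[OF 3(2)], of La'] by (simp add: unprime_def del: nfA_simps)
      ultimately have "vec_null (bvec [Lx] m c - rscale (DA1 [La', Lx]) (single ?s (- c)))"
        using vec_null_add[OF bvec_cong] by simp
      then show ?thesis
        using splits_step[of "[La', Lx]" "bvec [Lx] m c" ?s "- c"] splits_null relatorsA_rule[of La' Lx] by simp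
    qed
  qed
  have base_ab: "splits (bvec [z] m c)" if m: "normal_word m" and z: "z = La \<or> z = Lb"
    for z m and c :: 'k
  proof (cases "m \<noteq> [] \<and> hd m = Ly")
    case False
    then show ?thesis using m z by (intro tight) (simp add: normal_ab del: nfA_simps)
  next
    case True
    then obtain t where t: "m = Ly # t" by (cases m) auto
    have r: "rule2 z Ly = Some (Ly, Ly)" using z by auto
    have "bvec [z] m c - rscale (DA1 [z, Ly]) (single t c) = bvec [Ly] m c"
      by (simp add: DA1_rule[OF r] t rscale_diff)
    moreover have "splits (bvec [Ly] m c)" using m by (intro tight) (simp del: nfA_simps)
    ultimately show ?thesis
      using splits_step[OF relatorsA_rule[OF r], of "bvec [z] m c" t c] by simp
  qed
  have base: "splits (bvec [z] w c)" if "\<not> primed z" for z w and c :: 'k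
  proof (rule splits_bvec)
    fix m assume m: "nfA m = Some m"
    show "splits (bvec [z] m c)"
      using that base_x[OF m] base_ab[OF m] tight[of z m c] m
      by (cases z) (simp_all del: nfA_simps)
  qed
  show ?thesis
  proof (rule exact_if_split[OF _ _ _ v])
    fix g assume "g \<in> relatorsA"
    then show "vec_null (dmap augmentation_column (DA1 g))"
    proof (cases rule: relatorsA_cases)
      case (1 p z u v)
      have "nfA [p, z] = nfA [u, v]" using nfA_rule2[OF 1(2), of "[]" "[]"] by (simp del: nfA_simps)
      from bvec_cong[OF this] show ?thesis
        by (simp add: 1 DA1_rule[OF 1(2)] dmap_diff augmentation_column_def)
    next
      case 2
      have "nfA [Lx, Ly] = None" using nfA_xy[of "[]" "[]"] by (simp del: nfA_simps)
      then show ?thesis unfolding 2 DA1_xy augmentation_column_def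
        by (simp del: nfA_simps) (intro vec_null_single single_None)
    qed
  next
    fix g m :: "letter list" and c :: 'k assume "g \<in> letter_words" and m: "nfA m = Some m"
    then obtain z where z: "g = [z]" by blast
    show "splits (bvec g m c)"
    proof (cases "primed z")
      case False
      then show ?thesis using base z by simp
    next
      case True
      show ?thesis
      proof (cases "normal_word (z # m)")
        case False
        then obtain d t where mt: "m = d # t" using True by (cases m) (auto simp: act_def)
        have "rule2 z d \<noteq> None"
        proof
          assume "rule2 z d = None"
          then have "act z m = Some (z # m)" using act_Cons_rule[OF True, of d t] by (simp add: mt)
          with m False show False by (simp add: normal_Cons del: nfA_simps)
        qed
        then obtain u v where r: "rule2 z d = Some (u, v)" by auto
        have "bvec g m c - rscale (DA1 [z, d]) (single t c) = bvec [u] (v # t) c"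
          by (simp add: DA1_rule[OF r] z mt rscale_diff)
        then show ?thesis
          using splits_step[OF relatorsA_rule[OF r], of "bvec g m c" t c] base[OF rule2_unprimed[OF r]]
          by simp
      qed (use tight z in blast)
    qed
  next
    fix t assume t: "tight_vec t" "vec_null (dmap augmentation_column t)"
    show "t = 0"
      by (rule monomial_injective[OF _ _ _ t, of "\<lambda>_. []" "\<lambda>g. g"])
         (auto simp: augmentation_column_def simp del: nfA_simps)
  qed
qed

text \<open>
  The row that a tight basis element owns is the one of its leading term if that term stays nonzero.
  Otherwise the element is a multiple of \<open>a' x\<close> or \<open>b' x\<close> with vanishing leading term, or its relator
  starts with an unprimed letter, and the row of an unprimed letter is used. The rank makes
  the elements of the first kind invisible there. Among the second kind, the normal words in the row
  of \<open>x\<close> start with \<open>y\<close>, \<open>e\<close> and \<open>a\<close> for the relators \<open>x y\<close>, \<open>b' x\<close> and \<open>a' x\<close>, and in the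
  last case unique factorisation of balanced words recovers the element.
\<close>

lemma exact_at_relators:
  fixes v :: "(letter, 'k::field) fvec"
  assumes v: "keys v \<subseteq> relatorsA"
  shows "free_ideal.vec_null idealA (dmap DA1 v) \<longleftrightarrow>
    (\<exists>u. keys u \<subseteq> syzygiesA \<and> free_ideal.vec_null idealA (v - dmap DA2 u))"
proof -
  interpret exactness "idealA :: (letter, 'k) falg set" nfA relatorsA syzygiesA DA1 DA2 tightA
    unfolding exactness_def by (rule normal_form_A)
  show ?thesis
  proof (rule exact_if_split[OF _ _ _ v])
    fix g assume "g \<in> syzygiesA"
    then show "vec_null (dmap DA1 (DA2 g))"
    proof (cases rule: syzygiesA_cases)
      case (1 p c)
      obtain q where q: "primed q" "rule2 p c = Some (unprime p, q)"
        using 1(2,3) by (auto simp: unprime_def)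
      have u: "rule2 (unprime p) Ly = Some (Ly, Ly)" by (simp add: unprime_def)
      have eq: "dmap DA1 (DA2 g) = (bvec [p] [c, Ly] 1 - bvec [p] [Ly, Ly] 1)
          - (bvec [unprime p] [q, Ly] 1 - bvec [unprime p] [Ly, Ly] 1)"
        using 1 q(2) u
        by (simp add: DA2_bracket dmap_add dmap_diff DA1_rule rule2_primed(4) rscale_diff)
      have "nfA [c, Ly] = nfA [Ly, Ly]" "nfA [q, Ly] = nfA [Ly, Ly]"
        using nfA_rule2[of c Ly Ly Ly "[]" "[]"] nfA_rule2[of q Ly Ly Ly "[]" "[]"] 1(3) q(1)
        by (auto simp: rule2_primed(4) simp del: nfA_simps)
      then show ?thesis unfolding eq by (intro vec_null_diff bvec_cong)
    next
      case (2 w)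
      let ?s = "w @ [Ly]"
      have eq: "dmap DA1 (DA2 g) = bvec [La'] (Lx # ?s) 1
          - (bvec [Lx] (La' # ?s) 1 - bvec [Lx] (Ly # replicate (length ?s) Ly) 1)"
        unfolding 2(1) DA2_x by (simp add: dmap_add DA1_rule DA1_xy rscale_diff)
      have "vec_null (bvec [La'] (Lx # ?s) 1)"
        using nfA_xLy[OF short_blocks_blocks[OF 2(2)], of "[]"] by (intro vec_null_single single_None)
      moreover have "nfA (La' # ?s) = nfA (Ly # replicate (length ?s) Ly)"
      proof -
        have n: "normal_word ?s" using normal_blocks[OF short_blocks_blocks[OF 2(2)], of "[]"] by simp
        have y: "normal_word (Ly # Ly # replicate (length w) Ly)"
          using normal_y_power[of "[]" "length w"] by simp
        show ?thesis
          using act_La'_short[OF 2(2), of "[]"] normal_act[OF n, of La'] y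
          by (simp add: numeral_2_eq_2 del: nfA_simps normal_y)
      qed
      ultimately show ?thesis unfolding eq by (intro vec_null_diff bvec_cong)
    qed
  next
    fix g m and c :: 'k assume g: "g \<in> relatorsA" and m: "nfA m = Some m"
    show "splits (bvec g m c)"
    proof (cases "tightA g m")
      case True
      then show ?thesis using splits_tight g m by blast
    next
      case False
      then consider "g = [La', Lx]" "short_blocked m"
        | "drop 1 g = [La] \<or> drop 1 g = [Lb]" "m \<noteq> []" "hd m = Ly" by (auto simp: tightA_def)
      then show ?thesis
      proof cases
        case 1
        then obtain w t where w: "w \<in> short_blocks" "m = w @ Ly # t" by (auto simp: short_blocked_def)
        let ?h = "La' # Lx # w @ [Ly]" and ?y = "replicate (length (w @ [Ly])) Ly @ t"
        have h: "?h \<in> syzygiesA" using w(1) by (auto simp: syzygiesA_def)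
        have "bvec g m c - rscale (DA2 ?h) (single t c) = bvec [Lx, Ly] ?y (- c)"
          unfolding DA2_x by (simp add: 1(1) w(2) rscale_add single_uminus)
        moreover have "normal_word t"
          using m normal_factor[of "w @ [Ly]" t "[]"] by (simp add: w(2) del: nfA_simps)
        then have "splits (bvec [Lx, Ly] ?y (- c))"
          by (intro splits_tight relatorsA_xy normal_y_power) (simp_all add: tightA_def)
        ultimately show ?thesis using splits_step[OF h, of "bvec g m c" t c] by simp
      next
        case 2
        obtain t where t: "m = Ly # t" using 2(2,3) by (cases m) auto
        obtain p d where pd: "g = [p, d]" "d = La \<or> d = Lb" "rule2 p d \<noteq> None"
          using g 2(1) by (auto elim!: relatorsA_cases)
        then have p: "primed p" by (elim rule2_cases) auto
        have h: "[p, d, Ly] \<in> syzygiesA" using p pd by (auto simp: syzygiesA_def)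
        have "bvec g m c - rscale (DA2 [p, d, Ly]) (single t c)
            = bvec [p, Ly] m c + bvec [unprime p, Ly] m (- c)"
          unfolding DA2_bracket[OF pd(2)] pd(1) t by (simp add: rscale_add rscale_diff single_uminus)
        moreover have "splits (bvec [p, Ly] m c)" "splits (bvec [unprime p, Ly] m (- c))"
          using p m by (intro splits_tight relatorsA_rule[of _ _ "(Ly, Ly)"];
              auto simp: tightA_def rule2_primed(4) unprime_def simp del: nfA_simps)+
        ultimately show ?thesis using splits_step[OF h, of "bvec g m c" t c] splits_add by simp
      qed
    qed
  next
    fix t assume t: "tight_vec t" "vec_null (dmap DA1 t)"
    \<comment> \<open>Rank zero means that the leading term of the basis element does not vanish.\<close>
    define rank where "rank g m = (if primed (hd g) \<and> normal_word (drop 1 g @ m) then 0 else (1::nat))"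
      for g m :: "letter list"
    have entry_rule: "entry [p, z] m j w =
        (if j = [p] \<and> nfA (z # m) = Some w then 1 else 0) - (if j = [u] \<and> nfA (v # m) = Some w then 1 else 0)"
      if "rule2 p z = Some (u, v)" for p z u v m j w
      by (auto simp: entry_def DA1_rule[OF that] lookup_minus lookup_single when_def left_diff_distrib
          reduce_diff lookup_nf_word simp del: nfA_simps)
    have entry_xy: "entry [Lx, Ly] m j w = (if j = [Lx] \<and> nfA (Ly # m) = Some w then 1 else 0)" for m j w
      by (auto simp: entry_def DA1_xy lookup_single when_def lookup_nf_word simp del: nfA_simps)
    have first: "w = z # m"
      if "rule2 p z \<noteq> None" "normal_word m" "tightA [p, z] m" "nfA (z # m) = Some w" for p z m w
      using that(1)
    proof (cases rule: rule2_cases)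
      case 1
      then show ?thesis using that normal_act[OF that(2), of Lx] by (simp add: act_x split: if_splits)
    next
      case 2
      then have "normal_word (z # m)" using that(2,3) by (auto simp: normal_ab tightA_def simp del: nfA_simps)
      then show ?thesis using that(4) by simp
    next
      case 3
      then have "normal_word (z # m)" using that(2) by (auto simp del: nfA_simps)
      then show ?thesis using that(4) by simp
    next
      case 4
      then have "normal_word (z # m)" using that(2) by (auto simp del: nfA_simps)
      then show ?thesis using that(4) by simp
    qed
    have second: "g = [k, Ly] \<and> w = Ly # m \<or> g = [Lb', Lx] \<and> k = Lx \<and> w = Le # m \<or>
        g = [La', Lx] \<and> k = Lx \<and> (\<exists>u v t. u \<in> balanced \<and> v \<in> blocks \<and> v \<noteq> [] \<and>
          m = u @ Le # v @ Ly # t \<and> w = La # u @ Lb # v @ Ly # t)"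
      if g: "g \<in> relatorsA" and m: "normal_word m" "tightA g m" and r: "rank g m = 1"
        and e: "entry g m [k] w \<noteq> 0" and k: "\<not> primed k" "k \<noteq> Ly" for g m k w
      using g
    proof (cases rule: relatorsA_cases)
      case (1 p z u v)
      then have "rule2 p z \<noteq> None" by simp
      then show ?thesis
      proof (cases rule: rule2_cases)
        case A: 1
        then have b: "blocked m" using r m(1) by (simp add: rank_def 1(1) normal_x del: nfA_simps split: if_splits)
        from A have p: "p = La' \<or> p = Lb'" by simp
        have kp: "k \<noteq> p" using k(1) A(1) by blast
        from p show ?thesis
        proof
          assume pa: "p = La'"
          then have uv: "u = Lx" "v = La'" using 1(2) A by auto
          have "k = Lx" "nfA (La' # m) = Some w"
            using e kp by (auto simp: 1(1) entry_rule[OF 1(2)] uv simp del: nfA_simps split: if_splits)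
          moreover have "\<not> short_blocked m" using m(2) pa A by (simp add: tightA_def 1(1))
          with b obtain u' v' t where d: "u' \<in> balanced" "v' \<in> blocks" "v' \<noteq> []" "m = u' @ Le # v' @ Ly # t"
            by (rule long_blockedE)
          moreover have "nfA (La' # m) = Some (La # u' @ Lb # v' @ Ly # t)"
            using normal_act[OF m(1), of La'] act_block[OF d(1,2), of La' t] d(3,4) by (simp add: unprime_def)
          ultimately show ?thesis using pa A 1(1) by (simp del: nfA_simps) blast
        next
          assume pb: "p = Lb'"
          then have uv: "u = Lx" "v = Le" using 1(2) A by auto
          have "k = Lx" "nfA (Le # m) = Some w"
            using e kp by (auto simp: 1(1) entry_rule[OF 1(2)] uv simp del: nfA_simps split: if_splits)
          then show ?thesis using pb A 1(1) m(1) by simp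
        qed
      next
        case A: 2
        then have "normal_word (z # m)" using m by (auto simp: 1(1) normal_ab tightA_def simp del: nfA_simps)
        then show ?thesis using r A by (simp add: rank_def 1(1) del: nfA_simps)
      next
        case A: 3
        then have "normal_word (z # m)" using m by (auto simp del: nfA_simps)
        then show ?thesis using r A by (simp add: rank_def 1(1) del: nfA_simps)
      next
        case A: 4
        then have uv: "u = Ly" "v = Ly" using 1(2) by auto
        have "k = p" "nfA (Ly # m) = Some w"
          using e[unfolded 1(1) entry_rule[OF 1(2)] uv] k(2) A(2) by (auto simp del: nfA_simps split: if_splits)
        then show ?thesis using A 1(1) m(1) by simp
      qed
    next
      case 2
      then have "k = Lx" "nfA (Ly # m) = Some w"
        using e by (auto simp: entry_xy simp del: nfA_simps split: if_splits)
      then show ?thesis using 2 m(1) by simp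
    qed
    show "t = 0"
    proof (rule tight_injective[OF _ t, of rank])
      fix g m assume g: "g \<in> relatorsA" and m: "nfA m = Some m" "tightA g m"
      show "\<exists>j w. entry g m j w \<noteq> 0 \<and> (\<forall>g' m'. g' \<in> relatorsA \<longrightarrow> nfA m' = Some m' \<longrightarrow> tightA g' m' \<longrightarrow>
          entry g' m' j w \<noteq> 0 \<longrightarrow> g' = g \<and> m' = m \<or> rank g' m' < rank g m)"
      proof (cases "primed (hd g) \<and> normal_word (drop 1 g @ m)")
        case True
        then obtain p z u v where r: "g = [p, z]" "rule2 p z = Some (u, v)"
          using g by (auto elim!: relatorsA_cases)
        have p: "primed p" and zm: "normal_word (z # m)" using True r(1) by (simp_all del: nfA_simps)
        have "p \<noteq> u" using p rule2_unprimed[OF r(2)] by blast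
        then have own: "entry g m [p] (z # m) \<noteq> 0"
          using zm by (simp add: r(1) entry_rule[OF r(2)] del: nfA_simps)
        have others: "g' = g \<and> m' = m"
          if g': "g' \<in> relatorsA" "nfA m' = Some m'" "tightA g' m'" and e: "entry g' m' [p] (z # m) \<noteq> 0" for g' m'
          using g'(1)
        proof (cases rule: relatorsA_cases)
          case (1 p' z' u' v')
          have "p \<noteq> u'" using p rule2_unprimed[OF 1(2)] by blast
          then have "p' = p" "nfA (z' # m') = Some (z # m)"
            using e by (auto simp: 1(1) entry_rule[OF 1(2)] simp del: nfA_simps split: if_splits)
          moreover have "z # m = z' # m'"
            using first[of p' z' m' "z # m"] g'(2,3) 1 \<open>nfA (z' # m') = Some (z # m)\<close> by (simp del: nfA_simps)
          ultimately show ?thesis using 1(1) r(1) by simp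
        next
          case 2
          then show ?thesis using e p by (auto simp: entry_xy split: if_splits)
        qed
        show ?thesis by (rule exI[of _ "[p]", OF exI[of _ "z # m"]]) (use own others in blast)
      next
        case False
        then have rank1: "rank g m = 1" by (simp only: rank_def if_False)
        have "\<exists>k w. \<not> primed k \<and> k \<noteq> Ly \<and> entry g m [k] w \<noteq> 0"
          using g
        proof (cases rule: relatorsA_cases)
          case (1 p z u v)
          then have "rule2 p z \<noteq> None" by simp
          then show ?thesis
          proof (cases rule: rule2_cases)
            case A: 1
            then have b: "blocked m" using False m(1) by (simp add: 1(1) normal_x del: nfA_simps)
            from A have "p = La' \<or> p = Lb'" by simp
            then show ?thesis
            proof
              assume pa: "p = La'"
              then have uv: "u = Lx" "v = La'" using 1(2) A by auto
              obtain r where "act La' m = Some r" using blocked_act_La'[OF b] by blast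
              then have "nfA (La' # m) = Some r" using m(1) by simp
              then have "entry g m [Lx] r \<noteq> 0"
                using A(1) unfolding 1(1) entry_rule[OF 1(2)] uv by (auto simp del: nfA_simps)
              then show ?thesis by (intro exI[of _ Lx] exI[of _ r]) simp
            next
              assume pb: "p = Lb'"
              then have uv: "u = Lx" "v = Le" using 1(2) A by auto
              have "nfA (Le # m) = Some (Le # m)" using m(1) by simp
              then have "entry g m [Lx] (Le # m) \<noteq> 0"
                using A(1) unfolding 1(1) entry_rule[OF 1(2)] uv by (auto simp del: nfA_simps)
              then show ?thesis by (intro exI[of _ Lx] exI[of _ "Le # m"]) simp
            qed
          next
            case A: 2
            then have "normal_word (z # m)" using m by (auto simp: 1(1) normal_ab tightA_def simp del: nfA_simps)
            then show ?thesis using False A by (simp add: 1(1) del: nfA_simps)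
          next
            case A: 3
            then have "normal_word (z # m)" using m by (auto simp del: nfA_simps)
            then show ?thesis using False A by (simp add: 1(1) del: nfA_simps)
          next
            case A: 4
            then have uv: "u = Ly" "v = Ly" using 1(2) by auto
            have "nfA (z # m) = Some (z # m)" using m(1) A(2) by simp
            moreover have "\<not> primed p" "p \<noteq> Ly" using A(1) by auto
            ultimately show ?thesis unfolding 1(1)
              by (intro exI[of _ p] exI[of _ "z # m"]) (simp add: entry_rule[OF 1(2)] uv del: nfA_simps)
          qed
        next
          case 2
          have "nfA (Ly # m) = Some (Ly # m)" using m(1) by simp
          then show ?thesis
            by (intro exI[of _ Lx] exI[of _ "Ly # m"]) (simp add: 2 entry_xy del: nfA_simps)
        qed
        then obtain k w where k: "\<not> primed k" "k \<noteq> Ly" and own: "entry g m [k] w \<noteq> 0" by blast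
        note here = second[OF g m rank1 own k]
        have others: "g' = g \<and> m' = m"
          if g': "g' \<in> relatorsA" "nfA m' = Some m'" "tightA g' m'" and e: "entry g' m' [k] w \<noteq> 0"
            and r': "rank g' m' = 1" for g' m'
        proof -
          have long: "u = u' \<and> v @ Ly # t = v' @ Ly # t'"
            if "u \<in> balanced" "u' \<in> balanced" "u @ Lb # v @ Ly # t = u' @ Lb # v' @ Ly # t'"
            for u u' v v' t t'
            using balanced_unique[OF that] by simp
          from here second[OF g' r' e k] show ?thesis
            by (elim disjE conjE exE) (auto dest: long)
        qed
        have "rank g' m' = 1 \<or> rank g' m' < rank g m" for g' m'
          unfolding rank1 by (simp add: rank_def[of g' m'] del: nfA_simps)
        then show ?thesis
          by (intro exI[of _ "[k]", OF exI[of _ w]]) (use own others in blast)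
      qed
    qed
  qed
qed

text \<open>
  A syzygy is determined by its first relator, which occurs in no other kind of syzygy, and by the
  remaining word.
\<close>

lemma exact_at_syzygies:
  fixes v :: "(letter, 'k::field) fvec"
  assumes v: "keys v \<subseteq> syzygiesA"
  shows "free_ideal.vec_null idealA (dmap DA2 v) \<longleftrightarrow>
    (\<exists>u. keys u \<subseteq> {} \<and> free_ideal.vec_null idealA (v - dmap (\<lambda>_. 0) u))"
proof -
  interpret exactness "idealA :: (letter, 'k) falg set" nfA syzygiesA "{}" DA2 "\<lambda>_. 0" "\<lambda>_ _. True"
    unfolding exactness_def by (rule normal_form_A)
  show ?thesis
  proof (rule exact_if_split[OF _ _ _ v])
    fix t assume t: "tight_vec t" "vec_null (dmap DA2 t)"
    have col: "lookup (DA2 g') (take 2 g) =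
        (if take 2 g' = take 2 g then single (drop 2 g') (1 :: 'k) else 0)"
      if "g \<in> syzygiesA" "g' \<in> syzygiesA" for g g'
      using that
      by (elim syzygiesA_cases)
         (auto simp: DA2_bracket DA2_x lookup_add lookup_minus lookup_single when_def)
    have entry: "entry g' m' (take 2 g) w = (if take 2 g' = take 2 g \<and> drop 2 g' @ m' = w then 1 else 0)"
      if "g \<in> syzygiesA" "g' \<in> syzygiesA" "normal_word m'" for g g' m' w
      using chains3_tail_normal[OF syzygiesA_chains3[OF that(2)] that(3)]
      by (auto simp: entry_def col[OF that(1,2)] lookup_nf_word lookup_single when_def simp del: nfA_simps)
    show "t = 0"
    proof (rule tight_injective[OF _ t, of "\<lambda>_ _. 0"])
      fix g m assume g: "g \<in> syzygiesA" "nfA m = Some m"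
      have "entry g m (take 2 g) (drop 2 g @ m) \<noteq> 0" using entry[OF g(1) g] by simp
      moreover have "g' = g \<and> m' = m"
        if g': "g' \<in> syzygiesA" "nfA m' = Some m'" and "entry g' m' (take 2 g) (drop 2 g @ m) \<noteq> 0" for g' m'
      proof -
        have "take 2 g' = take 2 g" "drop 2 g' @ m' = drop 2 g @ m"
          using that(3) entry[OF g(1) g'] by (auto split: if_splits)
        then have "g' @ m' = g @ m" by (metis append_assoc append_take_drop_id)
        then show ?thesis using chains3_prefix_unique syzygiesA_chains3 g(1) g'(1) by blast
      qed
      ultimately show "\<exists>j w. entry g m j w \<noteq> 0 \<and> (\<forall>g' m'. g' \<in> syzygiesA \<longrightarrow> nfA m' = Some m' \<longrightarrow> True \<longrightarrow>
          entry g' m' j w \<noteq> 0 \<longrightarrow> g' = g \<and> m' = m \<or> (0::nat) < 0)"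
        by blast
    qed
  qed (auto intro: splits_tight)
qed

theorem global_dimension_A:
  "has_global_dimension (quot_alg (idealA :: (letter, 'k::field) falg set)) (quot_grade idealA) 3"
proof (rule global_dimension_three[OF normal_form_A, of syzygiesA relatorsA DA1 DA2])
  show "syzygiesA \<noteq> {}" by (auto simp: syzygiesA_def)
  show "graded_column letter_words g (DA1 g)" if "g \<in> relatorsA" for g
    using that
    by (cases rule: relatorsA_cases)
       (auto simp: DA1_rule DA1_xy intro!: graded_column_bvec graded_column_diff_bvec)
  show "graded_column relatorsA g (DA2 g)" if "g \<in> syzygiesA" for g
    using that
  proof (cases rule: syzygiesA_cases)
    case (1 p c)
    have "[p, c] \<in> relatorsA" "[p, Ly] \<in> relatorsA" "[unprime p, Ly] \<in> relatorsA"
      using 1(2,3) by (auto simp: relatorsA_def rule_pairs_def unprime_def)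
    then show ?thesis unfolding 1(1) DA2_bracket[OF 1(3)]
      by (intro graded_column_add graded_column_diff_bvec graded_column_bvec) simp_all
  next
    case (2 w)
    have "[La', Lx] \<in> relatorsA" by (auto simp: relatorsA_def rule_pairs_def)
    then show ?thesis unfolding 2(1) DA2_x
      by (intro graded_column_add graded_column_bvec relatorsA_xy) simp_all
  qed
qed (rule exact_at_generators exact_at_relators exact_at_syzygies, assumption)+

section \<open>Context-free grammars\<close>

lemma concI: "u \<in> A \<Longrightarrow> v \<in> B \<Longrightarrow> u @ v \<in> conc A B"
  unfolding conc_def by blast

lemma conc_assoc: "conc (conc A B) C = conc A (conc B C)"
  unfolding conc_def by (auto; metis append_assoc)

lemma conc_mono: "A \<subseteq> A' \<Longrightarrow> B \<subseteq> B' \<Longrightarrow> conc A B \<subseteq> conc A' B'"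
  unfolding conc_def by blast

lemma conc_Nil [simp]: "conc {[]} A = A" "conc A {[]} = A"
  by (auto simp: conc_def)

text \<open>
  The language of a sentential form, when the variables are interpreted by the languages \<open>V\<close>.
\<close>

fun sem :: "(nat \<Rightarrow> 'z list set) \<Rightarrow> (nat + 'z) list \<Rightarrow> 'z list set" where
  "sem V [] = {[]}"
| "sem V (Inl T # \<phi>) = conc (V T) (sem V \<phi>)"
| "sem V (Inr c # \<phi>) = conc {[c]} (sem V \<phi>)"

lemma sem_append: "sem V (\<phi> @ \<psi>) = conc (sem V \<phi>) (sem V \<psi>)"
  by (induction V \<phi> rule: sem.induct) (simp_all add: conc_assoc)

lemma sem_terminals [simp]: "sem V (map Inr w) = {w}"
  by (induction w) (simp_all add: conc_def)

text \<open>A family of languages closed under the productions contains everything derivable.\<close>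

lemma derivation_sem:
  assumes model: "\<And>T \<beta>. (T, \<beta>) \<in> P \<Longrightarrow> sem V \<beta> \<subseteq> V T" and "(step P)\<^sup>*\<^sup>* \<phi> \<psi>"
  shows "sem V \<psi> \<subseteq> sem V \<phi>"
  using assms(2)
proof (induction rule: rtranclp_induct)
  case (step \<chi> \<psi>)
  then obtain \<alpha> T \<beta> \<gamma> where s: "(T, \<beta>) \<in> P" "\<chi> = \<alpha> @ Inl T # \<gamma>" "\<psi> = \<alpha> @ \<beta> @ \<gamma>"
    by (auto simp: step_def)
  have "sem V \<psi> \<subseteq> sem V \<chi>"
    unfolding s sem_append sem.simps by (intro conc_mono order_refl model s)
  with step.IH show ?case by blast
qed simp

lemma cfg_lang_subset:
  assumes "\<And>T \<beta>. (T, \<beta>) \<in> P \<Longrightarrow> sem V \<beta> \<subseteq> V T"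
  shows "cfg_lang P S \<subseteq> V S"
proof
  fix w assume "w \<in> cfg_lang P S"
  then have "(step P)\<^sup>*\<^sup>* [Inl S] (map Inr w)" by (simp add: cfg_lang_def)
  from derivation_sem[OF assms this] show "w \<in> V S" by simp
qed

lemma leftmost_imp_step: "leftmost_step P \<phi> \<psi> \<Longrightarrow> step P \<phi> \<psi>"
  unfolding leftmost_step_def step_def by blast

lemma leftmost_imp_steps: "(leftmost_step P)\<^sup>*\<^sup>* \<phi> \<psi> \<Longrightarrow> (step P)\<^sup>*\<^sup>* \<phi> \<psi>"
  by (rule rtranclp_mono[THEN predicate2D]) (auto intro: leftmost_imp_step)

text \<open>
  Quantifying over the terminals \<open>u\<close> to the left and the rest \<open>\<gamma>\<close> to the right makes leftmost
  derivations composable.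
\<close>

definition derives :: "'z productions \<Rightarrow> (nat + 'z) list \<Rightarrow> 'z list \<Rightarrow> bool" where
  "derives P \<beta> w \<longleftrightarrow> (\<forall>u \<gamma>. (leftmost_step P)\<^sup>*\<^sup>* (map Inr u @ \<beta> @ \<gamma>) (map Inr (u @ w) @ \<gamma>))"

lemma derives_terminals: "derives P (map Inr w) w"
  by (simp add: derives_def)

lemma derives_append: "derives P \<beta> v \<Longrightarrow> derives P \<gamma> w \<Longrightarrow> derives P (\<beta> @ \<gamma>) (v @ w)"
  unfolding derives_def by (metis append_assoc rtranclp_trans)

lemma derives_Inr: "derives P \<beta> w \<Longrightarrow> derives P (Inr c # \<beta>) (c # w)"
  using derives_append[OF derives_terminals[of P "[c]"]] by simp

lemma derives_Inl: "derives P [Inl T] v \<Longrightarrow> derives P \<beta> w \<Longrightarrow> derives P (Inl T # \<beta>) (v @ w)"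
  using derives_append[of P "[Inl T]"] by simp

lemma derives_production: "(T, \<beta>) \<in> P \<Longrightarrow> derives P \<beta> w \<Longrightarrow> derives P [Inl T] w"
  unfolding derives_def leftmost_step_def
  by (intro allI, rule converse_rtranclp_into_rtranclp) auto

lemma derives_leftmost: "derives P [Inl S] w \<Longrightarrow> (leftmost_step P)\<^sup>*\<^sup>* [Inl S] (map Inr w)"
  unfolding derives_def by (metis append_Nil append_Nil2 list.simps(8))

lemma derives_cfg_lang: "derives P [Inl S] w \<Longrightarrow> w \<in> cfg_lang P S"
  using derives_leftmost leftmost_imp_steps by (fastforce simp: cfg_lang_def)

lemma dyck_eq: "dyck = balanced"
proof
  let ?P = "{(0, []), (0, [Inr La, Inl 0, Inr Lb, Inl 0])} :: letter productions"
  have "sem (\<lambda>_. balanced) \<beta> \<subseteq> balanced" if "(T, \<beta>) \<in> ?P" for T \<beta>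
    using that by (auto simp: conc_def intro: balanced.intros)
  then show "dyck \<subseteq> balanced"
    unfolding dyck_def by (rule cfg_lang_subset)
  have "derives ?P [Inl 0] w" if "w \<in> balanced" for w
    using that
  proof induction
    case Nil
    show ?case using derives_terminals[of ?P "[]"] by (intro derives_production[of 0 "[]"]) simp_all
  next
    case (step u v)
    have "derives ?P [Inr La, Inl 0, Inr Lb, Inl 0] (La # u @ Lb # v)"
      by (intro derives_Inr derives_Inl step.IH)
    then show ?case by (rule derives_production[rotated]) simp
  qed
  then show "balanced \<subseteq> dyck"
    unfolding dyck_def using derives_cfg_lang by blast
qed

lemma lang_star_eq: "lang_star (conc dyck {[Le]}) = blocks"
proof
  have M: "conc dyck {[Le]} = {u @ [Le] | u. u \<in> balanced}"
    by (auto simp: conc_def dyck_eq)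
  have "w \<in> blocks" if "w \<in> (conc (conc dyck {[Le]}) ^^ d) {[]}" for d w
    using that
  proof (induction d arbitrary: w)
    case (Suc d)
    then have "w \<in> conc (conc dyck {[Le]}) ((conc (conc dyck {[Le]}) ^^ d) {[]})" by simp
    then obtain u v where "u \<in> balanced" "v \<in> (conc (conc dyck {[Le]}) ^^ d) {[]}" "w = u @ Le # v"
      unfolding M conc_def[of "{u @ [Le] | u. u \<in> balanced}"] by auto
    then show ?case using Suc.IH blocks.step by blast
  qed (auto intro: blocks.intros)
  then show "lang_star (conc dyck {[Le]}) \<subseteq> blocks"
    by (auto simp: lang_star_def)
  have "\<exists>d. w \<in> (conc (conc dyck {[Le]}) ^^ d) {[]}" if "w \<in> blocks" for w
    using that
  proof induction
    case Nil
    show ?case by (rule exI[of _ 0]) simp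
  next
    case (step u v)
    then obtain d where "v \<in> (conc (conc dyck {[Le]}) ^^ d) {[]}" by blast
    moreover have "u @ [Le] \<in> conc dyck {[Le]}" unfolding M using step(1) by blast
    ultimately have "(u @ [Le]) @ v \<in> conc (conc dyck {[Le]}) ((conc (conc dyck {[Le]}) ^^ d) {[]})"
      by (rule concI[rotated])
    then show ?case by (intro exI[of _ "Suc d"]) simp
  qed
  then show "blocks \<subseteq> lang_star (conc dyck {[Le]})"
    by (auto simp: lang_star_def)
qed

lemma xLy_eq: "conc {[Lx]} (conc blocks {[Ly]}) = xLy_words"
  by (auto simp: conc_def xLy_words_def)

section \<open>Unambiguity of the chain languages\<close>

lemma leftmost_step_prefix:
  assumes "leftmost_step P (map Inr u @ \<phi>) \<psi>"
  shows "\<exists>\<psi>'. \<psi> = map Inr u @ \<psi>'"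
proof -
  from assms obtain w T \<beta> \<gamma> where s: "map Inr u @ \<phi> = map Inr w @ Inl T # \<gamma>" "\<psi> = map Inr w @ \<beta> @ \<gamma>"
    by (auto simp: leftmost_step_def)
  from s(1) have "\<exists>v. w = u @ v"
  proof (induction u arbitrary: w)
    case (Cons c u)
    then obtain w' where "w = c # w'" by (cases w) auto
    then show ?case using Cons by auto
  qed simp
  then show ?thesis using s(2) by auto
qed

lemma leftmost_steps_prefix:
  fixes P :: "'z productions"
  assumes "(leftmost_step P)\<^sup>*\<^sup>* (map Inr u @ \<phi>) (map Inr w)"
  shows "\<exists>v. w = u @ v"
proof -
  have "\<exists>\<psi>'. \<psi> = map Inr u @ \<psi>'" if "(leftmost_step P)\<^sup>*\<^sup>* (map Inr u @ \<phi>) \<psi>" for \<psi>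
    using that
  proof (induction rule: rtranclp_induct)
    case (step \<psi> \<chi>)
    then show ?case using leftmost_step_prefix by metis
  qed simp
  from this[OF assms] obtain \<psi>' :: "(nat + 'z) list" where "map Inr w = map Inr u @ \<psi>'" by blast
  then obtain u' v where "w = u' @ v" "map (Inr :: 'z \<Rightarrow> nat + 'z) u' = map Inr u"
    by (auto simp: map_eq_append_conv)
  then show ?thesis by (auto simp: inj_map_eq_map)
qed

lemma no_leftmost_step: "\<not> leftmost_step P (map Inr w) \<psi>"
proof
  assume "leftmost_step P (map Inr w) \<psi>"
  then obtain v T \<beta> \<gamma> where "(T, \<beta>) \<in> P" "map Inr w = map Inr v @ Inl T # \<gamma>"
    unfolding leftmost_step_def by blast
  then have "Inl T \<in> set (map Inr w)" by simp
  then show False by auto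
qed

text \<open>
  A grammar is unambiguous if, among the leftmost steps available from a reachable sentential
  form, at most one can still lead to the given word.
\<close>

lemma unambiguous_if_deterministic:
  assumes start: "reach [Inl S]"
    and closed: "\<And>\<phi> \<psi>. reach \<phi> \<Longrightarrow> leftmost_step P \<phi> \<psi> \<Longrightarrow> reach \<psi>"
    and det: "\<And>\<phi> \<psi>\<^sub>1 \<psi>\<^sub>2 w. reach \<phi> \<Longrightarrow> leftmost_step P \<phi> \<psi>\<^sub>1 \<Longrightarrow> leftmost_step P \<phi> \<psi>\<^sub>2 \<Longrightarrow>
      (leftmost_step P)\<^sup>*\<^sup>* \<psi>\<^sub>1 (map Inr w) \<Longrightarrow> (leftmost_step P)\<^sup>*\<^sup>* \<psi>\<^sub>2 (map Inr w) \<Longrightarrow> \<psi>\<^sub>1 = \<psi>\<^sub>2"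
    and complete: "\<And>w. w \<in> cfg_lang P S \<Longrightarrow> (leftmost_step P)\<^sup>*\<^sup>* [Inl S] (map Inr w)"
  shows "unambiguous_grammar P S"
  unfolding unambiguous_grammar_def
proof (intro ballI ex_ex1I)
  fix w assume "w \<in> cfg_lang P S"
  then have "(leftmost_step P)\<^sup>*\<^sup>* [Inl S] (map Inr w)" by (rule complete)
  then have "\<exists>\<Delta>. \<Delta> \<noteq> [] \<and> hd \<Delta> = [Inl S] \<and> last \<Delta> = map Inr w \<and> successively (leftmost_step P) \<Delta>"
  proof (induction rule: converse_rtranclp_induct)
    case base
    show ?case by (rule exI[of _ "[map Inr w]"]) simp
  next
    case (step \<phi> \<psi>)
    then obtain \<Delta> where "\<Delta> \<noteq> []" "hd \<Delta> = \<psi>" "last \<Delta> = map Inr w" "successively (leftmost_step P) \<Delta>"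
      by blast
    then show ?case using step(1)
      by (intro exI[of _ "\<phi> # \<Delta>"]) (simp add: successively_Cons)
  qed
  then show "\<exists>\<Delta>. leftmost_derivation P S w \<Delta>" by (simp add: leftmost_derivation_def)
next
  fix w \<Delta>\<^sub>1 \<Delta>\<^sub>2
  assume d: "leftmost_derivation P S w \<Delta>\<^sub>1" "leftmost_derivation P S w \<Delta>\<^sub>2"
  have steps: "(leftmost_step P)\<^sup>*\<^sup>* (hd \<Delta>) (last \<Delta>)" if "\<Delta> \<noteq> []" "successively (leftmost_step P) \<Delta>" for \<Delta>
    using that
  proof (induction \<Delta>)
    case (Cons \<phi> \<Delta>)
    then show ?case
      by (cases "\<Delta> = []") (auto simp: successively_Cons intro: converse_rtranclp_into_rtranclp)
  qed simp
  have "\<Delta>\<^sub>1 = \<Delta>\<^sub>2"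
    if "\<Delta>\<^sub>1 \<noteq> []" "\<Delta>\<^sub>2 \<noteq> []" "hd \<Delta>\<^sub>1 = hd \<Delta>\<^sub>2" "reach (hd \<Delta>\<^sub>1)" "last \<Delta>\<^sub>1 = map Inr w" "last \<Delta>\<^sub>2 = map Inr w"
      "successively (leftmost_step P) \<Delta>\<^sub>1" "successively (leftmost_step P) \<Delta>\<^sub>2" for \<Delta>\<^sub>1 \<Delta>\<^sub>2
    using that
  proof (induction \<Delta>\<^sub>1 arbitrary: \<Delta>\<^sub>2)
    case (Cons \<phi> \<Gamma>\<^sub>1)
    obtain \<Gamma>\<^sub>2 where D2: "\<Delta>\<^sub>2 = \<phi> # \<Gamma>\<^sub>2" using Cons.prems(2,3) by (cases \<Delta>\<^sub>2) auto
    show ?case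
    proof (cases "\<Gamma>\<^sub>1 = [] \<or> \<Gamma>\<^sub>2 = []")
      case True
      then have "\<phi> = map Inr w" using Cons.prems(5,6) D2 by auto
      then have "\<not> leftmost_step P \<phi> \<psi>" for \<psi> using no_leftmost_step by blast
      then have "\<Gamma>\<^sub>1 = []" "\<Gamma>\<^sub>2 = []" using Cons.prems(7,8) D2 by (auto simp: successively_Cons)
      then show ?thesis using D2 by simp
    next
      case False
      then have s: "leftmost_step P \<phi> (hd \<Gamma>\<^sub>1)" "leftmost_step P \<phi> (hd \<Gamma>\<^sub>2)"
        "successively (leftmost_step P) \<Gamma>\<^sub>1" "successively (leftmost_step P) \<Gamma>\<^sub>2"
        "last \<Gamma>\<^sub>1 = map Inr w" "last \<Gamma>\<^sub>2 = map Inr w" and r: "reach \<phi>"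
        using Cons.prems D2 by (auto simp: successively_Cons)
      have "hd \<Gamma>\<^sub>1 = hd \<Gamma>\<^sub>2"
        using det[OF r s(1,2), of w] steps[of \<Gamma>\<^sub>1] steps[of \<Gamma>\<^sub>2] False s by simp
      then have "\<Gamma>\<^sub>1 = \<Gamma>\<^sub>2"
        using Cons.IH[of \<Gamma>\<^sub>2] False s closed[OF r s(1)] by simp
      then show ?thesis using D2 by simp
    qed
  qed simp
  then show "\<Delta>\<^sub>1 = \<Delta>\<^sub>2" using d start by (simp add: leftmost_derivation_def)
qed

text \<open>
  Variable \<open>0\<close> is the start variable, \<open>1\<close> generates \<open>(D e)\<^sup>*\<close> and \<open>2\<close> generates \<open>D\<close>. The language
  is a finite set \<open>A\<close> together with the words \<open>p x w y\<close> for \<open>p\<close> in a finite set \<open>B\<close>.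
\<close>

definition chain_grammar :: "letter list set \<Rightarrow> letter list set \<Rightarrow> letter productions" where
  "chain_grammar A B =
     (\<lambda>w. (0, map Inr w)) ` A \<union> (\<lambda>p. (0, map Inr p @ [Inr Lx, Inl 1, Inr Ly])) ` B \<union>
     {(1, []), (1, [Inl 2, Inr Le, Inl 1]), (2, []), (2, [Inr La, Inl 2, Inr Lb, Inl 2])}"

definition chain_words :: "letter list set \<Rightarrow> letter list set \<Rightarrow> letter list set" where
  "chain_words A B = A \<union> {p @ Lx # w @ [Ly] | p w. p \<in> B \<and> w \<in> blocks}"

definition chain_model :: "letter list set \<Rightarrow> letter list set \<Rightarrow> nat \<Rightarrow> letter list set" where
  "chain_model A B T = (if T = 0 then chain_words A B else if T = 1 then blocks else balanced)"

lemma chain_grammar_cases: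
  assumes "(T, \<beta>) \<in> chain_grammar A B"
  obtains w where "T = 0" "w \<in> A" "\<beta> = map Inr w"
    | p where "T = 0" "p \<in> B" "\<beta> = map Inr p @ [Inr Lx, Inl 1, Inr Ly]"
    | "T = 1" "\<beta> = []" | "T = 1" "\<beta> = [Inl 2, Inr Le, Inl 1]"
    | "T = 2" "\<beta> = []" | "T = 2" "\<beta> = [Inr La, Inl 2, Inr Lb, Inl 2]"
  using assms unfolding chain_grammar_def by auto

lemma sem_x_y:
  "sem (chain_model A B) (map Inr p @ [Inr Lx, Inl 1, Inr Ly]) = {p @ Lx # w @ [Ly] | w. w \<in> blocks}"
  by (auto simp: sem_append conc_def chain_model_def)

lemma chain_model_closed:
  assumes "(T, \<beta>) \<in> chain_grammar A B"
  shows "sem (chain_model A B) \<beta> \<subseteq> chain_model A B T"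
  using assms
proof (cases rule: chain_grammar_cases)
  case (2 p)
  then show ?thesis unfolding 2(3) sem_x_y by (auto simp: chain_model_def chain_words_def)
qed (auto simp: chain_model_def chain_words_def conc_def intro: balanced.intros blocks.intros)

lemma derives_balanced: "w \<in> balanced \<Longrightarrow> derives (chain_grammar A B) [Inl 2] w"
proof (induction rule: balanced.induct)
  case Nil
  show ?case using derives_terminals[of _ "[]"]
    by (intro derives_production[of 2 "[]"]) (simp_all add: chain_grammar_def)
next
  case (step u v)
  have "derives (chain_grammar A B) [Inr La, Inl 2, Inr Lb, Inl 2] (La # u @ Lb # v)"
    by (intro derives_Inr derives_Inl step.IH)
  then show ?case by (rule derives_production[rotated]) (simp add: chain_grammar_def)
qed

lemma derives_blocks: "w \<in> blocks \<Longrightarrow> derives (chain_grammar A B) [Inl 1] w"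
proof (induction rule: blocks.induct)
  case Nil
  show ?case using derives_terminals[of _ "[]"]
    by (intro derives_production[of 1 "[]"]) (simp_all add: chain_grammar_def)
next
  case (step u v)
  have "derives (chain_grammar A B) [Inl 2, Inr Le, Inl 1] (u @ Le # v)"
    by (intro derives_Inr derives_Inl derives_balanced step)
  then show ?case by (rule derives_production[rotated]) (simp add: chain_grammar_def)
qed

lemma derives_chain_words:
  assumes "w \<in> chain_words A B" shows "derives (chain_grammar A B) [Inl 0] w"
proof -
  from assms consider "w \<in> A" | p v where "p \<in> B" "v \<in> blocks" "w = p @ Lx # v @ [Ly]"
    by (auto simp: chain_words_def)
  then show ?thesis
  proof cases
    case 1
    then show ?thesis
      by (intro derives_production[OF _ derives_terminals]) (simp add: chain_grammar_def)
  next
    case 2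
    have "derives (chain_grammar A B) (map Inr p @ [Inr Lx, Inl 1, Inr Ly]) w"
      unfolding 2(3) using derives_terminals[of _ "[]"]
      by (intro derives_append derives_terminals derives_Inr derives_Inl derives_blocks 2) simp
    then show ?thesis by (rule derives_production[rotated]) (simp add: chain_grammar_def 2)
  qed
qed

lemma cfg_lang_chain: "cfg_lang (chain_grammar A B) 0 = chain_words A B"
proof
  show "cfg_lang (chain_grammar A B) 0 \<subseteq> chain_words A B"
    using cfg_lang_subset[of "chain_grammar A B" "chain_model A B" 0, OF chain_model_closed]
    by (simp add: chain_model_def)
  show "chain_words A B \<subseteq> cfg_lang (chain_grammar A B) 0"
    using derives_chain_words derives_cfg_lang by blast
qed

text \<open>
  An invariant of leftmost derivations after the first step: each variable is followed by a terminal,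
  namely a letter with which no word derived by a nonempty production from that variable can begin.
\<close>

fun followed :: "(nat + letter) list \<Rightarrow> bool" where
  "followed [] = True"
| "followed (Inr c # \<phi>) = followed \<phi>"
| "followed (Inl T # \<phi>) = (followed \<phi> \<and>
     (\<exists>c \<psi>. \<phi> = Inr c # \<psi> \<and> (T = 2 \<and> (c = Lb \<or> c = Le) \<or> T = 1 \<and> c = Ly)))"

lemma followed_terminals [simp]: "followed (map Inr w @ \<phi>) = followed \<phi>"
  by (induction w) simp_all

lemma leftmost_split_unique:
  "map Inr u @ Inl T # \<gamma> = map Inr u' @ Inl T' # \<gamma>' \<Longrightarrow> u = u' \<and> T = T' \<and> \<gamma> = \<gamma>'"
proof (induction u arbitrary: u')
  case Nil
  then show ?case by (cases u') auto
next
  case (Cons c u)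
  then show ?case by (cases u') auto
qed

text \<open>
  After the first step the next terminal decides between the empty and the nonempty production of the
  leftmost variable. The first step is determined by the word itself, since the prefix \<open>p\<close> is the part
  before the first \<open>x\<close> and the words in \<open>A\<close> are not of the form \<open>p x w y\<close>.
\<close>

lemma unambiguous_chain_words:
  assumes fin: "finite A" "finite B" and noX: "\<And>p. p \<in> B \<Longrightarrow> Lx \<notin> set p"
    and disj: "\<And>p w. p \<in> B \<Longrightarrow> w \<in> blocks \<Longrightarrow> p @ Lx # w @ [Ly] \<notin> A"
  shows "unambiguous_cfl (chain_words A B)"
proof -
  let ?P = "chain_grammar A B"
  let ?L = "leftmost_step ?P"
  define reach where "reach \<phi> \<longleftrightarrow> \<phi> = [Inl 0] \<or> followed \<phi>" for \<phi> :: "(nat + letter) list"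
  have letter_next: "\<exists>v. w = u @ c # v" if "?L\<^sup>*\<^sup>* (map Inr u @ Inr c # \<gamma>) (map Inr w)" for u c \<gamma> w
    using leftmost_steps_prefix[of ?P "u @ [c]" \<gamma> w] that by auto
  have letter_D: "\<exists>c v. w = u @ c # v \<and> (c = La \<or> c = d)"
    if d: "?L\<^sup>*\<^sup>* (map Inr u @ Inl 2 # Inr d # \<gamma>) (map Inr w)" for u d \<gamma> w
    using d
  proof (cases rule: converse_rtranclpE)
    case base
    have "(Inl 2 :: nat + letter) \<in> set (map Inr w)" unfolding base[symmetric] by simp
    then show ?thesis by auto
  next
    case (step \<psi>)
    from step(1) obtain u' T \<beta> \<gamma>' where s: "(T, \<beta>) \<in> ?P"
      "map Inr u @ Inl 2 # Inr d # \<gamma> = map Inr u' @ Inl T # \<gamma>'" "\<psi> = map Inr u' @ \<beta> @ \<gamma>'"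
      by (auto simp: leftmost_step_def)
    have eq: "u' = u" "T = 2" "\<gamma>' = Inr d # \<gamma>" using leftmost_split_unique[OF s(2)] by auto
    from s(1) consider "\<beta> = []" | "\<beta> = [Inr La, Inl 2, Inr Lb, Inl 2]"
      by (cases rule: chain_grammar_cases) (use eq(2) in auto)
    then show ?thesis
    proof cases
      case 1
      have "\<exists>v. w = u @ d # v" using letter_next[of u d \<gamma> w] step(2) by (simp add: s(3) eq 1)
      then show ?thesis by blast
    next
      case 2
      have "\<exists>v. w = u @ La # v"
        using letter_next[of u La "Inl 2 # Inr Lb # Inl 2 # Inr d # \<gamma>" w] step(2) by (simp add: s(3) eq 2)
      then show ?thesis by blast
    qed
  qed
  have "unambiguous_grammar ?P 0"
  proof (rule unambiguous_if_deterministic[of reach])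
    show "reach [Inl 0]" by (simp add: reach_def)
  next
    fix \<phi> \<psi> assume r: "reach \<phi>" and "?L \<phi> \<psi>"
    then obtain u T \<beta> \<gamma> where s: "(T, \<beta>) \<in> ?P" "\<phi> = map Inr u @ Inl T # \<gamma>" "\<psi> = map Inr u @ \<beta> @ \<gamma>"
      by (auto simp: leftmost_step_def)
    have "followed \<psi>"
    proof (cases "\<phi> = [Inl 0]")
      case True
      then have "u = []" "T = 0" "\<gamma> = []" using leftmost_split_unique[of "[]" 0 "[]" u T \<gamma>] s(2) by auto
      then show ?thesis using s(1) unfolding s(3)
        by (elim chain_grammar_cases) (auto simp: followed_terminals[of _ "[]", simplified])
    next
      case False
      then have "followed (Inl T # \<gamma>)" using r s(2) by (simp add: reach_def)
      then show ?thesis using s(1) unfolding s(3)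
        by (elim chain_grammar_cases) auto
    qed
    then show "reach \<psi>" by (simp add: reach_def)
  next
    fix \<phi> \<psi>\<^sub>1 \<psi>\<^sub>2 w
    assume r: "reach \<phi>" and l: "?L \<phi> \<psi>\<^sub>1" "?L \<phi> \<psi>\<^sub>2"
      and d: "?L\<^sup>*\<^sup>* \<psi>\<^sub>1 (map Inr w)" "?L\<^sup>*\<^sup>* \<psi>\<^sub>2 (map Inr w)"
    from l(1) obtain u T \<beta>\<^sub>1 \<gamma> where s1: "(T, \<beta>\<^sub>1) \<in> ?P" "\<phi> = map Inr u @ Inl T # \<gamma>"
      "\<psi>\<^sub>1 = map Inr u @ \<beta>\<^sub>1 @ \<gamma>" unfolding leftmost_step_def by blast
    from l(2) obtain u' T' \<beta>\<^sub>2 \<gamma>' where s2: "(T', \<beta>\<^sub>2) \<in> ?P" "\<phi> = map Inr u' @ Inl T' # \<gamma>'"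
      "\<psi>\<^sub>2 = map Inr u' @ \<beta>\<^sub>2 @ \<gamma>'" unfolding leftmost_step_def by blast
    have "u = u' \<and> T = T' \<and> \<gamma> = \<gamma>'"
      by (rule leftmost_split_unique) (simp flip: s1(2) s2(2))
    then have s: "(T, \<beta>\<^sub>1) \<in> ?P" "(T, \<beta>\<^sub>2) \<in> ?P" "\<phi> = map Inr u @ Inl T # \<gamma>"
      "\<psi>\<^sub>1 = map Inr u @ \<beta>\<^sub>1 @ \<gamma>" "\<psi>\<^sub>2 = map Inr u @ \<beta>\<^sub>2 @ \<gamma>"
      using s1 s2 by simp_all
    have sem_in: "w \<in> sem (chain_model A B) \<psi>" if "?L\<^sup>*\<^sup>* \<psi> (map Inr w)" for \<psi>
      using derivation_sem[OF chain_model_closed leftmost_imp_steps[OF that]] by simp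
    show "\<psi>\<^sub>1 = \<psi>\<^sub>2"
    proof (cases "\<phi> = [Inl 0]")
      case True
      then have e: "u = []" "T = 0" "\<gamma> = []" using leftmost_split_unique[of "[]" 0 "[]" u T \<gamma>] s(3) by auto
      have form: "\<beta> = map Inr w \<and> w \<in> A \<or>
          (\<exists>p\<in>B. \<beta> = map Inr p @ [Inr Lx, Inl 1, Inr Ly] \<and> (\<exists>v\<in>blocks. w = p @ Lx # v @ [Ly]))"
        if "(0, \<beta>) \<in> ?P" "w \<in> sem (chain_model A B) \<beta>" for \<beta>
        using that(1)
      proof (cases rule: chain_grammar_cases)
        case (2 p)
        then show ?thesis using that(2) unfolding 2(3) sem_x_y by blast
      qed (use that(2) in auto)
      have in1: "w \<in> sem (chain_model A B) \<beta>\<^sub>1" and in2: "w \<in> sem (chain_model A B) \<beta>\<^sub>2"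
        using sem_in[OF d(1)] sem_in[OF d(2)] by (simp_all add: s e)
      have px: "p = p'" if "p @ Lx # v = p' @ Lx # v'" "p \<in> B" "p' \<in> B" for p p' v v'
      proof -
        have "takeWhile (\<lambda>c. c \<noteq> Lx) (p @ Lx # v) = p" if "p \<in> B" for p v
          using noX[OF that] by (subst takeWhile_append2) auto
        then show ?thesis using that by metis
      qed
      show ?thesis
        using form[OF s(1)[unfolded e(2)] in1] form[OF s(2)[unfolded e(2)] in2] disj
        by (auto simp: s e dest: px)
    next
      case False
      then have f: "followed (Inl T # \<gamma>)" using r s(3) by (simp add: reach_def)
      then obtain c \<gamma>' where g: "\<gamma> = Inr c # \<gamma>'" "T = 2 \<and> (c = Lb \<or> c = Le) \<or> T = 1 \<and> c = Ly" by auto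
      have eps: "\<exists>v. w = u @ c # v" if "\<beta> = []" "?L\<^sup>*\<^sup>* (map Inr u @ \<beta> @ \<gamma>) (map Inr w)" for \<beta>
        using letter_next that g by simp
      have other: "\<exists>d v. w = u @ d # v \<and> d \<noteq> c"
        if "\<beta> \<noteq> []" "(T, \<beta>) \<in> ?P" "?L\<^sup>*\<^sup>* (map Inr u @ \<beta> @ \<gamma>) (map Inr w)" for \<beta>
        using that(2)
      proof (cases rule: chain_grammar_cases)
        case 4
        then show ?thesis using letter_D[of u Le "Inl 1 # \<gamma>" w] that(3) g by auto
      next
        case 6
        then show ?thesis using letter_next[of u La _ w] that(3) g by auto
      qed (use that(1) g in auto)
      have one: "\<beta>\<^sub>1 = \<beta>\<^sub>2" if "\<beta>\<^sub>1 \<noteq> []" "\<beta>\<^sub>2 \<noteq> []"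
        using s(1)
      proof (cases rule: chain_grammar_cases)
        case 4
        from s(2) show ?thesis by (cases rule: chain_grammar_cases) (use that 4 in auto)
      next
        case 6
        from s(2) show ?thesis by (cases rule: chain_grammar_cases) (use that 6 in auto)
      qed (use that g in auto)
      have "\<beta>\<^sub>1 = [] \<longleftrightarrow> \<beta>\<^sub>2 = []"
        using eps[of \<beta>\<^sub>1] eps[of \<beta>\<^sub>2] other[OF _ s(1)] other[OF _ s(2)] d unfolding s(4,5) by fastforce
      then show ?thesis using one s(4,5) by blast
    qed
  next
    fix w assume "w \<in> cfg_lang ?P 0"
    then show "?L\<^sup>*\<^sup>* [Inl 0] (map Inr w)"
      unfolding cfg_lang_chain by (intro derives_leftmost derives_chain_words)
  qed
  moreover have "finite ?P" using fin by (simp add: chain_grammar_def)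
  ultimately show ?thesis unfolding unambiguous_cfl_def using cfg_lang_chain by blast
qed

section \<open>Chains\<close>

text \<open>
  The length conditions say that the obstruction starts inside the tail.
\<close>

lemma extends_iff:
  "extends G s t u \<longleftrightarrow> (\<exists>w\<in>G. \<exists>v. t @ u = v @ w \<and> length v < length t)"
proof
  assume "extends G s t u"
  then obtain w v where w: "w \<in> G" "(s @ t) @ u = v @ w" "length u < length w" "length s \<le> length v"
    unfolding extends_def by blast
  then obtain v' where v: "v = s @ v'"
    by (metis append_assoc append_eq_append_conv_if append_take_drop_id)
  then have e: "t @ u = v' @ w" using w(2) by simp
  then have "length t + length u = length v' + length w" by (metis length_append)
  then show "\<exists>w\<in>G. \<exists>v. t @ u = v @ w \<and> length v < length t" using w(1,3) e by force
next
  assume "\<exists>w\<in>G. \<exists>v. t @ u = v @ w \<and> length v < length t"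
  then obtain w v where w: "w \<in> G" "t @ u = v @ w" "length v < length t" by blast
  then have "length t + length u = length v + length w" by (metis length_append)
  then show "extends G s t u" unfolding extends_def
    using w by (intro bexI[of _ w] exI[of _ "s @ v"]) auto
qed

lemma extends_letter: "extends G s [z] u \<longleftrightarrow> z # u \<in> G"
  unfolding extends_iff by auto

lemma obstructions_Cons:
  "z # u \<in> obstructions \<longleftrightarrow>
     (\<exists>c. u = [c] \<and> rule2 z c \<noteq> None) \<or> z = Lx \<and> (\<exists>w\<in>blocks. u = w @ [Ly])"
  by (auto simp: obstructions_def xLy_words_def)

lemma rule2_bracket: "z = La \<or> z = Lb \<Longrightarrow> rule2 z c \<noteq> None \<Longrightarrow> c = Ly"
  by (cases c) auto

lemma blocks_last: "w \<in> blocks \<Longrightarrow> w \<noteq> [] \<Longrightarrow> last w = Le"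
  by (induction rule: blocks.induct) auto

text \<open>
  No obstruction starts inside \<open>w y\<close> after its \<open>x\<close>: letters \<open>y\<close> and \<open>e\<close> start none, and a bracket
  starts one only if \<open>y\<close> follows it, but the last letter of \<open>w\<close> is \<open>e\<close>.
\<close>

lemma not_extends_block:
  assumes "w \<in> blocks" shows "\<not> extends obstructions s (w @ [Ly]) u"
proof
  assume "extends obstructions s (w @ [Ly]) u"
  then obtain g v where g: "g \<in> obstructions" "w @ Ly # u = v @ g" "length v \<le> length w"
    unfolding extends_iff by auto
  then obtain w2 where w2: "w = v @ w2" "g = w2 @ Ly # u"
    by (metis append_eq_append_conv_if append_eq_conv_conj append_take_drop_id same_append_eq append_assoc)
  show False
  proof (cases w2)
    case Nil
    then show ?thesis using g(1) w2 by (auto elim!: obstructions_cases)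
  next
    case (Cons c w3)
    have "c = La \<or> c = Lb \<or> c = Le" using blocks_letters[OF assms] w2(1) Cons by auto
    then have "g = [c, Ly]" "c \<noteq> Le" using g(1) w2(2) Cons blocks_letters[OF assms] w2(1)
      by (auto elim!: obstructions_cases; cases w3; auto)+
    then have "w3 = []" using w2(2) Cons by (cases w3) auto
    then have "last w = c" using w2(1) Cons by simp
    then show ?thesis using blocks_last[OF assms] w2(1) Cons \<open>c \<noteq> Le\<close> by simp
  qed
qed

lemma chains_0: "chains obstructions 0 = (\<lambda>g. (take 1 g, drop 1 g)) ` obstructions"
  by auto

lemma chains_1: "chains obstructions (Suc 0) = (\<lambda>g. (take 2 g, drop 2 g)) ` chains3"
proof (intro equalityI subsetI)
  fix q assume "q \<in> chains obstructions (Suc 0)"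
  then obtain s t u where q: "q = (s @ t, u)" "(s, t) \<in> chains obstructions 0" "extends obstructions s t u"
    by auto
  then obtain g where g: "g \<in> obstructions" "s = take 1 g" "t = drop 1 g" unfolding chains_0 by auto
  from g(1) show "q \<in> (\<lambda>g. (take 2 g, drop 2 g)) ` chains3"
  proof (cases rule: obstructions_cases)
    case (1 p z)
    then have "z # u \<in> obstructions" using q(3) g by (simp add: extends_letter)
    moreover from 1(2) have "z = Lx \<and> primed p \<or> (z = La \<or> z = Lb) \<and> primed p \<or> z = Le \<or> z = Ly"
      by (cases rule: rule2_cases) auto
    ultimately have "p # z # u \<in> chains3"
      unfolding obstructions_Cons using rule2_bracket[of z]
      by (elim disjE conjE exE bexE) (auto simp: chains3_def)
    moreover have "q = (take 2 (p # z # u), drop 2 (p # z # u))" using q(1) g 1(1) by simp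
    ultimately show ?thesis by blast
  next
    case (2 w)
    then show ?thesis using q(3) g not_extends_block[OF 2(2)] by simp
  qed
next
  fix q assume "q \<in> (\<lambda>g. (take 2 g, drop 2 g)) ` chains3"
  then obtain g where g: "g \<in> chains3" "q = (take 2 g, drop 2 g)" by blast
  have "\<exists>p z u. g = p # z # u \<and> [p, z] \<in> obstructions \<and> z # u \<in> obstructions"
    using g(1) by (cases rule: chains3_cases) (auto simp: obstructions_def xLy_words_def)
  then obtain p z u where h: "g = p # z # u" "[p, z] \<in> obstructions" "z # u \<in> obstructions" by blast
  have "([p], [z]) \<in> chains obstructions 0" unfolding chains_0 using h(2) by force
  moreover have "extends obstructions [p] [z] u" using h(3) by (simp add: extends_letter)
  moreover have "\<not> (\<exists>u1. strict_prefix u1 u \<and> extends obstructions [p] [z] u1)"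
  proof
    assume "\<exists>u1. strict_prefix u1 u \<and> extends obstructions [p] [z] u1"
    then obtain u1 where u1: "strict_prefix u1 u" "z # u1 \<in> obstructions" by (auto simp: extends_letter)
    then obtain u2 where "u = u1 @ u2" "u2 \<noteq> []" by (auto simp: strict_prefix_def prefix_def)
    then show False using obstruction_prefix_unique[OF u1(2) h(3), of u2 "[]"] by simp
  qed
  ultimately have "([p] @ [z], u) \<in> chains obstructions (Suc 0)"
    unfolding chains.simps(2) by blast
  then show "q \<in> chains obstructions (Suc 0)" by (simp only: g(2) h(1)) simp
qed

lemma chains_2: "chains obstructions (Suc (Suc n)) = {}"
proof (induction n)
  case 0
  have "\<not> extends obstructions s t u" if "(s, t) \<in> chains obstructions (Suc 0)" for s t u
  proof -
    from that obtain g where "g \<in> chains3" "t = drop 2 g" unfolding chains_1 by auto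
    then show ?thesis
    proof (cases rule: chains3_cases)
      case (1 p c)
      then show ?thesis using \<open>t = drop 2 g\<close>
        by (auto simp: extends_letter obstructions_def xLy_words_def)
    next
      case (2 p w)
      then show ?thesis using \<open>t = drop 2 g\<close> not_extends_block by simp
    qed
  qed
  then show ?case unfolding chains.simps(2)[of obstructions "Suc 0"] by blast
next
  case (Suc n)
  show ?case unfolding chains.simps(2)[of obstructions "Suc (Suc n)"] Suc.IH by blast
qed

lemma chain_lang_B:
  fixes J :: "(letter, 'k::field) falg set"
  assumes "J = idealB"
  shows "chain_lang J 1 = obstructions" "chain_lang J 2 = chains3"
    "\<And>n. chain_lang J (Suc (Suc (Suc n))) = {}"
proof -
  have J: "minimal_monomial_basis J = obstructions" unfolding assms by (rule minimal_monomial_basis_B)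
  have eq: "{s @ t | s t. (s, t) \<in> (\<lambda>g. (take k g, drop k g)) ` G} = G" for k and G :: "letter list set"
  proof -
    have "{s @ t | s t. (s, t) \<in> (\<lambda>g. (take k g, drop k g)) ` G} = {take k g @ drop k g | g. g \<in> G}"
      by blast
    then show ?thesis by simp
  qed
  show "chain_lang J 1 = obstructions"
    unfolding One_nat_def chain_lang.simps J chains_0 by (rule eq)
  show "chain_lang J 2 = chains3"
    unfolding numeral_2_eq_2 chain_lang.simps J chains_1 by (rule eq[unfolded numeral_2_eq_2])
  show "chain_lang J (Suc (Suc (Suc n))) = {}" for n
    unfolding chain_lang.simps J chains_2 by simp
qed

lemma obstructions_words: "obstructions = chain_words rule_pairs {[]}"
  by (auto simp: obstructions_def chain_words_def rule_pairs_def xLy_words_def)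

text \<open>
  The finite part of the language of \<open>2\<close>-chains.
\<close>

definition collapsing_words :: "letter list set" where
  "collapsing_words = {[p, c, Ly] | p c. primed p \<and> (c = La \<or> c = Lb)}"

lemma chains3_words: "chains3 = chain_words collapsing_words {[La'], [Lb']}"
proof -
  have "{p @ Lx # w @ [Ly] | p w. p \<in> {[La'], [Lb']} \<and> w \<in> blocks}
      = (\<Union>p\<in>{[La'], [Lb']}. {p @ Lx # w @ [Ly] | w. w \<in> blocks})" by blast
  also have "\<dots> = (\<Union>p\<in>{La', Lb'}. {p # Lx # w @ [Ly] | w. w \<in> blocks})" by simp
  also have "\<dots> = {p # Lx # w @ [Ly] | p w. primed p \<and> w \<in> blocks}" by blast
  finally show ?thesis by (simp only: chains3_def chain_words_def collapsing_words_def)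
qed

lemma xLy_chain_words: "xLy_words = chain_words {} {[]}"
  by (auto simp: chain_words_def xLy_words_def)

lemma finite_rule_pairs: "finite rule_pairs"
proof (rule finite_subset)
  show "rule_pairs \<subseteq> {w. set w \<subseteq> UNIV \<and> length w = 2}" by (auto simp: rule_pairs_def)
qed (rule finite_lists_length_eq[OF finite_letter])

lemma finite_collapsing: "finite collapsing_words"
proof (rule finite_subset)
  show "collapsing_words \<subseteq> {w. set w \<subseteq> UNIV \<and> length w = 3}" by (auto simp: collapsing_words_def)
qed (rule finite_lists_length_eq[OF finite_letter])

lemma rule_pairs_xLy: "rule_pairs \<inter> xLy_words = {}"
proof -
  have "Lx # w @ [Ly] \<notin> rule_pairs" for w
    by (auto simp: rule_pairs_def Cons_eq_append_conv)
  then show ?thesis by (auto simp: xLy_words_def)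
qed

lemma unambiguous_xLy: "unambiguous_cfl xLy_words"
  unfolding xLy_chain_words by (rule unambiguous_chain_words) auto

lemma unambiguous_obstructions: "unambiguous_cfl obstructions"
  unfolding obstructions_words
  using rule_pairs_xLy by (intro unambiguous_chain_words finite_rule_pairs) (auto simp: xLy_words_def)

lemma unambiguous_chains3: "unambiguous_cfl chains3"
  unfolding chains3_words
  by (intro unambiguous_chain_words finite_collapsing) (auto simp: collapsing_words_def)

lemma unambiguous_empty: "unambiguous_cfl ({} :: letter list set)"
proof -
  have "chain_words {} {} = {}" by (auto simp: chain_words_def)
  then show ?thesis using unambiguous_chain_words[of "{}" "{}"] by simp
qed

lemma homologically_unambiguous_B: "homologically_unambiguous (idealB :: (letter, 'k::field) falg set)"
  unfolding homologically_unambiguous_def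
proof (intro conjI ballI allI impI)
  note L = chain_lang_B[of "idealB :: (letter, 'k) falg set", OF refl]
  show "2 \<le> length w" if "w \<in> chain_lang (idealB :: (letter, 'k) falg set) 1" for w
    using that unfolding L(1) by (auto simp: obstructions_def xLy_words_def)
  fix i :: nat assume "1 \<le> i"
  then consider "i = 1" | "i = 2" | n where "i = Suc (Suc (Suc n))"
    by (metis One_nat_def Suc_le_D numeral_2_eq_2 old.nat.exhaust)
  then show "unambiguous_cfl (chain_lang (idealB :: (letter, 'k) falg set) i)"
  proof cases
    case 1
    show ?thesis unfolding 1 L(1) by (rule unambiguous_obstructions)
  next
    case 2
    show ?thesis unfolding 2 L(2) by (rule unambiguous_chains3)
  next
    case 3
    show ?thesis unfolding 3 L(3) by (rule unambiguous_empty)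
  qed
qed

section \<open>Generating functions\<close>

definition gf :: "letter list set \<Rightarrow> 'c::comm_ring_1 fps" where
  "gf M = Abs_fps (\<lambda>n. of_nat (card {w \<in> M. length w = n}))"

lemma finite_slice: "finite {w \<in> (M :: letter list set). length w = n}"
  by (rule finite_subset[OF _ finite_lists_length_eq[OF finite_letter, of n]]) auto

lemma gf_Un:
  assumes "A \<inter> B = {}" shows "gf (A \<union> B) = gf A + gf B"
proof (rule fps_ext)
  fix n
  have "{w \<in> A \<union> B. length w = n} = {w \<in> A. length w = n} \<union> {w \<in> B. length w = n}" by auto
  moreover have "card ({w \<in> A. length w = n} \<union> {w \<in> B. length w = n})
      = card {w \<in> A. length w = n} + card {w \<in> B. length w = n}"
    using assms by (intro card_Un_disjoint finite_slice) auto
  ultimately show "gf (A \<union> B) $ n = (gf A + gf B) $ n"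
    by (simp add: gf_def)
qed

lemma gf_diff: "B \<subseteq> A \<Longrightarrow> (gf (A - B) :: 'c::comm_ring_1 fps) = gf A - gf B"
  using gf_Un[of "A - B" B, where ?'a = 'c] by (simp add: Un_absorb2 Un_commute Int_commute[of "A - B"])

lemma gf_Nil: "gf {[]} = 1"
proof (rule fps_ext)
  fix n :: nat
  have "{w \<in> {[]}. length w = n} = (if n = 0 then {[]} else ({} :: letter list set))" by auto
  then show "gf {[]} $ n = 1 $ n" by (simp add: gf_def)
qed

lemma gf_letter: "gf {[z]} = fps_X"
proof (rule fps_ext)
  fix n :: nat
  have "{w \<in> {[z]}. length w = n} = (if n = 1 then {[z]} else {})" by auto
  then show "gf {[z]} $ n = fps_X $ n" by (simp add: gf_def fps_X_def)
qed

lemma gf_conc: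
  assumes "\<And>u u' v v'. u \<in> A \<Longrightarrow> u' \<in> A \<Longrightarrow> v \<in> B \<Longrightarrow> v' \<in> B \<Longrightarrow> u @ v = u' @ v' \<Longrightarrow> u = u' \<and> v = v'"
  shows "gf (conc A B) = gf A * gf B"
proof (rule fps_ext)
  fix n
  let ?S = "\<lambda>i. {u \<in> A. length u = i} \<times> {v \<in> B. length v = n - i}"
  have "{w \<in> conc A B. length w = n} = (\<lambda>(u, v). u @ v) ` (\<Union>i\<in>{0..n}. ?S i)"
    by (force simp: conc_def)
  moreover have "inj_on (\<lambda>(u, v). u @ v) (\<Union>i\<in>{0..n}. ?S i)"
    using assms by (auto simp: inj_on_def)
  ultimately have "card {w \<in> conc A B. length w = n} = card (\<Union>i\<in>{0..n}. ?S i)"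
    by (simp add: card_image)
  also have "\<dots> = (\<Sum>i\<in>{0..n}. card (?S i))"
    by (rule card_UN_disjoint) (auto simp: finite_slice)
  finally show "gf (conc A B) $ n = (gf A * gf B) $ n"
    by (simp add: gf_def fps_mult_nth card_cartesian_product)
qed

lemma gf_Cons: "gf (conc {[z]} B) = fps_X * gf B"
  by (subst gf_conc) (auto simp: gf_letter)

lemma gf_balanced: "(gf balanced :: 'c::comm_ring_1 fps) = 1 + fps_X ^ 2 * gf balanced ^ 2"
proof -
  have eq: "balanced = {[]} \<union> conc {[La]} (conc balanced (conc {[Lb]} balanced))"
  proof (intro equalityI subsetI)
    fix w assume "w \<in> balanced"
    then show "w \<in> {[]} \<union> conc {[La]} (conc balanced (conc {[Lb]} balanced))"
      by cases (auto simp: conc_def)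
  qed (auto simp: conc_def intro: balanced.intros)
  have "(gf balanced :: 'c fps) = gf ({[]} \<union> conc {[La]} (conc balanced (conc {[Lb]} balanced)))"
    using eq by simp
  also have "\<dots> = gf {[]} + gf (conc {[La]} (conc balanced (conc {[Lb]} balanced)))"
    by (rule gf_Un) (auto simp: conc_def)
  finally have sum: "(gf balanced :: 'c fps) =
      gf {[]} + gf (conc {[La]} (conc balanced (conc {[Lb]} balanced)))" .
  have "(gf (conc balanced (conc {[Lb]} balanced)) :: 'c fps) = gf balanced * gf (conc {[Lb]} balanced)"
    by (rule gf_conc) (auto simp: conc_def dest: balanced_unique)
  then have "(gf (conc {[La]} (conc balanced (conc {[Lb]} balanced))) :: 'c fps) = fps_X ^ 2 * gf balanced ^ 2"
    by (simp add: gf_Cons power2_eq_square algebra_simps)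
  with sum show ?thesis by (simp add: gf_Nil)
qed

lemma gf_blocks: "(gf blocks :: 'c::comm_ring_1 fps) = 1 + fps_X * gf balanced * gf blocks"
proof -
  have eq: "blocks = {[]} \<union> conc balanced (conc {[Le]} blocks)"
  proof (intro equalityI subsetI)
    fix w assume "w \<in> blocks"
    then show "w \<in> {[]} \<union> conc balanced (conc {[Le]} blocks)"
      by cases (auto simp: conc_def)
  qed (auto simp: conc_def intro: blocks.intros)
  have "(gf blocks :: 'c fps) = gf ({[]} \<union> conc balanced (conc {[Le]} blocks))"
    using eq by simp
  also have "\<dots> = gf {[]} + gf (conc balanced (conc {[Le]} blocks))"
    by (rule gf_Un) (auto simp: conc_def)
  also have "(gf (conc balanced (conc {[Le]} blocks)) :: 'c fps) = gf balanced * gf (conc {[Le]} blocks)"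
    by (rule gf_conc) (auto simp: conc_def dest: balanced_unique)
  finally show ?thesis by (simp add: gf_Nil gf_Cons algebra_simps)
qed

text \<open>
  Multiply \<open>D = 1 + t\<^sup>2 D\<^sup>2\<close> by \<open>t L\<^sup>2\<close> and eliminate \<open>D\<close> by \<open>t D L = L - 1\<close>.
\<close>

lemma gf_blocks_quadratic: "(1 - 2 * fps_X) * (gf blocks ^ 2 - gf blocks) = (fps_X :: 'c::comm_ring_1 fps)"
proof -
  define x d l where "x = (fps_X :: 'c fps)" and "d = (gf balanced :: 'c fps)" and "l = (gf blocks :: 'c fps)"
  have d: "1 + x\<^sup>2 * d\<^sup>2 = d"
    unfolding x_def d_def by (rule gf_balanced[symmetric])
  have "l = 1 + x * d * l"
    unfolding x_def d_def l_def by (rule gf_blocks)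
  then have "l - 1 = x * d * l" by (metis add_diff_cancel_left')
  then have l: "x * l * d = l - 1" by (simp add: mult.assoc mult.commute)
  have "l * (l - 1) = l * (x * l * d)" using l by simp
  also have "\<dots> = x * l\<^sup>2 * d" by (simp add: power2_eq_square algebra_simps)
  also have "\<dots> = x * l\<^sup>2 * (1 + x\<^sup>2 * d\<^sup>2)" using d by simp
  also have "\<dots> = x * l\<^sup>2 + x * (x * l * d)\<^sup>2" by (simp add: power2_eq_square algebra_simps)
  also have "\<dots> = x * l\<^sup>2 + x * (l - 1)\<^sup>2" using l by simp
  finally have "(1 - 2 * x) * (l\<^sup>2 - l) = x" by (simp add: power2_eq_square algebra_simps)
  then show ?thesis by (simp add: x_def l_def)
qed

definition normal_words :: "letter list set" where "normal_words = {w. normal_word w}"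

text \<open>
  Split the normal words by their first letter. The letters \<open>y\<close> and \<open>e\<close> can precede any normal word,
  brackets those not starting with \<open>y\<close>, and \<open>x\<close> those that are not blocked. A primed letter
  can only precede primed letters, so the words starting with one lie in \<open>{a', b'}\<^sup>*\<close>.
\<close>

lemma normal_words_gf:
  "gf normal_words * ((1 - 2 * fps_X) * (1 - 5 * fps_X + 2 * fps_X ^ 2 + fps_X ^ 2 * gf blocks)) = (1 :: 'c::comm_ring_1 fps)"
proof -
  let ?N = normal_words
  let ?Y = "conc {[Ly]} ?N" and ?Z = "conc blocks (conc {[Ly]} ?N)"
  let ?P = "{w. set w \<subseteq> {La', Lb'}}"
  have cons: "w \<in> conc {[z]} M \<longleftrightarrow> (\<exists>m\<in>M. w = z # m)" for w z M by (auto simp: conc_def)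
  have Pn: "?P \<subseteq> ?N"
  proof
    fix w assume "w \<in> ?P"
    then have "set w \<subseteq> {La', Lb'}" by simp
    then have "normal_word w"
    proof (induction w)
      case (Cons z w)
      then have "act z w = Some (z # w)"
        by (cases w) (auto simp: act_def)
      with Cons show ?case by (simp add: normal_Cons del: nfA_simps)
    qed simp
    then show "w \<in> ?N" by (simp add: normal_words_def)
  qed
  have Yn: "?Y \<subseteq> ?N" by (auto simp: cons normal_words_def simp del: nfA_simps)
  have Zn: "?Z \<subseteq> ?N"
    using normal_blocks by (auto simp: conc_def normal_words_def simp del: nfA_simps)
  have inZ: "m \<in> ?Z \<longleftrightarrow> blocked m" if "m \<in> ?N" for m
    using that normal_factor[of "w @ [Ly]" t "[]" for w t]
    by (fastforce simp: conc_def blocked_def normal_words_def simp del: nfA_simps)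
  have inY: "m \<in> ?Y \<longleftrightarrow> m \<noteq> [] \<and> hd m = Ly" if "m \<in> ?N" for m
    using that by (cases m) (auto simp: cons normal_words_def simp del: nfA_simps)
  have primed: "normal_word (p # m) \<longleftrightarrow> set m \<subseteq> {La', Lb'}" if p: "primed p" for p m
  proof
    assume n: "normal_word (p # m)"
    then show "set m \<subseteq> {La', Lb'}"
      using p
    proof (induction m arbitrary: p)
      case (Cons z m)
      have "\<not> [p, z] \<in> obstructions"
        using Cons.prems(1) obstruction_not_normal[of "[p, z]" "[]" m] by auto
      then have "primed z" using Cons.prems(2) by (cases z) (auto simp: obstructions_def)
      moreover have "normal_word (z # m)" using Cons.prems(1) by (simp only: normal_Cons)
      ultimately show ?case using Cons.IH by auto
    qed simp
  next
    assume "set m \<subseteq> {La', Lb'}"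
    then have "p # m \<in> ?P" using p by auto
    then have "p # m \<in> ?N" by (rule subsetD[OF Pn])
    then show "normal_word (p # m)" by (simp only: normal_words_def mem_Collect_eq)
  qed
  have split: "?N = ?P \<union> (?Y \<union> (conc {[Le]} ?N \<union> (conc {[La]} (?N - ?Y) \<union>
      (conc {[Lb]} (?N - ?Y) \<union> conc {[Lx]} (?N - ?Z)))))" (is "_ = ?R")
  proof (rule Set.set_eqI)
    fix w show "w \<in> ?N \<longleftrightarrow> w \<in> ?R"
    proof (cases w)
      case Nil
      then show ?thesis by (simp add: normal_words_def)
    next
      case (Cons z m)
      have N: "v \<in> ?N \<longleftrightarrow> normal_word v" for v by (simp add: normal_words_def)
      have hd: "m \<in> ?N - ?Y \<longleftrightarrow> normal_word m \<and> \<not> (m \<noteq> [] \<and> hd m = Ly)"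
        using inY N by blast
      have bl: "m \<in> ?N - ?Z \<longleftrightarrow> normal_word m \<and> \<not> blocked m"
        using inZ N by blast
      have c: "x # v \<in> conc {[y]} M \<longleftrightarrow> x = y \<and> v \<in> M" for x y v M by (auto simp: conc_def)
      show ?thesis unfolding Cons
        by (cases z) (simp_all only: Un_iff c list.inject letter.distinct simp_thms hd bl
            N normal_y normal_e normal_ab normal_x primed mem_Collect_eq list.set insert_subset insert_iff empty_iff)
    qed
  qed
  have cgf: "gf (conc {[z]} M) = (fps_X * gf M :: 'c fps)" for z M by (rule gf_Cons)
  have gZ: "(gf ?Z :: 'c fps) = gf blocks * (fps_X * gf ?N)"
  proof -
    have "(gf ?Z :: 'c fps) = gf blocks * gf ?Y"
      by (rule gf_conc) (auto simp: conc_def dest: blocks_unique)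
    then show ?thesis by (simp only: cgf)
  qed
  have "?P = {[]} \<union> (conc {[La']} ?P \<union> conc {[Lb']} ?P)"
  proof (rule Set.set_eqI)
    fix w show "w \<in> ?P \<longleftrightarrow> w \<in> {[]} \<union> (conc {[La']} ?P \<union> conc {[Lb']} ?P)"
      by (cases w) (auto simp: cons)
  qed
  then have "(gf ?P :: 'c fps) = gf ({[]} \<union> (conc {[La']} ?P \<union> conc {[Lb']} ?P))" by simp
  also have "\<dots> = 1 + (fps_X * gf ?P + fps_X * gf ?P)"
    by (subst gf_Un, (auto simp: cons)[1], subst gf_Un, (auto simp: cons)[1], simp only: gf_Nil cgf)
  finally have P: "(gf ?P :: 'c fps) * (1 - 2 * fps_X) = 1" by (simp add: algebra_simps)
  have "(gf ?N :: 'c fps) = gf ?R" using split by simp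
  also have "\<dots> = gf ?P + (gf ?Y + (gf (conc {[Le]} ?N) + (gf (conc {[La]} (?N - ?Y)) +
      (gf (conc {[Lb]} (?N - ?Y)) + gf (conc {[Lx]} (?N - ?Z))))))"
    by (subst gf_Un, (auto simp: cons)[1])+ simp
  also have "\<dots> = gf ?P + (fps_X * gf ?N + (fps_X * gf ?N + (fps_X * (gf ?N - fps_X * gf ?N) +
      (fps_X * (gf ?N - fps_X * gf ?N) + fps_X * (gf ?N - gf blocks * (fps_X * gf ?N))))))"
    by (simp only: cgf gf_diff[OF Yn] gf_diff[OF Zn] gZ)
  finally have "(gf ?N :: 'c fps) * (1 - 5 * fps_X + 2 * fps_X ^ 2 + fps_X ^ 2 * gf blocks) = gf ?P"
    by (simp add: algebra_simps power2_eq_square)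
  then have "(gf ?N :: 'c fps) * (1 - 5 * fps_X + 2 * fps_X ^ 2 + fps_X ^ 2 * gf blocks) * (1 - 2 * fps_X) = 1"
    using P by simp
  then show ?thesis by (simp only: mult.assoc mult.commute[of "1 - 2 * fps_X"])
qed

section \<open>The Euler characteristic\<close>

definition euler :: "'c::comm_ring_1 fps" where
  "euler = (1 - 2 * fps_X) * (1 - 5 * fps_X + 2 * fps_X ^ 2 + fps_X ^ 2 * gf blocks)"

lemma gf_normal_euler: "gf normal_words * euler = 1"
  unfolding euler_def by (rule normal_words_gf)

text \<open>
  The defect in the quadratic equation is a multiple of the equation \<open>gf_blocks_quadratic\<close>.
\<close>

lemma euler_identity:
  fixes x l :: "'a::comm_ring_1"
  defines "q \<equiv> (1 - 2 * x) * (1 - 5 * x + 2 * x ^ 2 + x ^ 2 * l)"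
  shows "q ^ 2 + (2 * x - 1) * (5 * x ^ 2 - 10 * x + 2) * q
       + (2 * x - 1) * (13 * x ^ 5 - 56 * x ^ 4 + 85 * x ^ 3 - 50 * x ^ 2 + 12 * x - 1)
     = x ^ 4 * (1 - 2 * x) * ((1 - 2 * x) * (l ^ 2 - l) - x)"
  unfolding q_def by (simp add: algebra_simps eval_nat_numeral)

lemma euler_quadratic:
  "euler ^ 2 + (2 * fps_X - 1) * (5 * fps_X ^ 2 - 10 * fps_X + 2) * euler
     + (2 * fps_X - 1) * (13 * fps_X ^ 5 - 56 * fps_X ^ 4 + 85 * fps_X ^ 3
                             - 50 * fps_X ^ 2 + 12 * fps_X - 1) = (0 :: 'c::comm_ring_1 fps)"
  unfolding euler_def euler_identity gf_blocks_quadratic by simp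

text \<open>
  Completing the square in \<open>gf_blocks_quadratic\<close>; the constant term \<open>1\<close> selects the branch of the root.
\<close>

lemma gf_blocks_radical:
  "(1 - 2 * fps_X) * (2 * gf blocks - 1) = fps_radical root 2 (1 - 4 * fps_X ^ 2 :: real fps)"
proof -
  define x l where "x = (fps_X :: real fps)" and "l = (gf blocks :: real fps)"
  have q: "(1 - 2 * x) * (l ^ 2 - l) = x"
    unfolding x_def l_def by (rule gf_blocks_quadratic)
  have "((1 - 2 * x) * (2 * l - 1)) ^ 2 = (1 - 2 * x) * (4 * ((1 - 2 * x) * (l ^ 2 - l)) + (1 - 2 * x))"
    by Groebner_Basis.algebra
  also have "\<dots> = 1 - 4 * x ^ 2" unfolding q by Groebner_Basis.algebra
  finally have sq: "((1 - 2 * x) * (2 * l - 1)) ^ Suc 1 = 1 - 4 * x ^ 2" by (simp add: numeral_2_eq_2)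
  have "{w \<in> blocks. length w = 0} = {[]}" by (auto intro: blocks.intros)
  then have "l $ 0 = 1" by (simp add: l_def gf_def)
  then have a0: "((1 - 2 * x) * (2 * l - 1)) $ 0 = 1" by (simp add: x_def)
  have b0: "(1 - 4 * x ^ 2) $ 0 = 1" by (simp add: x_def)
  have "(1 - 2 * x) * (2 * l - 1) = fps_radical root (Suc 1) (1 - 4 * x ^ 2)"
    by (rule iffD1[OF radical_unique sq]) (simp_all only: a0 b0, simp_all)
  then show ?thesis by (simp add: x_def l_def numeral_2_eq_2)
qed

lemma euler_radical:
  "euler = 1 - 7 * fps_X + fps_const (25 / 2) * fps_X ^ 2 - 5 * fps_X ^ 3
     + fps_X ^ 2 * (fps_const (1 / 2) * fps_radical root 2 (1 - 4 * fps_X ^ 2 :: real fps))"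
proof -
  define x l c where "x = (fps_X :: real fps)" and "l = (gf blocks :: real fps)"
    and "c = (fps_const (1 / 2) :: real fps)"
  have c: "2 * c = 1" "fps_const (25 / 2) = 25 * c"
    by (simp_all add: c_def numeral_fps_const)
  have "(1 - 2 * x) * (1 - 5 * x + 2 * x ^ 2 + x ^ 2 * l)
      = 1 - 7 * x + 25 * c * x ^ 2 - 5 * x ^ 3 + x ^ 2 * (c * ((1 - 2 * x) * (2 * l - 1)))"
    using c(1) by Groebner_Basis.algebra
  then show ?thesis
    unfolding euler_def gf_blocks_radical[symmetric] c(2) x_def l_def c_def[symmetric] .
qed

text \<open>
  Dividing a quadratic equation for \<open>q = 1 / f\<close> by \<open>q\<^sup>2\<close> gives one for \<open>f\<close>, which is nontrivial in every
  characteristic because its constant coefficient is \<open>1\<close>.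
\<close>

lemma algebraic_function_quadratic:
  fixes f q :: "'k::field fps" and p0 p1 :: "'k poly"
  assumes "f * q = 1" and "q ^ 2 + fps_of_poly p1 * q + fps_of_poly p0 = 0"
  shows "algebraic_function f"
proof -
  let ?C = "\<lambda>p :: 'k poly. fps_to_fls (fps_of_poly p)"
  have rational: "?C p \<in> rational_functions" for p
    unfolding rational_functions_def by (intro CollectI exI[of _ p] exI[of _ 1]) simp
  have "1 + fps_of_poly p1 * f + fps_of_poly p0 * f ^ 2
      = f ^ 2 * (q ^ 2 + fps_of_poly p1 * q + fps_of_poly p0)"
    using assms(1) by Groebner_Basis.algebra
  then have z: "1 + fps_of_poly p1 * f + fps_of_poly p0 * f ^ 2 = 0" using assms(2) by simp
  let ?p = "[:?C 1, ?C p1, ?C p0:]"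
  have "poly ?p (fps_to_fls f) = fps_to_fls (1 + fps_of_poly p1 * f + fps_of_poly p0 * f ^ 2)"
    by (simp add: fls_times_fps_to_fls power2_eq_square algebra_simps)
  then have "poly ?p (fps_to_fls f) = 0" unfolding z by simp
  moreover have "coeff ?p i \<in> rational_functions" for i
    using rational[of 0] rational[of 1] rational[of p1] rational[of p0]
    by (auto simp: coeff_pCons split: nat.split)
  moreover have "?p \<noteq> 0" by simp
  ultimately show ?thesis unfolding algebraic_function_def by blast
qed

lemma algebraic_gf_normal: "algebraic_function (gf normal_words :: 'k::field fps)"
proof -
  define x where "x = ([:0, 1:] :: 'k poly)"
  have x: "fps_of_poly x = fps_X" by (simp add: x_def)
  show ?thesis
    by (rule algebraic_function_quadratic[OF gf_normal_euler,
        of "(2 * x - 1) * (5 * x ^ 2 - 10 * x + 2)"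
           "(2 * x - 1) * (13 * x ^ 5 - 56 * x ^ 4 + 85 * x ^ 3 - 50 * x ^ 2 + 12 * x - 1)"])
       (simp add: fps_of_poly_mult fps_of_poly_diff fps_of_poly_add fps_of_poly_power x euler_quadratic)
qed

lemma hilbert_A: "hilbert_series (idealA :: (letter, 'k::field) falg set) = (gf normal_words :: 'c::comm_ring_1 fps)"
  unfolding normal_form.hilbert_series_normal[OF normal_form_A finite_letter]
  by (simp add: gf_def normal_words_def del: nfA_simps)

lemma hilbert_B: "hilbert_series (idealB :: (letter, 'k::field) falg set) = (gf normal_words :: 'c::comm_ring_1 fps)"
  unfolding normal_form.hilbert_series_normal[OF normal_form_B finite_letter]
  by (simp add: gf_def normal_words_def del: nfA_simps)

lemma chains3_eq:
  "chains3 = conc {[La'], [Lb']} (conc {[La], [Lb]} {[Ly]}) \<union> conc {[La'], [Lb']} xLy_words"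
proof -
  have conc_UN: "conc A B = (\<Union>u\<in>A. (\<lambda>v. u @ v) ` B)" for A B :: "letter list set"
    unfolding conc_def by blast
  have "conc {[La'], [Lb']} (conc {[La], [Lb]} {[Ly]}) = {[p, c, Ly] | p c. primed p \<and> (c = La \<or> c = Lb)}"
    unfolding conc_UN by auto
  moreover have "conc {[La'], [Lb']} xLy_words = {p # Lx # w @ [Ly] | p w. primed p \<and> w \<in> blocks}"
    unfolding conc_UN xLy_words_def by auto
  ultimately show ?thesis by (simp only: chains3_def)
qed

theorem theorem8p1:
  fixes I J :: "(letter list \<Rightarrow>\<^sub>0 'k::field) set" and L xLy :: "letter list set"
    and E :: "real fps"
  assumes I_def: "I = genideal free_alg
      (binomials_i \<union> binomials_ii \<union> binomials_iii \<union> {var Lx * var Ly})"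
    and J_def: "J = LM glex I"
    and L_def: "L = lang_star (conc dyck {[Le]})"
    and xLy_def: "xLy = conc {[Lx]} (conc L {[Ly]})"
    and E_def: "E = 1 / hilbert_series I"
  shows
    "(let M = lm glex ` (binomials_i \<union> binomials_ii \<union> binomials_iii
                          :: (letter list \<Rightarrow>\<^sub>0 'k) set)
      in finite M \<and> M \<inter> xLy = {} \<and> unambiguous_cfl xLy \<and> chain_lang J 1 = M \<union> xLy) \<and>
     has_global_dimension (quot_alg I) (quot_grade I) 3 \<and>
     has_global_dimension (quot_alg J) (quot_grade J) 3 \<and>
     chain_lang J 2 =
       conc {[La'], [Lb']} (conc {[La], [Lb]} {[Ly]}) \<union> conc {[La'], [Lb']} xLy \<and>
     homologically_unambiguous J \<and>
     (hilbert_series I :: rat fps) = hilbert_series J \<and>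
     algebraic_function (hilbert_series I :: rat fps) \<and>
     algebraic_function (hilbert_series I :: 'k fps) \<and>
     E ^ 2 + (2 * fps_X - 1) * (5 * fps_X ^ 2 - 10 * fps_X + 2) * E
       + (2 * fps_X - 1) * (13 * fps_X ^ 5 - 56 * fps_X ^ 4 + 85 * fps_X ^ 3
                             - 50 * fps_X ^ 2 + 12 * fps_X - 1) = 0 \<and>
     (hilbert_series I :: real fps) =
       inverse (1 - 7 * fps_X + fps_const (25 / 2) * fps_X ^ 2 - 5 * fps_X ^ 3
                + fps_X ^ 2 * (fps_const (1 / 2) * fps_radical root 2 (1 - 4 * fps_X ^ 2)))"
proof -
  have I: "I = idealA" by (simp add: I_def idealA_def)
  have J: "J = idealB" by (simp add: J_def I LM_idealA)
  have xLy: "xLy = xLy_words" by (simp add: xLy_def L_def lang_star_eq xLy_eq)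
  have H: "(hilbert_series I :: real fps) * euler = 1"
    unfolding I hilbert_A by (rule gf_normal_euler)
  have "((hilbert_series I :: real fps) * euler) $ 0 = 1" unfolding H by simp
  then have "(hilbert_series I :: real fps) $ 0 \<noteq> 0" by auto
  then have E: "E = euler"
    using fps_inverse_unique[OF H] by (simp add: E_def fps_divide_unit)
  have M: "lm glex ` (binomials_i \<union> binomials_ii \<union> binomials_iii :: (letter list \<Rightarrow>\<^sub>0 'k) set) = rule_pairs"
    by (rule lm_binomials)
  have 1: "finite rule_pairs \<and> rule_pairs \<inter> xLy = {} \<and> unambiguous_cfl xLy \<and>
      chain_lang J 1 = rule_pairs \<union> xLy"
    unfolding xLy chain_lang_B(1)[OF J]
    using finite_rule_pairs rule_pairs_xLy unambiguous_xLy
    by (simp add: obstructions_def rule_pairs_def)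
  have 2: "(hilbert_series I :: real fps) =
       inverse (1 - 7 * fps_X + fps_const (25 / 2) * fps_X ^ 2 - 5 * fps_X ^ 3
                + fps_X ^ 2 * (fps_const (1 / 2) * fps_radical root 2 (1 - 4 * fps_X ^ 2)))"
    unfolding euler_radical[symmetric]
    by (rule fps_inverse_unique[symmetric]) (subst mult.commute, rule H)
  show ?thesis
    unfolding M Let_def
  proof (intro conjI)
    show "has_global_dimension (quot_alg I) (quot_grade I) 3"
      unfolding I by (rule global_dimension_A)
    show "has_global_dimension (quot_alg J) (quot_grade J) 3"
      unfolding J by (rule global_dimension_B)
    show "chain_lang J 2 =
       conc {[La'], [Lb']} (conc {[La], [Lb]} {[Ly]}) \<union> conc {[La'], [Lb']} xLy"
      unfolding chain_lang_B(2)[OF J] xLy by (rule chains3_eq)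
    show "homologically_unambiguous J"
      unfolding J by (rule homologically_unambiguous_B)
    show "(hilbert_series I :: rat fps) = hilbert_series J"
      unfolding I J hilbert_A hilbert_B ..
    show "algebraic_function (hilbert_series I :: rat fps)"
      unfolding I hilbert_A by (rule algebraic_gf_normal)
    show "algebraic_function (hilbert_series I :: 'k fps)"
      unfolding I hilbert_A by (rule algebraic_gf_normal)
    show "E ^ 2 + (2 * fps_X - 1) * (5 * fps_X ^ 2 - 10 * fps_X + 2) * E
       + (2 * fps_X - 1) * (13 * fps_X ^ 5 - 56 * fps_X ^ 4 + 85 * fps_X ^ 3
                             - 50 * fps_X ^ 2 + 12 * fps_X - 1) = 0"
      unfolding E by (rule euler_quadratic)
  qed (use 1 2 in blast)+
qed

end
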